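(* Let $K=\mathbb{F}_q(t)$ and let $\phi(x)=\dfrac{\sum_{i=0}^d a_i x^i}{\sum_{i=0}^d b_i x^i}\in K(x)$, with $a_i,b_i\in K$, be a rational function of degree $d\geq 2$ satisfying: (1) the system of seven linear equations, for $0\le n\le 6$, $$-\Big(\sum_{i=0}^n a_{d-i}a_{d-n+i}\Big)a-\Big(\sum_{i=0}^n a_{d-i}b_{d-n+i}\Big)b-\Big(\sum_{i=0}^n b_{d-i}b_{d-n+i}\Big)c+\Big(\sum_{i=0}^{n+1}(n+1-2i)\,a_{d-i}b_{d-n-1+i}\Big)e+\Big(\sum_{i=0}^{n}(n-2i)\,a_{d-i}b_{d-n+i}\Big)f+\Big(\sum_{i=0}^{n-1}(n-1-2i)\,a_{d-i}b_{d-n+1+i}\Big)g=r_n,$$ where $r_n=\sum_{i=0}^n a_{d-i}b_{d-n+i}'-\sum_{i=0}^n b_{d-i}a_{d-n+i}'$, has no solution $(a,b,c,e,f,g)\in K^6$; (2) $\infty$ is not in the forward orbit $\{\phi^k(\gamma):k\ge 1\}$ of any critical point $\gamma\in\mathbb{P}^1(\overline{K})$ of $\phi$. Let $\alpha\in K$ be a wandering point for $\phi$, and for each $n\ge1$ write $\phi^n(\alpha)=A_n(t)/B_n(t)$ with $A_n,B_n\in\mathbb{F}_q[t]$ coprime. Then $$\limsup_{n\to\infty}\frac{\deg(A_n)}{\deg(B_n)}\le 2.$$ In particular, $\{\phi^n(\alpha)\}_{n\ge1}$ contains only finitely many polynomials. Additionally, if the rational function $\psi(x)=1/\phi(1/x)=\dfrac{\sum_{i=0}^d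 b_{d-i}x^i}{\sum_{i=0}^d a_{d-i}x^i}$ also satisfies conditions (1) and (2) (with its own coefficients in place of those of $\phi$), then $$\frac12\le\liminf_{n\to\infty}\frac{\deg(A_n)}{\deg(B_n)}\le\limsup_{n\to\infty}\frac{\deg(A_n)}{\deg(B_n)}\le 2.$$
   Context: $'$ denotes the derivation $d/dt$ on $K=\mathbb{F}_q(t)$. In the linear system, coefficients $a_j,b_j$ with negative index $j$ are taken to be zero; empty sums are zero. The unknowns are $a,b,c,e,f,g$ (these letters are unknowns, not coefficients of $\phi$). A critical point of $\phi$ is a point of $\mathbb{P}^1(\overline{K})$ at which $\phi$ has ramification index greater than $1$. A point $\alpha\in K$ is wandering for $\phi$ if its orbit $\{\phi^n(\alpha)\}_{n\ge1}$ is infinite. *)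

theory Defs
  imports
    "HOL-Algebra.Algebraic_Closure_Type"
    "HOL-Computational_Algebra.Fraction_Field"
    "HOL-Library.Extended_Real"
    "HOL-Library.Liminf_Limsup"
begin

text \<open>
  The field $F_q(t)$ is \<open>'q poly fract\<close> for a type \<open>'q\<close> of sort \<open>{field, finite}\<close>.  On the fraction
  field of a polynomial ring, \<open>ddt\<close> is the derivation $d/dt$, given by the quotient rule.
\<close>

definition ddt :: "'q::field poly fract \<Rightarrow> 'q poly fract"
  where "ddt x = (THE y. \<exists>u v. v \<noteq> 0 \<and> x = Fract u v \<and>
                    y = Fract (pderiv u * v - u * pderiv v) (v * v))"

lemma ddt_Fract:
  assumes "v \<noteq> 0"
  shows "ddt (Fract u v) = Fract (pderiv u * v - u * pderiv v) (v * v)"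
proof -
  have "Fract (pderiv u' * v' - u' * pderiv v') (v' * v') =
        Fract (pderiv u * v - u * pderiv v) (v * v)"
    if v': "v' \<noteq> 0" and "Fract u v = Fract u' v'" for u' v'
  proof -
    have eq: "u * v' = u' * v"
      using that assms by (simp add: eq_fract)
    have "pderiv u * v' + u * pderiv v' = pderiv u' * v + u' * pderiv v"
      using arg_cong[OF eq, of pderiv] by (simp add: pderiv_mult algebra_simps)
    moreover have "(pderiv u * v - u * pderiv v) * (v' * v') - (pderiv u' * v' - u' * pderiv v') * (v * v) =
        v * v' * ((pderiv u * v' + u * pderiv v') - (pderiv u' * v + u' * pderiv v))
        + (u' * v - u * v') * (v' * pderiv v + v * pderiv v')"
      by (simp add: algebra_simps)
    ultimately have "(pderiv u * v - u * pderiv v) * (v' * v') =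
                  (pderiv u' * v' - u' * pderiv v') * (v * v)"
      using eq by simp
    with assms v' show ?thesis by (simp add: eq_fract)
  qed
  with assms show ?thesis
    unfolding ddt_def by (intro the_equality) blast+
qed

text \<open>
  A rational function of degree \<open>d\<close> over a field is given by coefficient sequences \<open>a\<close> (numerator) and
  \<open>b\<close> (denominator), of which only the entries with index at most \<open>d\<close> matter.  Its degree is the
  maximum of the degrees of numerator and denominator in lowest terms; if a quotient of two
  polynomials of degree at most \<open>d\<close> has degree \<open>d\<close>, it is already in lowest terms.
\<close>

definition form :: "nat \<Rightarrow> (nat \<Rightarrow> 'k::field) \<Rightarrow> 'k poly"
  where "form d a = (\<Sum>i\<le>d. Polynomial.monom (a i) i)"

definition is_ratfun :: "nat \<Rightarrow> (nat \<Rightarrow> 'k::field) \<Rightarrow> (nat \<Rightarrow> 'k) \<Rightarrow> bool"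
  where "is_ratfun d a b \<longleftrightarrow>
    form d b \<noteq> 0 \<and> coprime (form d a) (form d b) \<and>
    max (Polynomial.degree (form d a)) (Polynomial.degree (form d b)) = d"

text \<open>The coefficients of $x^d p(1/x)$ for $p$ of degree at most $d$.\<close>

definition rev_coeffs :: "nat \<Rightarrow> (nat \<Rightarrow> 'k) \<Rightarrow> nat \<Rightarrow> 'k"
  where "rev_coeffs d a = (\<lambda>i. a (d - i))"

datatype 'k P1 = Fin 'k | Infty

definition ratio :: "'k::field \<Rightarrow> 'k \<Rightarrow> 'k P1"
  where "ratio u v = (if v = 0 then Infty else Fin (u / v))"

text \<open>
  The induced self-map of the projective line; this and the ramification index are meaningful under
  \<open>is_ratfun d a b\<close>.
\<close>

fun rat_map :: "nat \<Rightarrow> (nat \<Rightarrow> 'k::field) \<Rightarrow> (nat \<Rightarrow> 'k) \<Rightarrow> 'k P1 \<Rightarrow> 'k P1"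
  where
    "rat_map d a b (Fin x) = ratio (poly (form d a) x) (poly (form d b) x)"
  | "rat_map d a b Infty = ratio (a d) (b d)"

text \<open>
  The ramification index at \<open>\<gamma>\<close> is the order of vanishing at \<open>\<gamma>\<close> of a uniformizer at the image
  of \<open>\<gamma>\<close>, pulled back.  At a finite point \<open>x\<close> with image \<open>y\<close> this is the order of
  $(P - y Q)/Q$, whose denominator does not vanish at \<open>x\<close>; if the image is infinite it is
  the order of $Q/P$.  At infinity one uses the coordinate $1/x$, which replaces $P$ and $Q$ by
  their reversals and \<open>x\<close> by \<open>0\<close>.
\<close>

definition vanishing_order :: "'k::field poly \<Rightarrow> 'k poly \<Rightarrow> 'k \<Rightarrow> 'k P1 \<Rightarrow> nat"
  where "vanishing_order P Q x w =
    (case w of Fin y \<Rightarrow> Polynomial.order x (P - Polynomial.smult y Q) | Infty \<Rightarrow> Polynomial.order x Q)"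

fun ramification_index :: "nat \<Rightarrow> (nat \<Rightarrow> 'k::field) \<Rightarrow> (nat \<Rightarrow> 'k) \<Rightarrow> 'k P1 \<Rightarrow> nat"
  where
    "ramification_index d a b (Fin x) =
       vanishing_order (form d a) (form d b) x (rat_map d a b (Fin x))"
  | "ramification_index d a b Infty =
       vanishing_order (form d (rev_coeffs d a)) (form d (rev_coeffs d b)) 0 (rat_map d a b Infty)"

definition critical_point :: "nat \<Rightarrow> (nat \<Rightarrow> 'k::field) \<Rightarrow> (nat \<Rightarrow> 'k) \<Rightarrow> 'k P1 \<Rightarrow> bool"
  where "critical_point d a b \<gamma> \<longleftrightarrow> ramification_index d a b \<gamma> > 1"

definition forward_orbit :: "('s \<Rightarrow> 's) \<Rightarrow> 's \<Rightarrow> 's set"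
  where "forward_orbit f x = {(f ^^ k) x |k. k \<ge> 1}"

text \<open>
  Indices in the linear system are integers, since some of them are negative; coefficients of
  negative index are zero.
\<close>

definition zcoeff :: "(nat \<Rightarrow> 'k::zero) \<Rightarrow> int \<Rightarrow> 'k"
  where "zcoeff a j = (if j < 0 then 0 else a (nat j))"

definition linear_system ::
  "nat \<Rightarrow> (nat \<Rightarrow> 'q::field poly fract) \<Rightarrow> (nat \<Rightarrow> 'q poly fract) \<Rightarrow>
   'q poly fract \<Rightarrow> 'q poly fract \<Rightarrow> 'q poly fract \<Rightarrow>
   'q poly fract \<Rightarrow> 'q poly fract \<Rightarrow> 'q poly fract \<Rightarrow> bool"
  where "linear_system d \<alpha> \<beta> a b c e f g \<longleftrightarrow>
    (let A = zcoeff \<alpha>; B = zcoeff \<beta>; D = int d in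
     \<forall>n\<in>{0..6::int}.
       - (\<Sum>i=0..n. A (D - i) * A (D - n + i)) * a
       - (\<Sum>i=0..n. A (D - i) * B (D - n + i)) * b
       - (\<Sum>i=0..n. B (D - i) * B (D - n + i)) * c
       + (\<Sum>i=0..n+1. of_int (n + 1 - 2 * i) * A (D - i) * B (D - n - 1 + i)) * e
       + (\<Sum>i=0..n. of_int (n - 2 * i) * A (D - i) * B (D - n + i)) * f
       + (\<Sum>i=0..n-1. of_int (n - 1 - 2 * i) * A (D - i) * B (D - n + 1 + i)) * g
       = (\<Sum>i=0..n. A (D - i) * ddt (B (D - n + i)))
         - (\<Sum>i=0..n. B (D - i) * ddt (A (D - n + i))))"

definition condition1 ::
  "nat \<Rightarrow> (nat \<Rightarrow> 'q::field poly fract) \<Rightarrow> (nat \<Rightarrow> 'q poly fract) \<Rightarrow> bool"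
  where "condition1 d \<alpha> \<beta> \<longleftrightarrow> \<not> (\<exists>a b c e f g. linear_system d \<alpha> \<beta> a b c e f g)"

definition condition2 :: "nat \<Rightarrow> (nat \<Rightarrow> 'k::field) \<Rightarrow> (nat \<Rightarrow> 'k) \<Rightarrow> bool"
  where "condition2 d a b \<longleftrightarrow>
    (let a' = (\<lambda>i. to_ac (a i)); b' = (\<lambda>i. to_ac (b i)) in
     \<forall>\<gamma> :: 'k alg_closure P1.
       critical_point d a' b' \<gamma> \<longrightarrow> Infty \<notin> forward_orbit (rat_map d a' b') \<gamma>)"

definition wandering :: "nat \<Rightarrow> (nat \<Rightarrow> 'k::field) \<Rightarrow> (nat \<Rightarrow> 'k) \<Rightarrow> 'k \<Rightarrow> bool"
  where "wandering d a b x \<longleftrightarrow> infinite (forward_orbit (rat_map d a b) (Fin x))"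

text \<open>
  The quotient \<open>u / v\<close> of two polynomials as a point of the projective line over their fraction
  field; coprime \<open>u\<close> and \<open>v\<close> represent infinity exactly when \<open>v = 0\<close>.
\<close>

definition quot_point :: "'q::field poly \<Rightarrow> 'q poly \<Rightarrow> 'q poly fract P1"
  where "quot_point u v = ratio (Fract u 1) (Fract v 1)"

definition polynomial_points :: "'q::field poly fract P1 set"
  where "polynomial_points = {Fin (Fract p 1) |p. True}"

text \<open>
  In the extended reals, division by zero yields \<open>\<infinity>\<close> for a positive numerator and \<open>0\<close> for the
  numerator \<open>0\<close>, so the ratio is \<open>\<infinity>\<close> whenever \<open>u / v\<close> is a nonconstant polynomial. The case
  of two polynomials of degree \<open>0\<close> (which covers all constants, zero and infinity) arises for only
  finitely many points if the field of constants is finite.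
\<close>

definition degree_ratio :: "'q::field poly \<Rightarrow> 'q poly \<Rightarrow> ereal"
  where "degree_ratio u v = ereal (real (Polynomial.degree u)) / ereal (real (Polynomial.degree v))"

end

theory Submission
  imports Defs
begin

text \<open>
  For large \<open>m\<close> with $D = d^m$, write $\phi^{n+m}(\alpha)$ as $\phi^m$ applied to
  $x = \phi^n(\alpha) = u/v$.  Its denominator is, up to a bounded factor, the form $Q_m(u, v)$
  of degree \<open>D\<close>, which is small exactly if \<open>x\<close> is close, in the absolute value at infinity of
  $F_q(t)$, to a preimage $\beta$ of infinity under $\phi^m$.  By condition (2) these preimages
  are simple roots.  Counting coefficients gives polynomials \<open>A\<close>, \<open>B\<close> of degrees about \<open>D / 2\<close>
  with $A(\beta) \beta' = B(\beta)$, and comparing this with $A(x) x' - B(x)$ as in Osgood's theorem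
  yields $\deg Q_m(u, v) \ge (D / 2 - O(1)) \max(\deg u, \deg v)$, unless $\beta$ satisfies a
  Riccati equation.  By condition (1), $\phi$ does not map one Riccati derivation to another, so if
  a preimage under $\phi^m$ is Riccati, then its preimages under $\phi$ are not, except for some
  of degree at most \<open>2 d + 1\<close>, for which Liouville's inequality is good enough.  As \<open>D\<close> is
  arbitrarily large and numerators have degree at most $D \max(\deg u, \deg v) + O(1)$, the
  limit superior is at most \<open>2\<close>.
\<close>

section \<open>Comaximal polynomials and binary forms\<close>


text \<open>In positive characteristic Roth's theorem has no analogue and Liouville's exponent can
  be attained, so differentiation has to help. The exponent D / 2 is a count: modulo a polynomial of
  degree at most 2 k + 3, the k + 1 coefficients of A and the k + 3 coefficients of B leave one
  degree of freedom, and the congruence found has exponent k + 2. The two extra degrees of B match v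
  u' - u v', which is quadratic in (u, v). For k = 0 both sides of x' = B(x) therefore have the same
  weight, and no height bound for rational solutions results: this is the Riccati case, excluded by
  condition (1). Infinity may be among the preimages, so the estimates are made for binary forms of
  a prescribed degree. Roots are not adjoined: a statement on roots is a divisibility by a
  polynomial E all of whose roots have the property, and "close to a root of one factor, hence far
  from those of the other" becomes the fact that two forms without common zero are never both small.
  Only condition (2) is about actual roots in the algebraic closure.\<close>

definition comaximal :: "'a::comm_ring_1 \<Rightarrow> 'a \<Rightarrow> bool"
  where "comaximal f g \<longleftrightarrow> (\<exists>s t. s * f + t * g = 1)"

lemma comaximalI: "s * f + t * g = 1 \<Longrightarrow> comaximal f g"
  unfolding comaximal_def by blast

lemma comaximal_sym: "comaximal f g \<Longrightarrow> comaximal g f"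
  unfolding comaximal_def by (metis add.commute)

lemma comaximal_dvd_left:
  assumes "comaximal f g" "h dvd f"
  shows "comaximal h g"
proof -
  obtain s t where "s * f + t * g = 1"
    using assms unfolding comaximal_def by blast
  moreover obtain k where "f = h * k"
    using assms by blast
  ultimately have "(s * k) * h + t * g = 1"
    by (simp add: algebra_simps)
  then show ?thesis
    by (rule comaximalI)
qed

lemma comaximal_dvd_mult:
  assumes "comaximal f g" "f dvd g * h"
  shows "f dvd h"
proof -
  obtain s t where st: "s * f + t * g = 1"
    using assms unfolding comaximal_def by blast
  have "h = (s * f + t * g) * h"
    using st by simp
  also have "\<dots> = f * (s * h) + t * (g * h)"
    by (simp add: algebra_simps)
  finally show ?thesis
    using assms(2) by (metis dvd_add dvd_mult dvd_triv_left)
qed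

lemma comaximal_mult:
  assumes "comaximal f g" "comaximal f h"
  shows "comaximal f (g * h)"
proof -
  obtain s t where 1: "s * f + t * g = 1"
    using assms unfolding comaximal_def by blast
  obtain s' t' where 2: "s' * f + t' * h = 1"
    using assms unfolding comaximal_def by blast
  have "(s * s' * f + s * t' * h + t * s' * g) * f + (t * t') * (g * h) = (s * f + t * g) * (s' * f + t' * h)"
    by (simp add: algebra_simps)
  also have "\<dots> = 1"
    using 1 2 by simp
  finally show ?thesis
    by (rule comaximalI)
qed

lemma comaximal_1: "comaximal f 1"
  by (rule comaximalI[of 0 _ 1]) simp

lemma comaximal_power_right: "comaximal f g \<Longrightarrow> comaximal f (g ^ n)"
  by (induction n) (auto simp: comaximal_mult comaximal_1)

lemma comaximal_power: "comaximal f g \<Longrightarrow> comaximal (f ^ m) (g ^ n)"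
  by (meson comaximal_power_right comaximal_sym)

lemma comaximal_common_dvd:
  assumes "comaximal f g" "h dvd f" "h dvd g"
  shows "h dvd 1"
  using comaximal_dvd_mult[of h g 1] comaximal_dvd_left assms by auto

text \<open>Division with remainder: a nonzero element of least degree in the ideal generated by
  \<open>A\<close> and \<open>B\<close> divides every element of that ideal.\<close>

lemma field_poly_gcd:
  fixes A B :: "'k::field poly"
  assumes "A \<noteq> 0 \<or> B \<noteq> 0"
  obtains g A' B' where "g \<noteq> 0" "A = g * A'" "B = g * B'" "comaximal A' B'"
proof -
  define S where "S = {p. p \<noteq> 0 \<and> (\<exists>s t. p = s * A + t * B)}"
  have "A \<in> S \<or> B \<in> S"
    unfolding S_def using assms
    by simp (metis add.commute add_0 mult_1 mult_zero_left)
  then obtain g where g: "g \<in> S" and least: "\<And>p. p \<in> S \<Longrightarrow> degree g \<le> degree p"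
    using exists_least_iff[of "\<lambda>n. \<exists>p\<in>S. degree p = n"] by (metis not_le)
  then obtain s t where st: "g = s * A + t * B" and "g \<noteq> 0"
    unfolding S_def by blast
  have dvd: "g dvd s' * A + t' * B" for s' t'
  proof (rule ccontr)
    assume not_dvd: "\<not> g dvd s' * A + t' * B"
    define p where "p = s' * A + t' * B"
    have ne: "p mod g \<noteq> 0"
      using not_dvd unfolding p_def by (simp add: mod_eq_0_iff_dvd)
    have "p mod g = p - (p div g) * g"
      by (metis minus_div_mult_eq_mod)
    also have "\<dots> = (s' - (p div g) * s) * A + (t' - (p div g) * t) * B"
      unfolding st by (simp add: p_def algebra_simps)
    finally have "p mod g \<in> S"
      using ne unfolding S_def by blast
    then have "degree g \<le> degree (p mod g)"
      by (rule least)
    then show False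
      using degree_mod_less[OF \<open>g \<noteq> 0\<close>, of p] ne by simp
  qed
  obtain A' where A': "A = g * A'"
    using dvd[of 1 0] by auto
  obtain B' where B': "B = g * B'"
    using dvd[of 0 1] by auto
  have "g * (s * A' + t * B') = g * 1"
    using st A' B' by (simp add: algebra_simps)
  then have "s * A' + t * B' = 1"
    using \<open>g \<noteq> 0\<close> by (metis mult_cancel_left)
  then show ?thesis
    using that[of g A' B'] A' B' \<open>g \<noteq> 0\<close> comaximalI by blast
qed

text \<open>Bezout identities replace \<open>coprime\<close> from here on, because they survive
  substitution into forms and transport to the algebraic closure.\<close>

lemma coprime_imp_comaximal:
  fixes A B :: "'k::field poly"
  assumes "coprime A B"
  shows "comaximal A B"
proof -
  have "A \<noteq> 0 \<or> B \<noteq> 0"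
    using assms by auto
  then obtain g A' B' where g: "g \<noteq> 0" "A = g * A'" "B = g * B'" "comaximal A' B'"
    by (rule field_poly_gcd)
  then have "is_unit g"
    using assms unfolding coprime_def by simp
  then obtain h where h: "1 = g * h"
    by blast
  from g(4) obtain s t where st: "s * A' + t * B' = 1"
    unfolding comaximal_def by blast
  have "(s * h) * A + (t * h) * B = (g * h) * (s * A' + t * B')"
    unfolding g by (simp add: algebra_simps)
  also have "\<dots> = 1"
    using st h by simp
  finally show ?thesis
    by (rule comaximalI)
qed

text \<open>
  \<open>binform \<iota> n f u v\<close> is the value at \<open>(u, v)\<close> of the binary form $Y^n f(X/Y)$ of degree \<open>n\<close>, with
  coefficients transported along \<open>\<iota>\<close>.  Its factor $Y^{n - \deg f}$ makes infinity a root.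
\<close>

definition binform :: "('k::comm_ring_1 \<Rightarrow> 'r::comm_ring_1) \<Rightarrow> nat \<Rightarrow> 'k poly \<Rightarrow> 'r \<Rightarrow> 'r \<Rightarrow> 'r"
  where "binform \<iota> n f u v = (\<Sum>i\<le>n. \<iota> (coeff f i) * u ^ i * v ^ (n - i))"

text \<open>Two instances matter: with \<open>[:c:]\<close> polynomials are substituted into a form,
  with the identity a form is evaluated in the field.\<close>

locale coeff_hom =
  fixes \<iota> :: "'k::comm_ring_1 \<Rightarrow> 'r::comm_ring_1"
  assumes hom_add: "\<iota> (x + y) = \<iota> x + \<iota> y"
    and hom_mult: "\<iota> (x * y) = \<iota> x * \<iota> y"
    and hom_one: "\<iota> 1 = 1"
begin

lemma hom_zero: "\<iota> 0 = 0"
  using hom_add[of 0 0] by simp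

lemma binform_add: "binform \<iota> n (f + g) u v = binform \<iota> n f u v + binform \<iota> n g u v"
  by (simp add: binform_def hom_add algebra_simps sum.distrib)

lemma binform_smult: "binform \<iota> n (smult c f) u v = \<iota> c * binform \<iota> n f u v"
  by (simp add: binform_def hom_mult algebra_simps sum_distrib_left)

lemma binform_0: "binform \<iota> n 0 u v = 0"
  by (simp add: binform_def hom_zero)

lemma binform_pCons:
  "binform \<iota> (Suc n) (pCons c f) u v = \<iota> c * v ^ Suc n + u * binform \<iota> n f u v"
  unfolding binform_def sum.atMost_Suc_shift by (simp add: algebra_simps sum_distrib_left)

lemma binform_Suc:
  assumes "degree f \<le> n"
  shows "binform \<iota> (Suc n) f u v = v * binform \<iota> n f u v"
proof -
  have "coeff f (Suc n) = 0"
    using assms by (simp add: coeff_eq_0)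
  then show ?thesis
    by (simp add: binform_def hom_zero sum_distrib_left Suc_diff_le algebra_simps)
qed

lemma binform_const: "binform \<iota> n [:c:] u v = \<iota> c * v ^ n"
proof (cases n)
  case 0
  then show ?thesis by (simp add: binform_def)
next
  case (Suc m)
  then show ?thesis by (simp add: binform_pCons binform_0)
qed

lemma binform_1: "binform \<iota> n 1 u v = v ^ n"
  using binform_const[of n 1 u v] by (simp add: hom_one one_pCons)

lemma binform_linear: "binform \<iota> 1 [:c, e:] u v = \<iota> c * v + \<iota> e * u"
  using binform_pCons[of 0 c "[:e:]" u v] binform_const[of 0 e u v] by (simp add: algebra_simps)

lemma binform_mult:
  "degree f \<le> m \<Longrightarrow> degree g \<le> n \<Longrightarrow>
     binform \<iota> (m + n) (f * g) u v = binform \<iota> m f u v * binform \<iota> n g u v"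
proof (induction m arbitrary: f)
  case 0
  then obtain c where "f = [:c:]"
    by (metis degree_eq_zeroE le_zero_eq)
  then show ?case
    by (simp add: binform_smult binform_const)
next
  case (Suc m)
  obtain c h where f: "f = pCons c h"
    by (cases f)
  have h: "degree h \<le> m"
    using Suc.prems(1) unfolding f by (simp add: degree_pCons_eq_if split: if_splits)
  have shift: "binform \<iota> (k + n) g u v = v ^ k * binform \<iota> n g u v" for k
    by (induction k) (use Suc.prems(2) in \<open>auto simp: binform_Suc algebra_simps\<close>)
  have "binform \<iota> (Suc m + n) (f * g) u v =
    \<iota> c * binform \<iota> (Suc m + n) g u v + binform \<iota> (Suc (m + n)) (pCons 0 (h * g)) u v"
    unfolding f mult_pCons_left binform_add binform_smult by simp
  also have "\<dots> = \<iota> c * (v ^ Suc m * binform \<iota> n g u v) + u * (binform \<iota> m h u v * binform \<iota> n g u v)"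
    using Suc.IH[OF h Suc.prems(2)] by (simp only: shift binform_pCons) (simp add: hom_zero)
  also have "\<dots> = binform \<iota> (Suc m) f u v * binform \<iota> n g u v"
    unfolding f binform_pCons by (simp add: algebra_simps)
  finally show ?case .
qed

lemma binform_lift:
  assumes "degree f \<le> n"
  shows "binform \<iota> (k + n) f u v = v ^ k * binform \<iota> n f u v"
  using binform_mult[of 1 k f n u v] assms by (simp add: binform_1)

lemma binform_X_power: "binform \<iota> n (Polynomial.monom 1 n) u v = u ^ n"
proof (induction n)
  case 0
  then show ?case by (simp add: binform_def hom_one)
next
  case (Suc n)
  then show ?case by (simp add: monom_Suc binform_pCons hom_zero)
qed

end

interpretation const_hom: coeff_hom "\<lambda>c. [:c:]"
  by standard (auto simp: one_pCons)

interpretation id_hom: coeff_hom "\<lambda>c. c"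
  by standard auto

abbreviation form_comp :: "nat \<Rightarrow> 'k::comm_ring_1 poly \<Rightarrow> 'k poly \<Rightarrow> 'k poly \<Rightarrow> 'k poly"
  where "form_comp \<equiv> binform (\<lambda>c. [:c:])"

lemma degree_form_comp:
  assumes "degree P \<le> d" "degree Q \<le> d"
  shows "degree (form_comp n f P Q) \<le> n * d"
  unfolding binform_def
proof (rule degree_sum_le)
  fix i assume "i \<in> {..n}"
  have "degree (P ^ i * Q ^ (n - i)) \<le> degree P * i + degree Q * (n - i)"
    by (meson add_mono degree_mult_le degree_power_le order_trans)
  also have "\<dots> \<le> d * i + d * (n - i)"
    using assms by (intro add_mono mult_mono) auto
  also have "\<dots> = n * d"
    using \<open>i \<in> _\<close> by (simp flip: distrib_left)
  finally have "degree (P ^ i * Q ^ (n - i)) \<le> n * d" .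
  then show "degree ([:coeff f i:] * P ^ i * Q ^ (n - i)) \<le> n * d"
    by (simp add: mult.assoc) (meson degree_smult_le order_trans)
qed simp

context coeff_hom
begin

lemma binform_power:
  "degree f \<le> m \<Longrightarrow> binform \<iota> (k * m) (f ^ k) u v = binform \<iota> m f u v ^ k"
proof (induction k)
  case 0
  then show ?case by (simp add: binform_1)
next
  case (Suc k)
  have "degree (f ^ k) \<le> k * m"
    by (metis Suc.prems degree_power_le mult.commute mult_le_mono1 order_trans)
  then show ?case
    using Suc binform_mult[of f m "f ^ k" "k * m" u v] by simp
qed

text \<open>This turns the recursion of \<open>iterate_denominator\<close> into iteration of values,
  and makes reversal commute with substitution.\<close>

lemma binform_comp:
  assumes PQ: "degree P \<le> d" "degree Q \<le> d"
  shows "degree f \<le> n \<Longrightarrow> binform \<iota> (n * d) (form_comp n f P Q) u v =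
    binform \<iota> n f (binform \<iota> d P u v) (binform \<iota> d Q u v)"
proof (induction n arbitrary: f)
  case 0
  then show ?case
    by (simp add: binform_def)
next
  case (Suc n)
  obtain c h where f: "f = pCons c h"
    by (cases f)
  have h: "degree h \<le> n"
    using Suc.prems(1) unfolding f by (simp add: degree_pCons_eq_if split: if_splits)
  have "binform \<iota> (Suc n * d) (form_comp (Suc n) f P Q) u v =
    \<iota> c * binform \<iota> (Suc n * d) (Q ^ Suc n) u v + binform \<iota> (d + n * d) (P * form_comp n h P Q) u v"
    unfolding f const_hom.binform_pCons by (simp add: binform_add binform_smult)
  also have "\<dots> = \<iota> c * binform \<iota> d Q u v ^ Suc n + binform \<iota> d P u v * binform \<iota> (n * d) (form_comp n h P Q) u v"
    using PQ degree_form_comp[OF PQ] by (simp only: binform_power binform_mult)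
  also have "\<dots> = binform \<iota> (Suc n) f (binform \<iota> d P u v) (binform \<iota> d Q u v)"
    unfolding f binform_pCons Suc.IH[OF h] ..
  finally show ?case .
qed

end

text \<open>The assumption \<open>exact\<close> says that infinity is not a common zero of the forms
  of degrees \<open>m\<close> and \<open>n\<close>. The polynomial that attains its prescribed
  degree serves as modulus: the cofactor of the other one is reduced modulo it, and comparing
  degrees bounds the remaining cofactor.\<close>

lemma comaximal_solve:
  fixes F G :: "'k::field poly"
  assumes FG: "comaximal F G" and deg: "degree F \<le> m" "degree G \<le> n"
    and exact: "coeff F m \<noteq> 0 \<or> coeff G n \<noteq> 0"
    and N: "m + n \<le> N" "degree p \<le> N"
  shows "\<exists>s t. degree s \<le> N - m \<and> degree t \<le> N - n \<and> s * F + t * G = p"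
proof -
  have main: "\<exists>s t. degree s \<le> N - m \<and> degree t \<le> N - n \<and> s * F + t * G = p"
    if FG: "comaximal F G" and deg: "degree F \<le> m" "degree G \<le> n"
    and exact: "coeff F m \<noteq> 0"
    and N: "m + n \<le> N" "degree p \<le> N" for F G :: "'k poly" and m n
  proof -
    have degF: "degree F = m" "F \<noteq> 0"
      using exact deg(1) le_degree[OF exact] by auto
    obtain s0 t0 where st0: "s0 * F + t0 * G = 1"
      using FG unfolding comaximal_def by blast
    define t where "t = (p * t0) mod F"
    define s where "s = p * s0 + ((p * t0) div F) * G"
    have t_eq: "t = p * t0 - (p * t0) div F * F"
      unfolding t_def by (metis minus_div_mult_eq_mod)
    have "s * F + t * G = p * (s0 * F + t0 * G)"
      unfolding s_def t_eq by (simp add: algebra_simps)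
    then have eq: "s * F + t * G = p"
      using st0 by simp
    have t: "t = 0 \<or> degree t < m"
      using degree_mod_less[OF \<open>F \<noteq> 0\<close>, of "p * t0"] degF unfolding t_def by simp
    then have tG: "degree (t * G) \<le> N"
      using degree_mult_le[of t G] deg N by (cases "t = 0") auto
    have "s * F = p - t * G"
      using eq by (simp add: algebra_simps)
    then have "degree (s * F) \<le> N"
      using tG N by (simp add: degree_diff_le)
    then have "degree s \<le> N - m"
      using degF by (cases "s = 0") (auto simp: degree_mult_eq)
    moreover have "degree t \<le> N - n"
      using t N by auto
    ultimately show ?thesis
      using eq by blast
  qed
  show ?thesis
  proof (cases "coeff F m \<noteq> 0")
    case True
    then show ?thesis
      using main[of F G m n] assms by blast
  next
    case False
    then obtain s t where "degree s \<le> N - n" "degree t \<le> N - m" "s * G + t * F = p"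
      using main[of G F n m] assms comaximal_sym[OF FG] by (auto simp: add.commute)
    then show ?thesis
      by (metis add.commute)
  qed
qed

text \<open>Over a field: no common zero on the projective line. The Bezout identity takes care of
  the finite points, the top coefficients of infinity.\<close>

definition comaximal_forms :: "nat \<Rightarrow> 'k::comm_ring_1 poly \<Rightarrow> nat \<Rightarrow> 'k poly \<Rightarrow> bool"
  where "comaximal_forms m F n G \<longleftrightarrow> comaximal F G \<and> degree F \<le> m \<and> degree G \<le> n \<and>
    (coeff F m \<noteq> 0 \<or> coeff G n \<noteq> 0)"

lemma (in coeff_hom) comaximal_forms_combination:
  fixes F G :: "'k poly"
  assumes "\<exists>s t. degree s \<le> n \<and> degree t \<le> m \<and> s * F + t * G = p"
    and "degree F \<le> m" "degree G \<le> n"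
  shows "\<exists>s t. \<forall>u v. binform \<iota> n s u v * binform \<iota> m F u v + binform \<iota> m t u v * binform \<iota> n G u v
    = binform \<iota> (n + m) p u v"
proof -
  obtain s t where st: "degree s \<le> n" "degree t \<le> m" "s * F + t * G = p"
    using assms by blast
  have "binform \<iota> (n + m) p u v = binform \<iota> (n + m) (s * F) u v + binform \<iota> (m + n) (t * G) u v" for u v
    using st by (auto simp: binform_add[symmetric] add.commute)
  also have "\<dots> u v = binform \<iota> n s u v * binform \<iota> m F u v + binform \<iota> m t u v * binform \<iota> n G u v" for u v
    using st assms by (simp add: binform_mult)
  finally show ?thesis
    by metis
qed

text \<open>A homogeneous Nullstellensatz: the pure powers of both variables lie in the ideal of the
  two forms. In degree n + m the cofactors get the degrees n and m.\<close>

lemma comaximal_forms_powers: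
  fixes F G :: "'k::field poly" and \<iota> :: "'k \<Rightarrow> 'r::comm_ring_1"
  assumes "coeff_hom \<iota>" "comaximal_forms m F n G"
  obtains s t s' t' where
    "\<And>u v. binform \<iota> n s u v * binform \<iota> m F u v + binform \<iota> m t u v * binform \<iota> n G u v = u ^ (n + m)"
    "\<And>u v. binform \<iota> n s' u v * binform \<iota> m F u v + binform \<iota> m t' u v * binform \<iota> n G u v = v ^ (n + m)"
proof -
  interpret coeff_hom \<iota> by fact
  have FG: "comaximal F G" "degree F \<le> m" "degree G \<le> n" "coeff F m \<noteq> 0 \<or> coeff G n \<noteq> 0"
    using assms unfolding comaximal_forms_def by auto
  have "\<exists>s t. \<forall>u v. binform \<iota> n s u v * binform \<iota> m F u v + binform \<iota> m t u v * binform \<iota> n G u v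
    = binform \<iota> (n + m) p u v" if "degree p \<le> n + m" for p
    using comaximal_forms_combination[OF _ FG(2,3)] comaximal_solve[OF FG _ that] by simp
  from this[of "Polynomial.monom 1 (n + m)"] this[of 1] that show ?thesis
    unfolding binform_1 binform_X_power by (force simp: degree_monom_le)
qed


section \<open>The absolute value at infinity\<close>

text \<open>With base 2, degrees reappear as values of \<open>log 2\<close> in
  \<open>degree_estimates\<close>.\<close>

definition poly_norm :: "'q::field poly \<Rightarrow> real"
  where "poly_norm p = (if p = 0 then 0 else 2 ^ degree p)"

lemma poly_norm_0 [simp]: "poly_norm 0 = 0"
  and poly_norm_1 [simp]: "poly_norm 1 = 1"
  and poly_norm_eq_0_iff [simp]: "poly_norm p = 0 \<longleftrightarrow> p = 0"
  and poly_norm_nonneg [simp]: "poly_norm p \<ge> 0"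
  by (auto simp: poly_norm_def)

lemma poly_norm_ge_1: "p \<noteq> 0 \<Longrightarrow> poly_norm p \<ge> 1"
  by (auto simp: poly_norm_def)

lemma poly_norm_mult: "poly_norm (p * q) = poly_norm p * poly_norm q"
  by (auto simp: poly_norm_def degree_mult_eq power_add)

lemma poly_norm_leI: "p \<noteq> 0 \<Longrightarrow> degree q \<le> degree p \<Longrightarrow> poly_norm q \<le> poly_norm p"
  by (auto simp: poly_norm_def)

lemma poly_norm_add: "poly_norm (p + q) \<le> max (poly_norm p) (poly_norm q)"
proof (cases "p = 0 \<or> q = 0 \<or> p + q = 0")
  case True
  then show ?thesis
    by (auto simp: le_max_iff_disj)
next
  case False
  then show ?thesis
    using degree_add_le_max[of p q] by (auto simp: poly_norm_def max_def split: if_splits)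
qed

lemma poly_norm_uminus [simp]: "poly_norm (- p) = poly_norm p"
  by (simp add: poly_norm_def)

lemma poly_norm_pderiv: "poly_norm (pderiv p) \<le> poly_norm p"
proof (cases "p = 0")
  case False
  have "degree (pderiv p) \<le> degree p"
    by (rule degree_le) (auto simp: coeff_pderiv coeff_eq_0)
  then show ?thesis
    using False poly_norm_leI by blast
qed auto

definition fract_norm :: "'q::field poly fract \<Rightarrow> real"
  where "fract_norm x = (THE r. \<exists>u v. v \<noteq> 0 \<and> x = Fract u v \<and> r = poly_norm u / poly_norm v)"

lemma fract_norm_Fract:
  assumes "v \<noteq> 0"
  shows "fract_norm (Fract u v) = poly_norm u / poly_norm v"
proof -
  have "poly_norm u' / poly_norm v' = poly_norm u / poly_norm v"
    if "v' \<noteq> 0" "Fract u v = Fract u' v'" for u' v'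
  proof -
    have "poly_norm (u * v') = poly_norm (u' * v)"
      using that assms by (simp add: eq_fract)
    then show ?thesis
      using that(1) assms by (simp add: poly_norm_mult field_simps)
  qed
  with assms show ?thesis
    unfolding fract_norm_def by (intro the_equality) blast+
qed

lemma fract_norm_to_fract [simp]: "fract_norm (to_fract p) = poly_norm p"
  by (simp add: to_fract_def fract_norm_Fract)

lemma fract_norm_0 [simp]: "fract_norm 0 = 0"
  and fract_norm_1 [simp]: "fract_norm 1 = 1"
  using fract_norm_to_fract[of 0] fract_norm_to_fract[of 1] by auto

lemma fract_norm_nonneg [simp]: "fract_norm x \<ge> 0"
  by (cases x) (simp add: fract_norm_Fract)

lemma fract_norm_eq_0_iff [simp]: "fract_norm x = 0 \<longleftrightarrow> x = 0"
  by (cases x) (auto simp: fract_norm_Fract Zero_fract_def eq_fract)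

lemma fract_norm_mult: "fract_norm (x * y) = fract_norm x * fract_norm y"
  by (cases x; cases y) (auto simp: fract_norm_Fract poly_norm_mult)

lemma fract_norm_power: "fract_norm (x ^ n) = fract_norm x ^ n"
  by (induction n) (auto simp: fract_norm_mult)

lemma fract_norm_uminus [simp]: "fract_norm (- x) = fract_norm x"
  by (cases x) (auto simp: fract_norm_Fract)

lemma fract_norm_add: "fract_norm (x + y) \<le> max (fract_norm x) (fract_norm y)"
proof (cases x; cases y)
  fix a b c e assume *: "x = Fract a b" "b \<noteq> 0" "y = Fract c e" "e \<noteq> 0"
  then have "fract_norm (x + y) = poly_norm (a * e + c * b) / (poly_norm b * poly_norm e)"
    by (simp add: fract_norm_Fract poly_norm_mult)
  also have "\<dots> \<le> max (poly_norm (a * e)) (poly_norm (c * b)) / (poly_norm b * poly_norm e)"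
    by (intro divide_right_mono poly_norm_add) auto
  also have "\<dots> = max (poly_norm (a * e) / (poly_norm b * poly_norm e)) (poly_norm (c * b) / (poly_norm b * poly_norm e))"
    by (simp add: max_divide_distrib_right)
  also have "\<dots> = max (fract_norm x) (fract_norm y)"
    using * by (simp add: fract_norm_Fract poly_norm_mult)
  finally show ?thesis .
qed

lemma fract_norm_diff: "fract_norm (x - y) \<le> max (fract_norm x) (fract_norm y)"
  using fract_norm_add[of x "- y"] by simp

lemma fract_norm_add_le: "fract_norm (x + y) \<le> fract_norm x + fract_norm y"
  using fract_norm_add[of x y] fract_norm_nonneg[of x] fract_norm_nonneg[of y] by linarith

lemma fract_norm_sum_le: "fract_norm (\<Sum>i\<in>S. f i) \<le> (\<Sum>i\<in>S. fract_norm (f i))"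
proof (induction S rule: infinite_finite_induct)
  case (insert x F)
  then show ?case
    using fract_norm_add_le[of "f x" "sum f F"] by simp
qed auto

text \<open>The derivation does not raise degrees. Hence a small value of a form also has a small
  derivative, which is what the differential method exploits.\<close>

lemma fract_norm_ddt: "fract_norm (ddt x) \<le> fract_norm x"
proof (cases x)
  case (Fract a b)
  have "poly_norm (pderiv a * b - a * pderiv b) \<le> max (poly_norm (pderiv a * b)) (poly_norm (a * pderiv b))"
    using poly_norm_add[of "pderiv a * b" "- (a * pderiv b)"] by simp
  also have "\<dots> \<le> poly_norm a * poly_norm b"
    using poly_norm_pderiv[of a] poly_norm_pderiv[of b]
    by (auto simp: poly_norm_mult intro: mult_mono)
  finally have "poly_norm (pderiv a * b - a * pderiv b) / (poly_norm b * poly_norm b) \<le>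
      poly_norm a * poly_norm b / (poly_norm b * poly_norm b)"
    by (intro divide_right_mono) auto
  then show ?thesis
    using Fract by (simp add: ddt_Fract fract_norm_Fract poly_norm_mult)
qed

abbreviation fract_form :: "nat \<Rightarrow> 'q::field poly fract poly \<Rightarrow> 'q poly fract \<Rightarrow> 'q poly fract \<Rightarrow> 'q poly fract"
  where "fract_form \<equiv> binform (\<lambda>c. c)"

text \<open>For comaximal polynomials this is the multiplicative height of u / v.\<close>

definition pair_norm :: "'q::field poly fract \<Rightarrow> 'q poly fract \<Rightarrow> real"
  where "pair_norm u v = max (fract_norm u) (fract_norm v)"

lemma pair_norm_nonneg [simp]: "pair_norm u v \<ge> 0"
  by (simp add: pair_norm_def le_max_iff_disj)

lemma pair_norm_ge_1:
  assumes "comaximal u v"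
  shows "pair_norm (to_fract u) (to_fract v) \<ge> 1"
proof -
  have "u \<noteq> 0 \<or> v \<noteq> 0"
    using assms unfolding comaximal_def by auto
  then show ?thesis
    using poly_norm_ge_1[of u] poly_norm_ge_1[of v] by (auto simp: pair_norm_def)
qed

lemma fract_form_upper:
  obtains C where "C > 0" "\<And>u v. fract_norm (fract_form n f u v) \<le> C * pair_norm u v ^ n"
proof -
  define C where "C = (\<Sum>i\<le>n. fract_norm (coeff f i)) + 1"
  have "C > 0"
    unfolding C_def by (simp add: add_nonneg_pos sum_nonneg)
  moreover have "fract_norm (fract_form n f u v) \<le> C * pair_norm u v ^ n" for u v
  proof -
    have "fract_norm (fract_form n f u v) \<le> (\<Sum>i\<le>n. fract_norm (coeff f i * u ^ i * v ^ (n - i)))"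
      unfolding binform_def by (rule fract_norm_sum_le)
    also have "\<dots> \<le> (\<Sum>i\<le>n. fract_norm (coeff f i) * pair_norm u v ^ n)"
    proof (rule sum_mono)
      fix i assume "i \<in> {..n}"
      have "fract_norm u ^ i * fract_norm v ^ (n - i) \<le> pair_norm u v ^ i * pair_norm u v ^ (n - i)"
        by (intro mult_mono power_mono) (auto simp: pair_norm_def le_max_iff_disj)
      also have "\<dots> = pair_norm u v ^ n"
        using \<open>i \<in> _\<close> by (simp flip: power_add)
      finally show "fract_norm (coeff f i * u ^ i * v ^ (n - i)) \<le> fract_norm (coeff f i) * pair_norm u v ^ n"
        by (simp add: fract_norm_mult fract_norm_power mult.assoc mult_left_mono)
    qed
    also have "\<dots> \<le> C * pair_norm u v ^ n"
      by (simp add: C_def algebra_simps sum_distrib_left)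
    finally show ?thesis .
  qed
  ultimately show ?thesis
    using that by blast
qed

text \<open>A point cannot be close to zeros of both forms: the larger of u and v has its power of
  degree n + m in their ideal, so by the ultrametric inequality one of the two products reaches that
  size.\<close>

lemma comaximal_forms_lower:
  assumes "comaximal_forms m F n G"
  obtains c where "c > 0"
    "\<And>u v. c * pair_norm u v ^ m \<le> fract_norm (fract_form m F u v) \<or>
      c * pair_norm u v ^ n \<le> fract_norm (fract_form n G u v)"
proof -
  obtain s t s' t' where
    1: "\<And>u v. fract_form n s u v * fract_form m F u v + fract_form m t u v * fract_form n G u v = u ^ (n + m)" and
    2: "\<And>u v. fract_form n s' u v * fract_form m F u v + fract_form m t' u v * fract_form n G u v = v ^ (n + m)"
    using comaximal_forms_powers[OF id_hom.coeff_hom_axioms assms] by metis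
  obtain C1 where C1: "C1 > 0" "\<And>u v. fract_norm (fract_form n s u v) \<le> C1 * pair_norm u v ^ n"
    using fract_form_upper by blast
  obtain C2 where C2: "C2 > 0" "\<And>u v. fract_norm (fract_form m t u v) \<le> C2 * pair_norm u v ^ m"
    using fract_form_upper by blast
  obtain C1' where C1': "C1' > 0" "\<And>u v. fract_norm (fract_form n s' u v) \<le> C1' * pair_norm u v ^ n"
    using fract_form_upper by blast
  obtain C2' where C2': "C2' > 0" "\<And>u v. fract_norm (fract_form m t' u v) \<le> C2' * pair_norm u v ^ m"
    using fract_form_upper by blast
  define C where "C = max (max C1 C2) (max C1' C2')"
  have C: "C > 0" "C1 \<le> C" "C2 \<le> C" "C1' \<le> C" "C2' \<le> C"
    unfolding C_def using C1(1) by auto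
  have "inverse C * pair_norm u v ^ m \<le> fract_norm (fract_form m F u v) \<or>
      inverse C * pair_norm u v ^ n \<le> fract_norm (fract_form n G u v)" for u v
  proof -
    define M where "M = pair_norm u v"
    define x where "x = fract_norm (fract_form m F u v)"
    define y where "y = fract_norm (fract_form n G u v)"
    have nonneg: "M \<ge> 0" "x \<ge> 0" "y \<ge> 0"
      by (auto simp: M_def x_def y_def)
    have bound: "z \<le> C * M ^ n * x \<or> z \<le> C * M ^ m * y"
      if "z \<le> max (fract_norm p * x) (fract_norm q * y)"
        "fract_norm p \<le> c * M ^ n" "fract_norm q \<le> c' * M ^ m" "c \<le> C" "c' \<le> C" for z c c' and p q :: "'a poly fract"
    proof -
      have "c * M ^ n \<le> C * M ^ n" "c' * M ^ m \<le> C * M ^ m"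
        using that nonneg by (auto intro: mult_right_mono)
      then have "fract_norm p \<le> C * M ^ n" "fract_norm q \<le> C * M ^ m"
        using that by linarith+
      then have "fract_norm p * x \<le> C * M ^ n * x" "fract_norm q * y \<le> C * M ^ m * y"
        using nonneg by (auto intro: mult_right_mono)
      then show ?thesis
        using that(1) by linarith
    qed
    have "fract_norm u ^ (n + m) \<le> C * M ^ n * x \<or> fract_norm u ^ (n + m) \<le> C * M ^ m * y"
    proof (rule bound[where c = C1 and c' = C2])
      show "fract_norm u ^ (n + m) \<le> max (fract_norm (fract_form n s u v) * x) (fract_norm (fract_form m t u v) * y)"
        unfolding x_def y_def fract_norm_mult[symmetric] fract_norm_power[symmetric] 1[of u v, symmetric] by (rule fract_norm_add)
    qed (use C1(2)[of u v] C2(2)[of u v] C in \<open>simp_all add: M_def\<close>)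
    moreover have "fract_norm v ^ (n + m) \<le> C * M ^ n * x \<or> fract_norm v ^ (n + m) \<le> C * M ^ m * y"
    proof (rule bound[where c = C1' and c' = C2'])
      show "fract_norm v ^ (n + m) \<le> max (fract_norm (fract_form n s' u v) * x) (fract_norm (fract_form m t' u v) * y)"
        unfolding x_def y_def fract_norm_mult[symmetric] fract_norm_power[symmetric] 2[of u v, symmetric] by (rule fract_norm_add)
    qed (use C1'(2)[of u v] C2'(2)[of u v] C in \<open>simp_all add: M_def\<close>)
    moreover have "M = fract_norm u \<or> M = fract_norm v"
      unfolding M_def pair_norm_def by linarith
    ultimately have *: "M ^ (n + m) \<le> C * M ^ n * x \<or> M ^ (n + m) \<le> C * M ^ m * y"
      by metis
    have "inverse C * M ^ m \<le> x \<or> inverse C * M ^ n \<le> y"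
    proof (cases "M = 0")
      case False
      then have "M > 0"
        using nonneg by simp
      then have "M ^ m \<le> C * x \<or> M ^ n \<le> C * y"
        using * by (simp add: power_add mult.left_commute[of _ "M ^ _"] mult.assoc)
      then show ?thesis
        using C by (auto simp: field_simps)
    next
      case True
      \<comment> \<open>For u = v = 0 the bounds are trivial unless a degree is 0, where 0 ^ 0 =
        1.\<close>
      show ?thesis
      proof (cases "m = 0 \<or> n = 0")
        case False
        then show ?thesis
          using True nonneg by (auto simp: power_0_left)
      next
        case True
        then show ?thesis
          using \<open>M = 0\<close> * C nonneg by (auto simp: power_0_left field_simps split: if_splits)
      qed
    qed
    then show ?thesis
      unfolding M_def x_def y_def .
  qed
  then show ?thesis
    using that[of "inverse C"] C by simp
qed

subsection \<open>Integrality\<close>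

lemma to_fract_power: "to_fract (x ^ n) = to_fract x ^ n"
  by (induction n) auto

lemma to_fract_range_add: "x \<in> range to_fract \<Longrightarrow> y \<in> range to_fract \<Longrightarrow> x + y \<in> range to_fract"
  by (auto simp flip: to_fract_add)

lemma to_fract_range_mult: "x \<in> range to_fract \<Longrightarrow> y \<in> range to_fract \<Longrightarrow> x * y \<in> range to_fract"
  by (auto simp flip: to_fract_mult)

lemma to_fract_range_power: "x \<in> range to_fract \<Longrightarrow> x ^ n \<in> range to_fract"
  by (auto simp flip: to_fract_power)

lemma to_fract_range_sum: "(\<And>i. i \<in> S \<Longrightarrow> f i \<in> range to_fract) \<Longrightarrow> sum f S \<in> range to_fract"
proof (induction S rule: infinite_finite_induct)
  case (insert x S)
  then show ?case
    by (simp add: to_fract_range_add)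
qed (auto intro: range_eqI[of _ _ 0])

lemma to_fract_range_norm: "x \<in> range to_fract \<Longrightarrow> x \<noteq> 0 \<Longrightarrow> fract_norm x \<ge> 1"
  by (auto simp: poly_norm_ge_1)

lemma common_denominator:
  assumes "finite S"
  shows "\<exists>\<rho>. \<rho> \<noteq> 0 \<and> (\<forall>x\<in>S. to_fract \<rho> * x \<in> range to_fract)"
  using assms
proof (induction S rule: finite_induct)
  case empty
  then show ?case by (auto intro: exI[of _ 1])
next
  case (insert x S)
  then obtain \<rho> where \<rho>: "\<rho> \<noteq> 0" "\<forall>x\<in>S. to_fract \<rho> * x \<in> range to_fract"
    by blast
  obtain a b where x: "x = Fract a b" "b \<noteq> 0"
    by (cases x)
  have "to_fract (\<rho> * b) * x = to_fract \<rho> * to_fract a"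
    using x by (simp add: Fract_conv_to_fract)
  moreover have "to_fract (\<rho> * b) * y = to_fract b * (to_fract \<rho> * y)" for y
    by (simp add: algebra_simps)
  ultimately have "\<forall>y\<in>insert x S. to_fract (\<rho> * b) * y \<in> range to_fract"
    using \<rho>(2) by (metis insert_iff rangeI to_fract_range_mult)
  then show ?case
    using \<rho>(1) x(2) by (intro exI[of _ "\<rho> * b"]) auto
qed

lemma fract_form_integral:
  obtains \<rho> where "\<rho> \<noteq> 0"
    "\<And>u v. to_fract \<rho> * fract_form n f (to_fract u) (to_fract v) \<in> range to_fract"
proof -
  obtain \<rho> where \<rho>: "\<rho> \<noteq> 0" "\<forall>x\<in>coeff f ` {..n}. to_fract \<rho> * x \<in> range to_fract"
    using common_denominator[of "coeff f ` {..n}"] by auto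
  have "to_fract \<rho> * fract_form n f (to_fract u) (to_fract v) \<in> range to_fract" for u v
    unfolding binform_def sum_distrib_left mult.assoc[symmetric]
    by (intro to_fract_range_sum to_fract_range_mult[of "_ * _"] to_fract_range_power rangeI)
      (use \<rho>(2) in auto)
  then show ?thesis
    using that \<rho>(1) by blast
qed

text \<open>After a fixed denominator is cleared, a nonzero value is a nonzero polynomial and so has
  norm at least 1.\<close>

lemma fract_form_liouville:
  obtains c where "c > 0"
    "\<And>u v. fract_form n f (to_fract u) (to_fract v) \<noteq> 0 \<Longrightarrow> c \<le> fract_norm (fract_form n f (to_fract u) (to_fract v))"
proof -
  obtain \<rho> where \<rho>: "\<rho> \<noteq> 0"
    "\<And>u v. to_fract \<rho> * fract_form n f (to_fract u) (to_fract v) \<in> range to_fract"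
    using fract_form_integral by blast
  have "inverse (poly_norm \<rho>) \<le> fract_norm (fract_form n f (to_fract u) (to_fract v))"
    if "fract_form n f (to_fract u) (to_fract v) \<noteq> 0" for u v
    using to_fract_range_norm[OF \<rho>(2)[of u v]] that \<rho>(1) poly_norm_ge_1[OF \<rho>(1)]
    by (simp add: fract_norm_mult field_simps)
  then show ?thesis
    using that[of "inverse (poly_norm \<rho>)"] poly_norm_ge_1[OF \<rho>(1)] by simp
qed

text \<open>A resultant argument: up to fixed denominators, a common factor \<open>w\<close> of both
  values divides the pure powers of u and v of degree n + m. These are comaximal, so
  \<open>w\<close> divides a constant that does not depend on u and v.\<close>

lemma comaximal_forms_divisor:
  fixes F G :: "'q::field poly fract poly"
  assumes "comaximal_forms m F n G"
  obtains C where "C > 0"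
    "\<And>u v w a b. comaximal u v \<Longrightarrow> fract_form m F (to_fract u) (to_fract v) = w * to_fract a \<Longrightarrow>
      fract_form n G (to_fract u) (to_fract v) = w * to_fract b \<Longrightarrow> fract_norm w \<le> C"
proof -
  obtain s t s' t' where
    1: "\<And>u v. fract_form n s u v * fract_form m F u v + fract_form m t u v * fract_form n G u v = u ^ (n + m)" and
    2: "\<And>u v. fract_form n s' u v * fract_form m F u v + fract_form m t' u v * fract_form n G u v = v ^ (n + m)"
    using comaximal_forms_powers[OF id_hom.coeff_hom_axioms assms] by metis
  obtain r1 where r1: "r1 \<noteq> 0" "\<And>u v. to_fract r1 * fract_form n s (to_fract u) (to_fract v) \<in> range to_fract"
    using fract_form_integral by blast
  obtain r2 where r2: "r2 \<noteq> 0" "\<And>u v. to_fract r2 * fract_form m t (to_fract u) (to_fract v) \<in> range to_fract"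
    using fract_form_integral by blast
  obtain r3 where r3: "r3 \<noteq> 0" "\<And>u v. to_fract r3 * fract_form n s' (to_fract u) (to_fract v) \<in> range to_fract"
    using fract_form_integral by blast
  obtain r4 where r4: "r4 \<noteq> 0" "\<And>u v. to_fract r4 * fract_form m t' (to_fract u) (to_fract v) \<in> range to_fract"
    using fract_form_integral by blast
  define \<rho> where "\<rho> = r1 * r2 * r3 * r4"
  have "\<rho> \<noteq> 0"
    using r1 r2 r3 r4 unfolding \<rho>_def by simp
  have "fract_norm w \<le> poly_norm \<rho>"
    if uv: "comaximal u v" and w: "fract_form m F (to_fract u) (to_fract v) = w * to_fract a"
      "fract_form n G (to_fract u) (to_fract v) = w * to_fract b" for u v w a b
  proof -
    define U where "U = to_fract u"
    define V where "V = to_fract v"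
    obtain g h where "g * u ^ (n + m) + h * v ^ (n + m) = 1"
      using comaximal_power[OF uv] unfolding comaximal_def by blast
    then have gh: "to_fract g * U ^ (n + m) + to_fract h * V ^ (n + m) = 1"
      unfolding U_def V_def by (simp flip: to_fract_mult to_fract_add to_fract_power)
    \<comment> \<open>The cofactor of \<open>w\<close>. Each of the four forms takes its own
      denominator out of \<rho>, which makes every summand integral.\<close>
    define y where "y = to_fract g * (
        to_fract (r2 * r3 * r4) * (to_fract r1 * fract_form n s U V) * to_fract a +
        to_fract (r1 * r3 * r4) * (to_fract r2 * fract_form m t U V) * to_fract b) +
      to_fract h * (
        to_fract (r1 * r2 * r4) * (to_fract r3 * fract_form n s' U V) * to_fract a +
        to_fract (r1 * r2 * r3) * (to_fract r4 * fract_form m t' U V) * to_fract b)"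
    have y: "y \<in> range to_fract"
      unfolding y_def U_def V_def
      by (rule to_fract_range_add; rule to_fract_range_mult, rule rangeI, rule to_fract_range_add;
          rule to_fract_range_mult, rule to_fract_range_mult, rule rangeI)
        (rule r1 r2 r3 r4 rangeI)+
    have "to_fract \<rho> = to_fract \<rho> * (to_fract g * U ^ (n + m) + to_fract h * V ^ (n + m))"
      unfolding gh by simp
    also have "\<dots> = w * y"
      unfolding 1[of U V, symmetric] 2[of U V, symmetric] w[folded U_def V_def] y_def
      by (simp add: \<rho>_def algebra_simps)
    finally have wy: "to_fract \<rho> = w * y" .
    then have "y \<noteq> 0"
      using \<open>\<rho> \<noteq> 0\<close> by auto
    then have "fract_norm y \<ge> 1"
      using y to_fract_range_norm by blast
    moreover have "poly_norm \<rho> = fract_norm w * fract_norm y"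
      using wy by (metis fract_norm_mult fract_norm_to_fract)
    ultimately show ?thesis
      using mult_left_mono[of 1 "fract_norm y" "fract_norm w"] by simp
  qed
  then show ?thesis
    using that[of "poly_norm \<rho>"] poly_norm_ge_1[OF \<open>\<rho> \<noteq> 0\<close>] by auto
qed

subsection \<open>Exponents of approximation\<close>

text \<open>
  In terms of $x = u / v$ with $u, v$ coprime polynomials: \<open>x\<close> approximates a simple root
  of \<open>f\<close> at most to within a constant times the height of \<open>x\<close> to the power \<open>- \<kappa>\<close>.
\<close>

definition approx_exponent :: "nat \<Rightarrow> 'q::field poly fract poly \<Rightarrow> nat \<Rightarrow> bool"
  where "approx_exponent n f \<kappa> \<longleftrightarrow> (\<exists>c>0. \<forall>u v. comaximal u v \<longrightarrow> fract_form n f (to_fract u) (to_fract v) \<noteq> 0 \<longrightarrow>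
    c * pair_norm (to_fract u) (to_fract v) ^ n \<le>
      pair_norm (to_fract u) (to_fract v) ^ \<kappa> * fract_norm (fract_form n f (to_fract u) (to_fract v)))"

lemma approx_exponentI:
  assumes "c > 0" "\<And>u v. comaximal u v \<Longrightarrow> fract_form n f (to_fract u) (to_fract v) \<noteq> 0 \<Longrightarrow>
    c * pair_norm (to_fract u) (to_fract v) ^ n \<le>
      pair_norm (to_fract u) (to_fract v) ^ \<kappa> * fract_norm (fract_form n f (to_fract u) (to_fract v))"
  shows "approx_exponent n f \<kappa>"
  using assms unfolding approx_exponent_def by blast

lemma approx_exponent_mono:
  assumes "approx_exponent n f \<kappa>" "\<kappa> \<le> \<kappa>'"
  shows "approx_exponent n f \<kappa>'"
proof -
  obtain c where "c > 0" and c: "\<And>u v. comaximal u v \<Longrightarrow> fract_form n f (to_fract u) (to_fract v) \<noteq> 0 \<Longrightarrow>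
    c * pair_norm (to_fract u) (to_fract v) ^ n \<le>
      pair_norm (to_fract u) (to_fract v) ^ \<kappa> * fract_norm (fract_form n f (to_fract u) (to_fract v))"
    using assms(1) unfolding approx_exponent_def by blast
  show ?thesis
    by (intro approx_exponentI[OF \<open>c > 0\<close>] order_trans[OF c] mult_right_mono power_increasing assms(2)
      pair_norm_ge_1) auto
qed

text \<open>Liouville's inequality in this language: a constant lower bound for the value costs the
  full degree.\<close>

lemma approx_exponent_degree: "approx_exponent n f n"
proof -
  obtain c where "c > 0"
    "\<And>u v. fract_form n f (to_fract u) (to_fract v) \<noteq> 0 \<Longrightarrow> c \<le> fract_norm (fract_form n f (to_fract u) (to_fract v))"
    using fract_form_liouville by blast
  then show ?thesis
    by (intro approx_exponentI[of c]) (auto simp: mult.commute[of c] intro: mult_left_mono)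
qed

text \<open>One factor always has full size by \<open>comaximal_forms_lower\<close>, so only the
  exponent of the other one is paid: exponents do not add up under products.\<close>

lemma approx_exponent_mult:
  assumes cop: "comaximal_forms m F n G"
    and F: "approx_exponent m F \<kappa>" and G: "approx_exponent n G \<kappa>"
  shows "approx_exponent (m + n) (F * G) \<kappa>"
proof -
  obtain a where a: "a > 0"
    "\<And>u v. a * pair_norm u v ^ m \<le> fract_norm (fract_form m F u v) \<or>
      a * pair_norm u v ^ n \<le> fract_norm (fract_form n G u v)"
    using comaximal_forms_lower[OF cop] by blast
  obtain b where b: "b > 0" "\<And>u v. comaximal u v \<Longrightarrow> fract_form m F (to_fract u) (to_fract v) \<noteq> 0 \<Longrightarrow>
    b * pair_norm (to_fract u) (to_fract v) ^ m \<le>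
      pair_norm (to_fract u) (to_fract v) ^ \<kappa> * fract_norm (fract_form m F (to_fract u) (to_fract v))"
    using F unfolding approx_exponent_def by blast
  obtain c where c: "c > 0" "\<And>u v. comaximal u v \<Longrightarrow> fract_form n G (to_fract u) (to_fract v) \<noteq> 0 \<Longrightarrow>
    c * pair_norm (to_fract u) (to_fract v) ^ n \<le>
      pair_norm (to_fract u) (to_fract v) ^ \<kappa> * fract_norm (fract_form n G (to_fract u) (to_fract v))"
    using G unfolding approx_exponent_def by blast
  show ?thesis
  proof (rule approx_exponentI)
    show "a * min b c > 0"
      using a b c by simp
    fix u v :: "'a poly"
    assume uv: "comaximal u v" and ne: "fract_form (m + n) (F * G) (to_fract u) (to_fract v) \<noteq> 0"
    define M where "M = pair_norm (to_fract u) (to_fract v)"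
    define x where "x = fract_norm (fract_form m F (to_fract u) (to_fract v))"
    define y where "y = fract_norm (fract_form n G (to_fract u) (to_fract v))"
    have FG: "fract_form (m + n) (F * G) (to_fract u) (to_fract v) =
        fract_form m F (to_fract u) (to_fract v) * fract_form n G (to_fract u) (to_fract v)"
      using cop by (simp add: comaximal_forms_def id_hom.binform_mult)
    have b': "b * M ^ m \<le> M ^ \<kappa> * x" and c': "c * M ^ n \<le> M ^ \<kappa> * y"
      using b(2)[OF uv] c(2)[OF uv] ne unfolding FG M_def x_def y_def by auto
    have nonneg: "M \<ge> 0" "x \<ge> 0" "y \<ge> 0"
      by (auto simp: M_def x_def y_def)
    have "a * min b c * M ^ (m + n) \<le> M ^ \<kappa> * (x * y)"
    proof (cases "a * M ^ m \<le> x")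
      case True
      have "a * min b c * M ^ (m + n) = (a * M ^ m) * (min b c * M ^ n)"
        by (simp add: power_add algebra_simps)
      also have "\<dots> \<le> x * (c * M ^ n)"
        using True a b c nonneg by (intro mult_mono) auto
      also have "\<dots> \<le> x * (M ^ \<kappa> * y)"
        using c' nonneg by (intro mult_left_mono) auto
      finally show ?thesis
        by (simp add: algebra_simps)
    next
      case False
      then have *: "a * M ^ n \<le> y"
        using a(2) unfolding M_def x_def y_def by blast
      have "a * min b c * M ^ (m + n) = (a * M ^ n) * (min b c * M ^ m)"
        by (simp add: power_add algebra_simps)
      also have "\<dots> \<le> y * (b * M ^ m)"
        using * a b c nonneg by (intro mult_mono) auto
      also have "\<dots> \<le> y * (M ^ \<kappa> * x)"
        using b' nonneg by (intro mult_left_mono) auto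
      finally show ?thesis
        by (simp add: algebra_simps)
    qed
    then show "a * min b c * pair_norm (to_fract u) (to_fract v) ^ (m + n) \<le>
      pair_norm (to_fract u) (to_fract v) ^ \<kappa> * fract_norm (fract_form (m + n) (F * G) (to_fract u) (to_fract v))"
      unfolding FG by (simp add: M_def x_def y_def fract_norm_mult)
  qed
qed


section \<open>Derivations\<close>

lemma ddt_add: "ddt (x + y) = ddt x + ddt y"
proof (cases x; cases y)
  fix a b c e assume "x = Fract a b" "b \<noteq> 0" "y = Fract c e" "e \<noteq> 0"
  then show ?thesis
    by (simp add: ddt_Fract eq_fract pderiv_add pderiv_mult algebra_simps)
qed

lemma ddt_mult: "ddt (x * y) = ddt x * y + x * ddt y"
proof (cases x; cases y)
  fix a b c e assume "x = Fract a b" "b \<noteq> 0" "y = Fract c e" "e \<noteq> 0"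
  then show ?thesis
    by (simp add: ddt_Fract eq_fract pderiv_mult algebra_simps)
qed

lemma ddt_to_fract: "ddt (to_fract p) = to_fract (pderiv p)"
  by (simp add: to_fract_def ddt_Fract)

lemma ddt_0 [simp]: "ddt 0 = 0"
  using ddt_to_fract[of 0] by simp

abbreviation coeff_ddt :: "'q::field poly fract poly \<Rightarrow> 'q poly fract poly"
  where "coeff_ddt \<equiv> map_poly ddt"

lemma coeff_ddt_add: "coeff_ddt (f + g) = coeff_ddt f + coeff_ddt g"
  by (rule poly_eqI) (simp add: coeff_map_poly ddt_add)

lemma coeff_ddt_smult: "coeff_ddt (smult c f) = smult (ddt c) f + smult c (coeff_ddt f)"
  by (rule poly_eqI) (simp add: coeff_map_poly ddt_mult)

lemma coeff_ddt_pCons: "coeff_ddt (pCons c f) = pCons (ddt c) (coeff_ddt f)"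
  by (simp add: map_poly_pCons)

lemma coeff_ddt_mult: "coeff_ddt (f * g) = coeff_ddt f * g + f * coeff_ddt g"
proof (induction f)
  case (pCons c f)
  then show ?case
    by (simp add: coeff_ddt_add coeff_ddt_smult coeff_ddt_pCons algebra_simps)
qed simp

lemma degree_coeff_ddt_le: "degree (coeff_ddt f) \<le> degree f"
  by (rule degree_le) (simp add: coeff_map_poly coeff_eq_0)

lemma degree_pderiv_le: "degree (pderiv f) \<le> degree f - 1"
  by (rule degree_le) (auto simp: coeff_pderiv coeff_eq_0)

text \<open>\<open>D\<close> extends \<open>ddt\<close>. On the field itself this gives the estimate
  for u / v; on polynomials in x it differentiates a form with P and Q substituted.\<close>

locale derivation_hom = coeff_hom \<iota> for \<iota> :: "'q::field poly fract \<Rightarrow> 'r::comm_ring_1" +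
  fixes D :: "'r \<Rightarrow> 'r"
  assumes D_add: "D (x + y) = D x + D y"
    and D_mult: "D (x * y) = D x * y + x * D y"
    and D_hom: "D (\<iota> c) = \<iota> (ddt c)"
begin

lemma D_1: "D 1 = 0"
  using D_mult[of 1 1] by simp

lemma D_power_Suc: "D (x ^ Suc n) = of_nat (Suc n) * x ^ n * D x"
  by (induction n) (simp_all add: D_mult D_1 algebra_simps)

text \<open>The chain rule has a term with the partial derivative in the second variable. The factor
  \<open>v\<close> and Euler's relation for a form of degree \<open>n\<close> trade it for
  \<open>pderiv f\<close> and the form itself, so that only v D u - u D v and D v remain.\<close>

lemma D_binform:
  "degree f \<le> n \<Longrightarrow> v * D (binform \<iota> n f u v) = v * binform \<iota> n (coeff_ddt f) u v
      + binform \<iota> (n - 1) (pderiv f) u v * (v * D u - u * D v)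
      + of_nat n * binform \<iota> n f u v * D v"
proof (induction n arbitrary: f)
  case 0
  then obtain c where "f = [:c:]"
    by (metis degree_eq_zeroE le_zero_eq)
  then show ?case
    by (simp add: binform_const D_hom coeff_ddt_pCons pderiv_pCons binform_0)
next
  case (Suc n)
  obtain c h where f: "f = pCons c h"
    by (cases f)
  have h: "degree h \<le> n"
    using Suc.prems(1) unfolding f by (auto simp: degree_pCons_eq_if split: if_splits)
  \<comment> \<open>For n = 0 the truncated n - 1 is harmless, since \<open>pderiv h\<close> is then
    0.\<close>
  have shift: "binform \<iota> n (pCons 0 (pderiv h)) u v = u * binform \<iota> (n - 1) (pderiv h) u v"
  proof (cases n)
    case 0
    then have "pderiv h = 0"
      using h by (metis degree_eq_zeroE le_zero_eq pderiv_singleton)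
    then show ?thesis
      by (simp add: binform_0)
  next
    case (Suc m)
    then show ?thesis
      by (simp add: binform_pCons hom_zero)
  qed
  have IH: "v * D (binform \<iota> n h u v) = v * binform \<iota> n (coeff_ddt h) u v
      + binform \<iota> (n - 1) (pderiv h) u v * (v * D u - u * D v)
      + of_nat n * binform \<iota> n h u v * D v"
    by (rule Suc.IH[OF h])
  have "v * D (binform \<iota> (Suc n) f u v) = v * (\<iota> (ddt c) * v ^ Suc n) + v * \<iota> c * (of_nat (Suc n) * v ^ n * D v)
      + v * D u * binform \<iota> n h u v + u * (v * D (binform \<iota> n h u v))"
    unfolding f binform_pCons D_add D_mult D_hom D_power_Suc by (simp add: algebra_simps)
  also have "\<dots> = v * binform \<iota> (Suc n) (coeff_ddt f) u v
      + (binform \<iota> n h u v + u * binform \<iota> (n - 1) (pderiv h) u v) * (v * D u - u * D v)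
      + of_nat (Suc n) * binform \<iota> (Suc n) f u v * D v"
    unfolding IH unfolding f coeff_ddt_pCons binform_pCons by (simp add: algebra_simps)
  also have "binform \<iota> n h u v + u * binform \<iota> (n - 1) (pderiv h) u v = binform \<iota> n (pderiv f) u v"
    unfolding f pderiv_pCons binform_add shift ..
  finally show ?case
    by simp
qed

text \<open>
  A congruence $A \beta' = B$ for the roots $\beta$ of $E$, expressed at the point \<open>(u, v)\<close>.
\<close>

lemma D_binform_congruence:
  assumes eq: "A * coeff_ddt E + pderiv E * B = E * H"
    and deg: "degree E = r" "r \<ge> 1" "degree A \<le> k" "degree B \<le> k + 2"
  shows "degree H \<le> k + 1"
    and "binform \<iota> k A u v * (v * D (binform \<iota> r E u v)) =
      binform \<iota> (r - 1) (pderiv E) u v * (binform \<iota> k A u v * (v * D u - u * D v) - binform \<iota> (k + 2) B u v)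
      + binform \<iota> r E u v * (binform \<iota> (k + 1) H u v + of_nat r * binform \<iota> k A u v * D v)"
proof -
  have pd: "degree (pderiv E) \<le> r - 1"
    using degree_pderiv_le[of E] deg by simp
  have dE: "degree (coeff_ddt E) \<le> r"
    using degree_coeff_ddt_le deg by metis
  have "degree (A * coeff_ddt E + pderiv E * B) \<le> r + (k + 1)"
  proof (rule degree_add_le)
    show "degree (A * coeff_ddt E) \<le> r + (k + 1)"
      using degree_mult_le[of A "coeff_ddt E"] dE deg by linarith
    show "degree (pderiv E * B) \<le> r + (k + 1)"
      using degree_mult_le[of "pderiv E" B] pd deg by linarith
  qed
  moreover have "E \<noteq> 0"
    using deg by auto
  ultimately show H: "degree H \<le> k + 1"
    unfolding eq using deg by (cases "H = 0") (auto simp: degree_mult_eq)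
  have "binform \<iota> k A u v * (v * binform \<iota> r (coeff_ddt E) u v) + binform \<iota> (r - 1) (pderiv E) u v * binform \<iota> (k + 2) B u v
    = binform \<iota> (k + Suc r) (A * coeff_ddt E) u v + binform \<iota> ((r - 1) + (k + 2)) (pderiv E * B) u v"
    using dE pd deg by (subst (1 2) binform_mult) (auto simp: binform_Suc)
  also have "\<dots> = binform \<iota> (r + (k + 1)) (E * H) u v"
  proof -
    have "k + Suc r = r + (k + 1)" "(r - 1) + (k + 2) = r + (k + 1)"
      using deg by auto
    then show ?thesis
      by (simp only: binform_add[symmetric] eq)
  qed
  also have "\<dots> = binform \<iota> r E u v * binform \<iota> (k + 1) H u v"
    using H deg by (subst binform_mult) auto
  finally have 1: "binform \<iota> k A u v * (v * binform \<iota> r (coeff_ddt E) u v) =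
      binform \<iota> r E u v * binform \<iota> (k + 1) H u v - binform \<iota> (r - 1) (pderiv E) u v * binform \<iota> (k + 2) B u v"
    by (simp add: algebra_simps)
  have "binform \<iota> k A u v * (v * D (binform \<iota> r E u v)) =
    binform \<iota> k A u v * (v * binform \<iota> r (coeff_ddt E) u v) + binform \<iota> k A u v *
      (binform \<iota> (r - 1) (pderiv E) u v * (v * D u - u * D v) + of_nat r * binform \<iota> r E u v * D v)"
    unfolding D_binform[OF eq_refl[OF deg(1)]] by (simp add: algebra_simps)
  then show "binform \<iota> k A u v * (v * D (binform \<iota> r E u v)) =
      binform \<iota> (r - 1) (pderiv E) u v * (binform \<iota> k A u v * (v * D u - u * D v) - binform \<iota> (k + 2) B u v)
      + binform \<iota> r E u v * (binform \<iota> (k + 1) H u v + of_nat r * binform \<iota> k A u v * D v)"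
    unfolding 1 by (simp add: algebra_simps)
qed

end

interpretation ddt_deriv: derivation_hom "\<lambda>c. c" ddt
  by standard (auto simp: ddt_add ddt_mult)

section \<open>The differential method of Osgood\<close>

lemma comaximal_forms_pderiv:
  fixes E :: "'k::field poly"
  assumes "comaximal E (pderiv E)"
  shows "comaximal_forms (degree E) E (degree E - 1) (pderiv E)"
proof -
  have "E \<noteq> 0"
    using assms by (auto simp: comaximal_def)
  then show ?thesis
    using assms degree_pderiv_le[of E] by (auto simp: comaximal_forms_def)
qed

lemma fract_norm_of_nat: "fract_norm (of_nat n) \<le> 1"
proof (induction n)
  case (Suc n)
  then show ?case
    using fract_norm_add[of 1 "of_nat n"] by (simp add: max_def split: if_splits)
qed simp

text \<open>Here \<open>z\<close> stands for v u' - u v', which is a polynomial, so Liouville's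
  argument applies to the whole expression although it is not a form in (u, v).\<close>

lemma congruence_value_lower:
  fixes A B :: "'q::field poly fract poly"
  obtains c where "c > 0"
    "\<And>u v z. fract_form k A (to_fract u) (to_fract v) * to_fract z - fract_form l B (to_fract u) (to_fract v) \<noteq> 0
    \<Longrightarrow> c \<le> fract_norm (fract_form k A (to_fract u) (to_fract v) * to_fract z - fract_form l B (to_fract u) (to_fract v))"
proof -
  obtain a where a: "a \<noteq> 0" "\<And>u v. to_fract a * fract_form k A (to_fract u) (to_fract v) \<in> range to_fract"
    using fract_form_integral by blast
  obtain b where b: "b \<noteq> 0" "\<And>u v. to_fract b * fract_form l B (to_fract u) (to_fract v) \<in> range to_fract"
    using fract_form_integral by blast
  have "inverse (poly_norm (a * b)) \<le> fract_norm (fract_form k A (to_fract u) (to_fract v) * to_fract z - fract_form l B (to_fract u) (to_fract v))"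
    if ne: "fract_form k A (to_fract u) (to_fract v) * to_fract z - fract_form l B (to_fract u) (to_fract v) \<noteq> 0" for u v z
  proof -
    define W where "W = fract_form k A (to_fract u) (to_fract v) * to_fract z - fract_form l B (to_fract u) (to_fract v)"
    have "to_fract (a * b) * W = to_fract (b * z) * (to_fract a * fract_form k A (to_fract u) (to_fract v))
      + to_fract (- a) * (to_fract b * fract_form l B (to_fract u) (to_fract v))"
      unfolding W_def by (simp add: algebra_simps)
    also have "\<dots> \<in> range to_fract"
      by (intro to_fract_range_add to_fract_range_mult[OF _ a(2)] to_fract_range_mult[OF _ b(2)] rangeI)
    finally have "to_fract (a * b) * W \<in> range to_fract" .
    moreover have "to_fract (a * b) * W \<noteq> 0"
      using ne a(1) b(1) unfolding W_def by simp
    ultimately have "fract_norm (to_fract (a * b) * W) \<ge> 1"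
      by (rule to_fract_range_norm)
    then have "1 \<le> poly_norm (a * b) * fract_norm W"
      by (simp only: fract_norm_mult fract_norm_to_fract)
    moreover have "poly_norm (a * b) > 0"
      using poly_norm_ge_1[of "a * b"] a(1) b(1) by simp
    ultimately show ?thesis
      unfolding W_def by (simp add: field_simps)
  qed
  then show ?thesis
    using that[of "inverse (poly_norm (a * b))"] poly_norm_ge_1[of "a * b"] a(1) b(1) by simp
qed

text \<open>For a solution, A(u, v) is a common factor of the values of A and B, hence bounded by
  \<open>comaximal_forms_divisor\<close>. Since the factor z = v u' - u v' has norm at most M^2 for
  M the height, B(u, v) is at most C M^2. But A(u, v) reaches the size M^k or B(u, v) the size M^(k
  + 2), and either way M^k is bounded. For k = 0 this would say nothing.\<close>

lemma congruence_solutions_bounded: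
  fixes A B :: "'q::field poly fract poly"
  assumes AB: "comaximal_forms k A (k + 2) B" and "k \<ge> 1"
  obtains C where "C \<ge> 1"
    "\<And>u v. comaximal u v \<Longrightarrow>
      fract_form k A (to_fract u) (to_fract v) * to_fract (v * pderiv u - u * pderiv v)
        = fract_form (k + 2) B (to_fract u) (to_fract v) \<Longrightarrow> pair_norm (to_fract u) (to_fract v) \<le> C"
proof -
  obtain C where C: "C > 0"
    "\<And>u v w a b. comaximal u v \<Longrightarrow> fract_form k A (to_fract u) (to_fract v) = w * to_fract a \<Longrightarrow>
      fract_form (k + 2) B (to_fract u) (to_fract v) = w * to_fract b \<Longrightarrow> fract_norm w \<le> C"
    using comaximal_forms_divisor[OF AB] by blast
  obtain c where c: "c > 0"
    "\<And>u v. c * pair_norm u v ^ k \<le> fract_norm (fract_form k A u v) \<or>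
      c * pair_norm u v ^ (k + 2) \<le> fract_norm (fract_form (k + 2) B u v)"
    using comaximal_forms_lower[OF AB] by blast
  have "pair_norm (to_fract u) (to_fract v) \<le> max 1 (C / c)"
    if uv: "comaximal u v" and eq: "fract_form k A (to_fract u) (to_fract v) * to_fract (v * pderiv u - u * pderiv v)
        = fract_form (k + 2) B (to_fract u) (to_fract v)" for u v
  proof -
    define M where "M = pair_norm (to_fract u) (to_fract v)"
    have M: "M \<ge> 1"
      unfolding M_def using pair_norm_ge_1[OF uv] .
    define z where "z = v * pderiv u - u * pderiv v"
    have A: "fract_norm (fract_form k A (to_fract u) (to_fract v)) \<le> C"
      by (rule C(2)[OF uv, of _ 1 z]) (use eq in \<open>simp_all add: z_def\<close>)
    have "poly_norm z \<le> max (poly_norm (v * pderiv u)) (poly_norm (u * pderiv v))"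
      unfolding z_def using poly_norm_add[of "v * pderiv u" "- (u * pderiv v)"] by simp
    also have "\<dots> \<le> M * M"
      unfolding poly_norm_mult using poly_norm_pderiv[of u] poly_norm_pderiv[of v]
      by (intro max.boundedI mult_mono) (auto simp: M_def pair_norm_def le_max_iff_disj)
    finally have z: "poly_norm z \<le> M\<^sup>2"
      by (simp add: power2_eq_square)
    have B: "fract_norm (fract_form (k + 2) B (to_fract u) (to_fract v)) \<le> C * M\<^sup>2"
      unfolding eq[symmetric] fract_norm_mult fract_norm_to_fract z_def[symmetric]
      using A z C(1) by (intro mult_mono) auto
    have "c * M ^ k \<le> C"
    proof (cases "c * M ^ k \<le> fract_norm (fract_form k A (to_fract u) (to_fract v))")
      case False
      then have "c * M ^ (k + 2) \<le> C * M\<^sup>2"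
        using c(2)[of "to_fract u" "to_fract v"] B unfolding M_def by linarith
      then have "(c * M ^ k) * M\<^sup>2 \<le> C * M\<^sup>2"
        by (simp add: power_add power2_eq_square algebra_simps)
      then show ?thesis
        using M by simp
    qed (use A in linarith)
    moreover have "M ^ 1 \<le> M ^ k"
      using M \<open>k \<ge> 1\<close> by (intro power_increasing) auto
    then have "c * M \<le> c * M ^ k"
      using c(1) by simp
    ultimately have "c * M \<le> C"
      by linarith
    then have "M \<le> C / c"
      using c(1) by (simp add: field_simps)
    then show ?thesis
      unfolding M_def by simp
  qed
  then show ?thesis
    using that[of "max 1 (C / c)"] by simp
qed

text \<open>
  Let $W = A(u, v) (v u' - u v') - B(u, v)$.  If \<open>W\<close> is nonzero, it is bounded from below, being
  integral up to a constant, while a good approximation \<open>u / v\<close> to a root of \<open>E\<close> makes it small.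
  If \<open>W\<close> vanishes, then the divisibility of \<open>B(u, v)\<close> by \<open>A(u, v)\<close> bounds the height of \<open>u / v\<close>.
\<close>

lemma approx_exponent_congruence:
  fixes A B E :: "'q::field poly fract poly"
  assumes E: "comaximal E (pderiv E)"
    and AB: "comaximal_forms k A (k + 2) B" and "k \<ge> 1"
    and dvd: "E dvd A * coeff_ddt E + pderiv E * B"
  shows "approx_exponent (degree E) E (k + 2)"
proof (cases "degree E = 0")
  case True
  then show ?thesis
    using approx_exponent_mono[OF approx_exponent_degree[of "degree E"]] by simp
next
  case False
  define r where "r = degree E"
  have r: "r \<ge> 1"
    using False unfolding r_def by simp
  have deg: "degree A \<le> k" "degree B \<le> k + 2"
    using AB unfolding comaximal_forms_def by auto
  obtain H where eq: "A * coeff_ddt E + pderiv E * B = E * H"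
    using dvd by blast
  obtain a where a: "a > 0"
    "\<And>u v. a * pair_norm u v ^ r \<le> fract_norm (fract_form r E u v) \<or>
      a * pair_norm u v ^ (r - 1) \<le> fract_norm (fract_form (r - 1) (pderiv E) u v)"
    using comaximal_forms_lower[OF comaximal_forms_pderiv[OF E]] unfolding r_def by blast
  obtain bA where bA: "bA > 0" "\<And>u v. fract_norm (fract_form k A u v) \<le> bA * pair_norm u v ^ k"
    using fract_form_upper by blast
  obtain bH where bH: "bH > 0" "\<And>u v. fract_norm (fract_form (k + 1) H u v) \<le> bH * pair_norm u v ^ (k + 1)"
    using fract_form_upper by blast
  obtain \<omega> where \<omega>: "\<omega> > 0"
    "\<And>u v z. fract_form k A (to_fract u) (to_fract v) * to_fract z - fract_form (k + 2) B (to_fract u) (to_fract v) \<noteq> 0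
    \<Longrightarrow> \<omega> \<le> fract_norm (fract_form k A (to_fract u) (to_fract v) * to_fract z - fract_form (k + 2) B (to_fract u) (to_fract v))"
    using congruence_value_lower by blast
  obtain C where C: "C \<ge> 1"
    "\<And>u v. comaximal u v \<Longrightarrow>
      fract_form k A (to_fract u) (to_fract v) * to_fract (v * pderiv u - u * pderiv v)
        = fract_form (k + 2) B (to_fract u) (to_fract v) \<Longrightarrow> pair_norm (to_fract u) (to_fract v) \<le> C"
    using congruence_solutions_bounded[OF AB \<open>k \<ge> 1\<close>] by blast
  obtain l where l: "l > 0"
    "\<And>u v. fract_form r E (to_fract u) (to_fract v) \<noteq> 0 \<Longrightarrow> l \<le> fract_norm (fract_form r E (to_fract u) (to_fract v))"
    using fract_form_liouville by blast
  \<comment> \<open>One entry for each case below: E(u, v) of full size; W nonzero; W = 0, where the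
    height is at most \<open>C\<close> and Liouville's constant \<open>l\<close> suffices.\<close>
  define c where "c = min a (min (a * \<omega> / (bA + bH)) (l / C ^ r))"
  have "c > 0"
    unfolding c_def using a bA bH \<omega> C l by simp
  then have "approx_exponent r E (k + 2)"
  proof (rule approx_exponentI)
    fix u v :: "'q poly"
    assume uv: "comaximal u v" and ne: "fract_form r E (to_fract u) (to_fract v) \<noteq> 0"
    define M where "M = pair_norm (to_fract u) (to_fract v)"
    define N where "N = fract_form r E (to_fract u) (to_fract v)"
    define S where "S = fract_form (r - 1) (pderiv E) (to_fract u) (to_fract v)"
    define A0 where "A0 = fract_form k A (to_fract u) (to_fract v)"
    define B0 where "B0 = fract_form (k + 2) B (to_fract u) (to_fract v)"
    define H0 where "H0 = fract_form (k + 1) H (to_fract u) (to_fract v)"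
    define z where "z = v * pderiv u - u * pderiv v"
    define W where "W = A0 * to_fract z - B0"
    have M: "M \<ge> 1"
      unfolding M_def using pair_norm_ge_1[OF uv] .
    have v: "fract_norm (to_fract v) \<le> M" "fract_norm (to_fract (pderiv v)) \<le> M"
      using poly_norm_pderiv[of v] unfolding M_def pair_norm_def by auto
    have one: "1 * y \<le> M ^ n * y" if "y \<ge> 0" for y n
      using M that by (intro mult_right_mono) auto
    consider "a * M ^ r \<le> fract_norm N" | "W = 0" | "W \<noteq> 0" "a * M ^ (r - 1) \<le> fract_norm S"
      using a(2)[of "to_fract u" "to_fract v"] unfolding M_def N_def S_def by blast
    then have "c * M ^ r \<le> M ^ (k + 2) * fract_norm N"
    proof cases
      case 1
      have "c * M ^ r \<le> a * M ^ r"
        using M by (intro mult_right_mono) (auto simp: c_def)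
      then show ?thesis
        using 1 one[of "fract_norm N" "k + 2"] by simp
    next
      case 2
      then have "M \<le> C"
        using C(2)[OF uv] unfolding M_def W_def A0_def B0_def z_def by simp
      then have "c * M ^ r \<le> l / C ^ r * C ^ r"
        using M C l by (intro mult_mono power_mono) (auto simp: c_def)
      also have "\<dots> = l"
        using C by simp
      also have "\<dots> \<le> fract_norm N"
        using l(2) ne unfolding N_def by blast
      finally show ?thesis
        using one[of "fract_norm N" "k + 2"] by simp
    next
      case 3
      have "A0 * (to_fract v * ddt N) = S * (A0 * (to_fract v * ddt (to_fract u) - to_fract u * ddt (to_fract v)) - B0)
          + N * (H0 + of_nat r * A0 * ddt (to_fract v))"
        using ddt_deriv.D_binform_congruence(2)[OF eq r_def[symmetric] r deg, of "to_fract u" "to_fract v"]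
        unfolding S_def A0_def B0_def N_def H0_def .
      \<comment> \<open>Every term on the right contains N or its derivative, whose norm is at most
        that of N. In this case S has full size and W is bounded below, so N cannot be too
        small.\<close>
      then have XW: "S * W = A0 * (to_fract v * ddt N) - N * (H0 + of_nat r * A0 * to_fract (pderiv v))"
        unfolding W_def z_def by (simp add: ddt_to_fract)
      have A0: "fract_norm A0 \<le> bA * M ^ k" and H0: "fract_norm H0 \<le> bH * M ^ (k + 1)"
        unfolding A0_def H0_def M_def by (rule bA bH)+
      have "fract_norm A0 * (fract_norm (to_fract v) * fract_norm (ddt N)) \<le> (bA * M ^ k) * (M * fract_norm N)"
        using A0 v M bA fract_norm_ddt[of N] by (intro mult_mono mult_nonneg_nonneg) auto
      then have 1: "fract_norm (A0 * (to_fract v * ddt N)) \<le> bA * M ^ (k + 1) * fract_norm N"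
        by (simp add: fract_norm_mult algebra_simps)
      have "fract_norm (of_nat r :: 'q poly fract) * fract_norm A0 * fract_norm (to_fract (pderiv v)) \<le> 1 * (bA * M ^ k) * M"
        using fract_norm_of_nat[of r, where 'a = 'q] A0 v M bA by (intro mult_mono mult_nonneg_nonneg) auto
      then have "fract_norm (of_nat r * A0 * to_fract (pderiv v)) \<le> bA * M ^ (k + 1)"
        by (simp add: fract_norm_mult algebra_simps)
      then have "fract_norm (H0 + of_nat r * A0 * to_fract (pderiv v)) \<le> bH * M ^ (k + 1) + bA * M ^ (k + 1)"
        using fract_norm_add_le[of H0 "of_nat r * A0 * to_fract (pderiv v)"] H0 by linarith
      then have "fract_norm (H0 + of_nat r * A0 * to_fract (pderiv v)) * fract_norm N
          \<le> (bH * M ^ (k + 1) + bA * M ^ (k + 1)) * fract_norm N"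
        by (rule mult_right_mono) simp
      then have 2: "fract_norm (N * (H0 + of_nat r * A0 * to_fract (pderiv v))) \<le> (bA + bH) * M ^ (k + 1) * fract_norm N"
        unfolding fract_norm_mult[of N] distrib_right by (simp only: ac_simps)
      have "bA * M ^ (k + 1) * fract_norm N \<le> (bA + bH) * M ^ (k + 1) * fract_norm N"
        using bH(1) M by (intro mult_right_mono) auto
      then have "fract_norm (S * W) \<le> (bA + bH) * M ^ (k + 1) * fract_norm N"
        unfolding XW using fract_norm_diff[of "A0 * (to_fract v * ddt N)" "N * (H0 + of_nat r * A0 * to_fract (pderiv v))"]
          1 2 by linarith
      moreover have "\<omega> \<le> fract_norm W"
        using 3(1) \<omega>(2)[of u v z] unfolding W_def A0_def B0_def by blast
      then have "(a * M ^ (r - 1)) * \<omega> \<le> fract_norm (S * W)"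
        unfolding fract_norm_mult using 3(2) a \<omega> M by (intro mult_mono) auto
      ultimately have "(a * M ^ (r - 1)) * \<omega> \<le> (bA + bH) * M ^ (k + 1) * fract_norm N"
        by linarith
      \<comment> \<open>S has degree r - 1 only; the factor \<open>M\<close> restores the degree r
        and raises the exponent from k + 1 to k + 2.\<close>
      then have "M * (a * M ^ (r - 1) * \<omega>) \<le> M * ((bA + bH) * M ^ (k + 1) * fract_norm N)"
        using M by (intro mult_left_mono) auto
      then have "a * \<omega> * (M * M ^ (r - 1)) \<le> (bA + bH) * (M ^ (k + 2) * fract_norm N)"
        by (simp add: algebra_simps)
      moreover have "M * M ^ (r - 1) = M ^ r"
        using r by (metis One_nat_def Suc_pred' less_eq_Suc_le power_Suc)
      ultimately have "a * \<omega> * M ^ r \<le> (bA + bH) * (M ^ (k + 2) * fract_norm N)"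
        by simp
      then have "a * \<omega> / (bA + bH) * M ^ r \<le> M ^ (k + 2) * fract_norm N"
        using bA bH by (simp add: field_simps)
      moreover have "c * M ^ r \<le> a * \<omega> / (bA + bH) * M ^ r"
        using M by (intro mult_right_mono) (auto simp: c_def)
      ultimately show ?thesis
        by linarith
    qed
    then show "c * pair_norm (to_fract u) (to_fract v) ^ r
      \<le> pair_norm (to_fract u) (to_fract v) ^ (k + 2) * fract_norm (fract_form r E (to_fract u) (to_fract v))"
      unfolding M_def N_def .
  qed
  then show ?thesis
    unfolding r_def .
qed


section \<open>Small congruences by counting coefficients, and the Riccati alternative\<close>

lemma homogeneous_system_solution:
  fixes c :: "nat \<Rightarrow> nat \<Rightarrow> 'k::field"
  shows "\<exists>x. (\<exists>j\<le>n. x j \<noteq> 0) \<and> (\<forall>i<n. (\<Sum>j\<le>n. c i j * x j) = 0)"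
proof (induction n arbitrary: c)
  case 0
  then show ?case by (auto intro: exI[of _ "\<lambda>_. 1"])
next
  case (Suc n)
  show ?case
  proof (cases "\<exists>i<Suc n. c i (Suc n) \<noteq> 0")
    case False
    have "(\<Sum>j\<le>Suc n. c i j * (if j = Suc n then 1 else 0)) = c i (Suc n)" for i
      by simp
    then show ?thesis
      using False by (intro exI[of _ "\<lambda>j. if j = Suc n then 1 else 0"]) auto
  next
    case True
    then obtain p where p: "p < Suc n" "c p (Suc n) \<noteq> 0"
      by blast
    \<comment> \<open>Gaussian elimination of the last unknown with pivot row \<open>p\<close>:
      \<open>row\<close> renumbers the other rows and \<open>c'\<close> is what remains of
      them.\<close>
    define row where "row i = (if i < p then i else Suc i)" for i
    define c' where "c' i j = c (row i) j - c (row i) (Suc n) / c p (Suc n) * c p j" for i j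
    obtain x where x: "\<exists>j\<le>n. x j \<noteq> 0" "\<And>i. i < n \<Longrightarrow> (\<Sum>j\<le>n. c' i j * x j) = 0"
      using Suc.IH[of c'] by blast
    define s where "s = (\<Sum>j\<le>n. c p j * x j)"
    define y where "y j = (if j = Suc n then - s / c p (Suc n) else x j)" for j
    have sum_y: "(\<Sum>j\<le>Suc n. c i j * y j) = (\<Sum>j\<le>n. c i j * x j) - c i (Suc n) * s / c p (Suc n)" for i
      by (simp add: y_def)
    have "(\<Sum>j\<le>Suc n. c i j * y j) = 0" if "i < Suc n" for i
    proof (cases "i = p")
      case True
      then show ?thesis
        using p sum_y[of p] by (simp add: s_def)
    next
      case False
      define k where "k = (if i < p then i else i - 1)"
      have k: "row k = i" "k < n"
        using False that p unfolding k_def row_def by auto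
      have "(\<Sum>j\<le>n. c i j * x j) - c i (Suc n) / c p (Suc n) * s = (\<Sum>j\<le>n. c' k j * x j)"
        unfolding c'_def k s_def by (simp add: left_diff_distrib sum_subtractf sum_distrib_left mult.assoc)
      then show ?thesis
        using x(2)[OF k(2)] sum_y[of i] by simp
    qed
    moreover have "\<exists>j\<le>Suc n. y j \<noteq> 0"
      using x(1) unfolding y_def by (metis Suc_n_not_le_n le_SucI)
    ultimately show ?thesis
      by blast
  qed
qed

text \<open>There are (k + 1) + (k + 3) = 2 k + 4 unknown coefficients, and a remainder modulo
  \<open>f\<close> has at most 2 k + 3 coefficients that must vanish.\<close>

lemma small_congruence:
  fixes f p q :: "'k::field poly"
  assumes "f \<noteq> 0" "degree f \<le> 2 * k + 3"
  obtains A B where "A \<noteq> 0 \<or> B \<noteq> 0" "degree A \<le> k" "degree B \<le> k + 2" "f dvd A * p + q * B"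
proof -
  define m where "m = 2 * k + 3"
  define G where "G j = (if j \<le> k then Polynomial.monom 1 j * p else q * Polynomial.monom 1 (j - (k + 1)))" for j
  obtain x where x: "\<exists>j\<le>m. x j \<noteq> 0" "\<And>i. i < m \<Longrightarrow> (\<Sum>j\<le>m. coeff (G j mod f) i * x j) = 0"
    using homogeneous_system_solution[of m "\<lambda>i j. coeff (G j mod f) i"] by blast
  define A where "A = (\<Sum>j\<le>k. Polynomial.monom (x j) j)"
  define B where "B = (\<Sum>j\<le>k + 2. Polynomial.monom (x (k + 1 + j)) j)"
  have split: "(\<Sum>j\<le>m. h j) = (\<Sum>j\<le>k. h j) + (\<Sum>j\<le>k + 2. h (k + 1 + j))" for h :: "nat \<Rightarrow> 'k poly"
  proof -
    have "m = k + (k + 3)"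
      by (simp add: m_def)
    then have "(\<Sum>j\<le>m. h j) = (\<Sum>j\<le>k. h j) + (\<Sum>j\<in>{k + 1..k + (k + 3)}. h j)"
      unfolding atMost_atLeast0 by (simp only:) (rule sum.ub_add_nat, simp)
    also have "(\<Sum>j\<in>{k + 1..k + (k + 3)}. h j) = (\<Sum>j\<le>k + 2. h (k + 1 + j))"
      by (rule sum.reindex_bij_witness[of _ "\<lambda>j. k + 1 + j" "\<lambda>j. j - (k + 1)"]) auto
    finally show ?thesis .
  qed
  have AB: "A * p + q * B = (\<Sum>j\<le>m. smult (x j) (G j))"
  proof -
    have "Polynomial.monom (x j) i = smult (x j) (Polynomial.monom 1 i)" for i j
      by (simp add: smult_monom)
    then show ?thesis
      unfolding split A_def B_def sum_distrib_right sum_distrib_left by (simp add: G_def)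
  qed
  have small: "coeff (G j mod f) i = 0" if "i \<ge> m" for i j
  proof (cases "G j mod f = 0")
    case False
    then have "degree (G j mod f) < degree f"
      using degree_mod_less[OF assms(1), of "G j"] by auto
    then show ?thesis
      using that assms(2) unfolding m_def by (intro coeff_eq_0) simp
  qed auto
  have "(\<Sum>j\<le>m. smult (x j) (G j mod f)) = 0"
  proof (rule poly_eqI)
    fix i
    show "coeff (\<Sum>j\<le>m. smult (x j) (G j mod f)) i = coeff 0 i"
      using x(2)[of i] small[of i] by (cases "i < m") (simp_all add: coeff_sum mult.commute)
  qed
  then have "A * p + q * B = (\<Sum>j\<le>m. smult (x j) (G j - G j mod f))"
    unfolding AB by (simp add: smult_diff_right sum_subtractf)
  also have "f dvd \<dots>"
    by (intro dvd_sum dvd_smult dvd_minus_mod)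
  finally have "f dvd A * p + q * B" .
  moreover have degs: "degree A \<le> k" "degree B \<le> k + 2"
    unfolding A_def B_def by (intro degree_sum_le; force intro: order_trans[OF degree_monom_le])+
  moreover have "A \<noteq> 0 \<or> B \<noteq> 0"
  proof -
    have coeff_sum_monom: "coeff (\<Sum>j\<le>l. Polynomial.monom (y j) j) i = y i"
      if "i \<le> l" for l i and y :: "nat \<Rightarrow> 'k"
      using that by (simp add: coeff_sum)
    have cA: "coeff A j = x j" if "j \<le> k" for j
      unfolding A_def using that by (rule coeff_sum_monom)
    have cB: "coeff B j = x (k + 1 + j)" if "j \<le> k + 2" for j
      unfolding B_def using that by (rule coeff_sum_monom)
    obtain j where j: "j \<le> m" "x j \<noteq> 0"
      using x(1) by blast
    show ?thesis
    proof (cases "j \<le> k")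
      case True
      then show ?thesis
        using cA j by fastforce
    next
      case False
      then have "coeff B (j - (k + 1)) = x j"
        using cB[of "j - (k + 1)"] j(1) unfolding m_def by simp
      then show ?thesis
        using j(2) by fastforce
    qed
  qed
  ultimately show ?thesis
    using that by blast
qed

lemma separable_factors:
  fixes E R :: "'k::field poly"
  assumes "comaximal (E * R) (pderiv (E * R))"
  shows "comaximal E R" "comaximal E (pderiv E)"
proof -
  obtain s t where st: "s * (E * R) + t * (pderiv E * R + E * pderiv R) = 1"
    using assms unfolding comaximal_def by (auto simp: pderiv_mult algebra_simps)
  have "(s * R + t * pderiv R) * E + (t * pderiv E) * R = 1"
    using st by (simp add: algebra_simps)
  then show "comaximal E R"
    by (rule comaximalI)
  have "(s * R + t * pderiv R) * E + (t * R) * pderiv E = 1"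
    using st by (simp add: algebra_simps)
  then show "comaximal E (pderiv E)"
    by (rule comaximalI)
qed

text \<open>
  The roots $\beta$ of \<open>f\<close> satisfy $A(\beta) \beta' = B(\beta)$.  For \<open>A = 1\<close> and \<open>B\<close> of degree at most
  two this is a Riccati equation.
\<close>

definition roots_satisfy :: "'q::field poly fract poly \<Rightarrow> 'q poly fract poly \<Rightarrow> 'q poly fract poly \<Rightarrow> bool"
  where "roots_satisfy f A B \<longleftrightarrow> f dvd A * coeff_ddt f + pderiv f * B"

text \<open>By the product rule the expression for E R is, modulo E, R times the expression for E,
  and R is invertible modulo E by separability.\<close>

lemma roots_satisfy_factor:
  assumes sep: "comaximal (E * R) (pderiv (E * R))" and "roots_satisfy (E * R) A B"
  shows "roots_satisfy E A B"
proof -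
  have "E dvd A * coeff_ddt (E * R) + pderiv (E * R) * B"
    using assms(2) unfolding roots_satisfy_def by (rule dvd_mult_left)
  also have "A * coeff_ddt (E * R) + pderiv (E * R) * B =
    R * (A * coeff_ddt E + pderiv E * B) + E * (A * coeff_ddt R + pderiv R * B)"
    by (simp add: coeff_ddt_mult pderiv_mult algebra_simps)
  finally have "E dvd R * (A * coeff_ddt E + pderiv E * B)"
    by (metis dvd_add_left_iff dvd_triv_left)
  then show ?thesis
    using comaximal_dvd_mult separable_factors(1)[OF sep] unfolding roots_satisfy_def by blast
qed

text \<open>If A and B share a factor g, the congruence is void at the roots of g. These are
  collected in R = gcd(f, g), whose degree is at most that of A or B, so Liouville's exponent for R
  is good enough. At the other roots g can be cancelled, and the reduced pair \<open>A1\<close>,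
  \<open>B1\<close> yields either the differential estimate or, in weight 0, a Riccati
  equation.\<close>

lemma separable_decomposition:
  fixes f :: "'q::field poly fract poly"
  assumes sep: "comaximal f (pderiv f)" and deg: "degree f \<ge> 2"
  obtains E R where "f = E * R" "degree R \<le> degree f div 2 + 1"
    "approx_exponent (degree E) E (degree f div 2 + 1) \<or> (\<exists>B. degree B \<le> 2 \<and> roots_satisfy E 1 B)"
proof -
  \<comment> \<open>Chosen so that deg f is at most 2 k + 3; degree at least 2 keeps the subtraction
    exact.\<close>
  define k where "k = degree f div 2 - 1"
  have k: "k + 2 = degree f div 2 + 1" "degree f \<le> 2 * k + 3"
    using deg unfolding k_def by auto
  have "f \<noteq> 0"
    using deg by auto
  then obtain A B where AB: "A \<noteq> 0 \<or> B \<noteq> 0" "degree A \<le> k" "degree B \<le> k + 2"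
    "f dvd A * coeff_ddt f + pderiv f * B"
    using small_congruence[OF _ k(2)] by blast
  obtain g A1 B1 where g: "g \<noteq> 0" "A = g * A1" "B = g * B1" "comaximal A1 B1"
    using AB(1) by (rule field_poly_gcd)
  obtain R E g1 where R: "R \<noteq> 0" "f = R * E" "g = R * g1" "comaximal E g1"
    using field_poly_gcd[of f g] \<open>f \<noteq> 0\<close> by blast
  have "degree R \<le> degree g"
    using R g by (simp add: degree_mult_eq)
  also have "\<dots> \<le> k + 2"
    using AB(1-3) g by (auto simp: degree_mult_eq)
  finally have degR: "degree R \<le> k + 2" .
  have f: "f = E * R"
    using R by simp
  have "R * E dvd R * (g1 * (A1 * coeff_ddt f + pderiv f * B1))"
    using AB(4) unfolding g R(3) R(2)[symmetric] by (simp add: algebra_simps)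
  then have "E dvd g1 * (A1 * coeff_ddt f + pderiv f * B1)"
    using R(1) by simp
  then have "E dvd A1 * coeff_ddt f + pderiv f * B1"
    using R(4) comaximal_dvd_mult by blast
  moreover have "comaximal E R"
    using separable_factors(1) sep f by metis
  moreover have "A1 * coeff_ddt (E * R) + pderiv (E * R) * B1 =
    R * (A1 * coeff_ddt E + pderiv E * B1) + E * (A1 * coeff_ddt R + pderiv R * B1)"
    by (simp add: coeff_ddt_mult pderiv_mult algebra_simps)
  ultimately have E: "E dvd A1 * coeff_ddt E + pderiv E * B1"
    unfolding f by (metis comaximal_dvd_mult dvd_add_left_iff dvd_triv_left)
  have sepE: "comaximal E (pderiv E)"
    using separable_factors(2) sep f by metis
  \<comment> \<open>The least weight for which \<open>A1\<close> and \<open>B1\<close> fit the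
    degrees k' and k' + 2. When it is positive, one of the two top coefficients is nonzero, so
    infinity is not a common zero.\<close>
  define k' where "k' = max (degree A1) (degree B1 - 2)"
  have k': "degree A1 \<le> k'" "degree B1 \<le> k' + 2"
    unfolding k'_def by auto
  have degA1: "degree A1 \<le> degree A" and degB1: "degree B1 \<le> degree B"
    using g by (cases "A1 = 0"; cases "B1 = 0"; simp add: degree_mult_eq)+
  have k'_le: "k' \<le> k"
    using AB degA1 degB1 unfolding k'_def by simp
  have "approx_exponent (degree E) E (k + 2) \<or> (\<exists>B. degree B \<le> 2 \<and> roots_satisfy E 1 B)"
  proof (cases "k' = 0")
    case False
    have "coeff A1 k' \<noteq> 0 \<or> coeff B1 (k' + 2) \<noteq> 0"
    proof (cases "k' = degree A1")
      case True
      then have "A1 \<noteq> 0"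
        using False by auto
      then show ?thesis
        using True by simp
    next
      case neq: False
      then have "k' + 2 = degree B1" "B1 \<noteq> 0"
        using False unfolding k'_def by (auto simp: max_def split: if_splits)
      then show ?thesis
        by simp
    qed
    then have "approx_exponent (degree E) E (k' + 2)"
      using approx_exponent_congruence[OF sepE _ _ E, of k'] g(4) k' False by (simp add: comaximal_forms_def)
    then show ?thesis
      using approx_exponent_mono k'_le by (metis add_le_mono1)
  next
    case True
    then obtain a where A1: "A1 = [:a:]"
      using k' by (metis degree_eq_zeroE le_zero_eq)
    show ?thesis
    proof (cases "a = 0")
      case False
      have "A1 * coeff_ddt E + pderiv E * B1 = smult a (1 * coeff_ddt E + pderiv E * smult (inverse a) B1)"
        using False by (simp add: A1 smult_add_right)
      then have "roots_satisfy E 1 (smult (inverse a) B1)"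
        using E False unfolding roots_satisfy_def by (simp add: dvd_smult_iff)
      moreover have "degree (smult (inverse a) B1) \<le> 2"
        using k' True by simp
      ultimately show ?thesis
        by blast
    next
      \<comment> \<open>With \<open>A1\<close> = 0 the coprime \<open>B1\<close> is a unit, so E
        divides its own derivative. Being separable, E is then a unit and satisfies any Riccati
        equation vacuously.\<close>
      case a0: True
      then have "B1 dvd 1"
        using g(4) A1 comaximal_common_dvd[of A1 B1 B1] by simp
      moreover have "E dvd pderiv E * B1"
        using E A1 a0 by simp
      ultimately have "E dvd pderiv E"
        using dvd_mult_unit_iff by blast
      then have "E dvd 1"
        by (rule comaximal_common_dvd[OF sepE dvd_refl])
      then have "roots_satisfy E 1 0"
        unfolding roots_satisfy_def by (meson dvd_trans one_dvd)
      then show ?thesis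
        by (intro disjI2 exI[of _ 0]) simp
    qed
  qed
  then show ?thesis
    using that[OF f] degR k(1) by metis
qed

section \<open>Riccati equations and preimages\<close>

text \<open>The extension of d/dt to polynomials in x with x' = V. It preserves the ideal of G
  exactly if \<open>roots_satisfy G 1 V\<close>, so that differentiation at a root of G becomes
  calculation modulo G.\<close>

lemma derivation_hom_vector_field: "derivation_hom (\<lambda>c. [:c:]) (\<lambda>p. coeff_ddt p + pderiv p * V)"
  by unfold_locales
    (auto simp: coeff_ddt_add coeff_ddt_mult coeff_ddt_pCons pderiv_add pderiv_mult pderiv_pCons algebra_simps)

text \<open>
  The amount by which $\phi = P / Q$ fails to map the derivation $x' = V$ to $y' = B$, which is
  $\phi^\delta + V \phi_x - B(\phi)$, times $Q^2$.
\<close>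

definition transport_defect :: "'q::field poly fract poly \<Rightarrow> 'q poly fract poly \<Rightarrow> 'q poly fract poly \<Rightarrow>
    'q poly fract poly \<Rightarrow> 'q poly fract poly"
  where "transport_defect P Q V B =
    Q * (coeff_ddt P + pderiv P * V) - P * (coeff_ddt Q + pderiv Q * V) - form_comp 2 B P Q"

lemma degree_transport_defect_le:
  assumes "degree P \<le> d" "degree Q \<le> d" "d \<ge> 1" "degree V \<le> 2"
  shows "degree (transport_defect P Q V B) \<le> 2 * d + 1"
proof -
  have D: "degree (coeff_ddt p + pderiv p * V) \<le> d + 1" if "degree p \<le> d" for p
  proof (rule degree_add_le)
    show "degree (coeff_ddt p) \<le> d + 1"
      using degree_coeff_ddt_le[of p] that by simp
    show "degree (pderiv p * V) \<le> d + 1"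
      using degree_mult_le[of "pderiv p" V] degree_pderiv_le[of p] that assms by simp
  qed
  have "degree (Q * (coeff_ddt P + pderiv P * V)) \<le> 2 * d + 1"
    using degree_mult_le[of Q "coeff_ddt P + pderiv P * V"] D[OF assms(1)] assms by simp
  moreover have "degree (P * (coeff_ddt Q + pderiv Q * V)) \<le> 2 * d + 1"
    using degree_mult_le[of P "coeff_ddt Q + pderiv Q * V"] D[OF assms(2)] assms by simp
  moreover have "degree (form_comp 2 B P Q) \<le> 2 * d + 1"
    using degree_form_comp[OF assms(1,2), of 2 B] by simp
  ultimately show ?thesis
    unfolding transport_defect_def by (intro degree_diff_le)
qed

text \<open>Let x be a root of G, so x' = V(x), with \<phi>(x) = y a root of E, so y' = B(y).
  Differentiating y = \<phi>(x) shows that the defect vanishes at x. Without roots: in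
  \<open>D_binform_congruence\<close> at (P, Q) both \<Phi> and D \<Phi> vanish modulo G, so the
  defect times \<Psi> does, and \<Psi> is invertible modulo G.\<close>

lemma riccati_preimage:
  assumes PQ: "comaximal P Q"
    and E: "comaximal E (pderiv E)" "roots_satisfy E 1 B" "degree B \<le> 2"
    and G: "roots_satisfy G 1 V" and dvd: "G dvd form_comp (degree E) E P Q"
  shows "G dvd transport_defect P Q V B"
proof (cases "degree E = 0")
  case True
  then obtain c where c: "E = [:c:]"
    by (rule degree_eq_zeroE)
  have "c \<noteq> 0"
    using E(1) c by (auto simp: comaximal_def)
  then have "[:c:] dvd 1"
    by (simp add: is_unit_const_poly_iff dvd_field_iff)
  then have "G dvd 1"
    using dvd unfolding True c by (auto simp: const_hom.binform_const intro: dvd_trans)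
  then show ?thesis
    by (meson dvd_trans one_dvd)
next
  case False
  define r where "r = degree E"
  define D where "D p = coeff_ddt p + pderiv p * V" for p
  interpret D: derivation_hom "\<lambda>c. [:c:]" D
    unfolding D_def by (rule derivation_hom_vector_field)
  obtain H where H: "1 * coeff_ddt E + pderiv E * B = E * H"
    using E(2) unfolding roots_satisfy_def by blast
  define \<Phi> where "\<Phi> = form_comp r E P Q"
  define \<Psi> where "\<Psi> = form_comp (r - 1) (pderiv E) P Q"
  have one: "form_comp 0 1 P Q = 1"
    by (simp add: const_hom.binform_1)
  have eq: "Q * D \<Phi> = \<Psi> * (Q * D P - P * D Q - form_comp 2 B P Q) + \<Phi> * (form_comp 1 H P Q + of_nat r * D Q)"
    using D.D_binform_congruence(2)[OF H r_def[symmetric], of 0 P Q] False E(3)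
    unfolding \<Phi>_def \<Psi>_def one by (simp add: r_def numeral_2_eq_2)
  have dG: "G dvd D G"
    using G unfolding roots_satisfy_def D_def by simp
  have G\<Phi>: "G dvd \<Phi>"
    using dvd unfolding \<Phi>_def r_def .
  then obtain K where K: "\<Phi> = G * K"
    by blast
  have "G dvd D \<Phi>"
    unfolding K D.D_mult using dG by simp
  then have "G dvd Q * D \<Phi>"
    by simp
  then have "G dvd \<Psi> * (Q * D P - P * D Q - form_comp 2 B P Q)"
    unfolding eq using G\<Phi> by (metis dvd_add_left_iff dvd_mult2)
  \<comment> \<open>Modulo both, the Nullstellensatz for E and its derivative makes the powers of P
    and of Q vanish, but these generate 1.\<close>
  moreover have "comaximal \<Phi> \<Psi>"
  proof -
    obtain s t s' t' where
      1: "\<And>u v. form_comp (r - 1) s u v * form_comp r E u v + form_comp r t u v * form_comp (r - 1) (pderiv E) u v = u ^ (r - 1 + r)" and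
      2: "\<And>u v. form_comp (r - 1) s' u v * form_comp r E u v + form_comp r t' u v * form_comp (r - 1) (pderiv E) u v = v ^ (r - 1 + r)"
      using comaximal_forms_powers[OF const_hom.coeff_hom_axioms comaximal_forms_pderiv[OF E(1)]]
      unfolding r_def by metis
    obtain g h where gh: "g * P ^ (r - 1 + r) + h * Q ^ (r - 1 + r) = 1"
      using comaximal_power[OF PQ] unfolding comaximal_def by blast
    have "(g * form_comp (r - 1) s P Q + h * form_comp (r - 1) s' P Q) * \<Phi>
      + (g * form_comp r t P Q + h * form_comp r t' P Q) * \<Psi> = 1"
      unfolding gh[symmetric] 1[of P Q, symmetric] 2[of P Q, symmetric] \<Phi>_def \<Psi>_def
      by (simp add: algebra_simps)
    then show ?thesis
      by (rule comaximalI)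
  qed
  then have "comaximal G \<Psi>"
    using G\<Phi> comaximal_dvd_left by blast
  ultimately have "G dvd Q * D P - P * D Q - form_comp 2 B P Q"
    by (rule comaximal_dvd_mult[rotated])
  then show ?thesis
    unfolding transport_defect_def D_def .
qed


section \<open>The linear system of condition (1) as vanishing of coefficients\<close>

lemma coeff_form: "coeff (form d a) i = (if i \<le> d then a i else 0)"
  by (simp add: form_def coeff_sum)

lemma degree_form_le: "degree (form d a) \<le> d"
  by (rule degree_le) (simp add: coeff_form)

text \<open>The sums in the linear system are coefficients of products, counted from the top degree \<open>2 d\<close>.\<close>

lemma zcoeff_sum:
  fixes a b :: "nat \<Rightarrow> 'k::field"
  shows "(\<Sum>i=0..n. zcoeff a (int d - i) * zcoeff b (int d - n + i)) =
    (if n \<le> 2 * int d then coeff (form d a * form d b) (nat (2 * int d - n)) else 0)"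
proof -
  \<comment> \<open>For i between 0 and n no index exceeds \<open>d\<close>, and
    \<open>zcoeff\<close> removes the negative ones, so exactly the coefficients of the two forms
    survive.\<close>
  define S where "S = {i \<in> {0..n}. i \<le> int d \<and> n - i \<le> int d}"
  have S: "(\<Sum>i=0..n. zcoeff a (int d - i) * zcoeff b (int d - n + i)) =
      (\<Sum>i\<in>S. zcoeff a (int d - i) * zcoeff b (int d - n + i))"
    by (rule sum.mono_neutral_right) (auto simp: S_def zcoeff_def)
  show ?thesis
  proof (cases "n \<le> 2 * int d")
    case True
    define N where "N = nat (2 * int d - n)"
    have N: "int N = 2 * int d - n"
      using True unfolding N_def by simp
    have "coeff (form d a * form d b) N = (\<Sum>k | k \<le> N \<and> k \<le> d \<and> N - k \<le> d. coeff (form d a) k * coeff (form d b) (N - k))"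
      unfolding coeff_mult by (rule sum.mono_neutral_right) (auto simp: coeff_form)
    also have "\<dots> = (\<Sum>i\<in>S. zcoeff a (int d - i) * zcoeff b (int d - n + i))"
    proof (rule sum.reindex_bij_witness[of _ "\<lambda>i. nat (int d - i)" "\<lambda>k. int d - int k"])
      fix i assume "i \<in> S"
      then have i: "0 \<le> i" "i \<le> n" "i \<le> int d" "n - i \<le> int d"
        unfolding S_def by auto
      show "int d - int (nat (int d - i)) = i" "nat (int d - i) \<in> {k. k \<le> N \<and> k \<le> d \<and> N - k \<le> d}"
        using i N by auto
    next
      fix k assume "k \<in> {k. k \<le> N \<and> k \<le> d \<and> N - k \<le> d}"
      then have k: "k \<le> N" "k \<le> d" "N - k \<le> d"
        by auto
      then show "nat (int d - (int d - int k)) = k" "int d - int k \<in> S"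
        using N unfolding S_def by auto
      have 1: "int d - n + (int d - int k) = int (N - k)" and 2: "int d - (int d - int k) = int k"
        using k N by auto
      show "zcoeff a (int d - (int d - int k)) * zcoeff b (int d - n + (int d - int k)) =
          coeff (form d a) k * coeff (form d b) (N - k)"
        unfolding 1 2 using k by (simp add: zcoeff_def coeff_form del: of_nat_diff)
    qed
    finally show ?thesis
      using True S unfolding N_def by simp
  next
    case False
    then have "S = {}"
      unfolding S_def by auto
    then show ?thesis
      using False S by simp
  qed
qed

lemma form_times_index: "form d (\<lambda>j. of_nat j * a j) = pCons 0 (pderiv (form d a))"
  by (rule poly_eqI) (auto simp: coeff_form coeff_pCons coeff_pderiv split: nat.splits)

lemma form_ddt: "form d (\<lambda>j. ddt (a j)) = coeff_ddt (form d a)"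
  by (rule poly_eqI) (simp add: coeff_form coeff_map_poly)

text \<open>The weight n - 2 i is the difference of the two indices. So x d/dx acts on one factor
  minus on the other, which gives x times the Wronskian of the forms.\<close>

lemma zcoeff_weighted_sum:
  fixes a b :: "nat \<Rightarrow> 'k::field"
  shows "(\<Sum>i=0..n. of_int (n - 2 * i) * zcoeff a (int d - i) * zcoeff b (int d - n + i)) =
    (if n \<le> 2 * int d then coeff (pCons 0 (form d b * pderiv (form d a) - form d a * pderiv (form d b))) (nat (2 * int d - n)) else 0)"
proof -
  have z: "of_int j * zcoeff a j = zcoeff (\<lambda>j. of_nat j * a j) j" for j and a :: "nat \<Rightarrow> 'k"
    by (simp add: zcoeff_def)
  have "of_int (n - 2 * i) * zcoeff a (int d - i) * zcoeff b (int d - n + i)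
      = zcoeff (\<lambda>j. of_nat j * a j) (int d - i) * zcoeff b (int d - n + i)
        - zcoeff a (int d - i) * zcoeff (\<lambda>j. of_nat j * b j) (int d - n + i)" for i
    unfolding z[symmetric] by (simp add: algebra_simps)
  then have "(\<Sum>i=0..n. of_int (n - 2 * i) * zcoeff a (int d - i) * zcoeff b (int d - n + i)) =
     (if n \<le> 2 * int d then coeff (form d (\<lambda>j. of_nat j * a j) * form d b - form d a * form d (\<lambda>j. of_nat j * b j)) (nat (2 * int d - n)) else 0)"
    by (simp add: sum_subtractf zcoeff_sum)
  then show ?thesis
    unfolding form_times_index by (simp add: mult.commute)
qed

text \<open>The unknowns are the coefficients of B = a x^2 + b x + c and V = e x^2 + f x + g, and
  equation n is the coefficient of x^(2 d - n) in the defect. The weighted sums are coefficients of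
  x W, while V W needs x^2 W, x W and W; hence the shifts n + 1, n and n - 1. So a vanishing defect
  would solve the system.\<close>

lemma transport_defect_nonzero:
  assumes c1: "condition1 d \<alpha> \<beta>" and "degree V \<le> 2" "degree B \<le> 2"
  shows "transport_defect (form d \<alpha>) (form d \<beta>) V B \<noteq> 0"
proof
  assume eq0: "transport_defect (form d \<alpha>) (form d \<beta>) V B = 0"
  define P where "P = form d \<alpha>"
  define Q where "Q = form d \<beta>"
  define a b c where "a = coeff B 2" and "b = coeff B 1" and "c = coeff B 0"
  define e f g where "e = coeff V 2" and "f = coeff V 1" and "g = coeff V 0"
  have quadratic: "p = [:coeff p 0, coeff p 1, coeff p 2:]" if "degree p \<le> 2" for p :: "'a poly fract poly"
    using that by (intro poly_eqI) (auto simp: coeff_pCons coeff_eq_0 numeral_2_eq_2 split: nat.splits)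
  have V: "V = [:g, f, e:]" and B: "B = [:c, b, a:]"
    unfolding a_def b_def c_def e_def f_def g_def using assms quadratic by auto
  define W where "W = Q * pderiv P - P * pderiv Q"
  have "form_comp 2 B P Q = smult c (Q * Q) + smult b (P * Q) + smult a (P * P)"
    unfolding B numeral_2_eq_2 const_hom.binform_pCons const_hom.binform_const
    by (simp add: binform_def algebra_simps)
  moreover have "transport_defect P Q V B = Q * coeff_ddt P - P * coeff_ddt Q + V * W - form_comp 2 B P Q"
    unfolding transport_defect_def W_def by (simp add: algebra_simps)
  moreover have "V * W = smult g W + smult f (pCons 0 W) + smult e (pCons 0 (pCons 0 W))"
    unfolding V by (simp add: algebra_simps)
  ultimately have "Q * coeff_ddt P - P * coeff_ddt Q + (smult g W + smult f (pCons 0 W) + smult e (pCons 0 (pCons 0 W)))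
      - (smult a (P * P) + smult b (P * Q) + smult c (Q * Q)) = transport_defect P Q V B"
    by (simp add: algebra_simps)
  then have zero: "coeff (Q * coeff_ddt P) N - coeff (P * coeff_ddt Q) N
      + (g * coeff W N + f * coeff (pCons 0 W) N + e * coeff (pCons 0 (pCons 0 W)) N)
      - (a * coeff (P * P) N + b * coeff (P * Q) N + c * coeff (Q * Q) N) = 0" for N
    using eq0 unfolding P_def[symmetric] Q_def[symmetric]
    by (metis (no_types, lifting) coeff_0 coeff_add coeff_diff coeff_smult)
  have "linear_system d \<alpha> \<beta> a b c e f g"
    unfolding linear_system_def Let_def
  proof
    fix n :: int assume n: "n \<in> {0..6}"
    define D where "D = int d"
    have dd: "ddt (zcoeff x j) = zcoeff (\<lambda>j. ddt (x j)) j" for x :: "nat \<Rightarrow> 'a poly fract" and j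
      by (simp add: zcoeff_def)
    have s1: "(\<Sum>i=0..n + 1. of_int (n + 1 - 2 * i) * zcoeff \<alpha> (D - i) * zcoeff \<beta> (D - n - 1 + i)) =
      (if n + 1 \<le> 2 * D then coeff (pCons 0 W) (nat (2 * D - (n + 1))) else 0)"
      using zcoeff_weighted_sum[of "n + 1" \<alpha> d \<beta>] unfolding P_def Q_def W_def D_def by (simp add: diff_diff_eq)
    have s2: "(\<Sum>i=0..n. of_int (n - 2 * i) * zcoeff \<alpha> (D - i) * zcoeff \<beta> (D - n + i)) =
      (if n \<le> 2 * D then coeff (pCons 0 W) (nat (2 * D - n)) else 0)"
      using zcoeff_weighted_sum[of n \<alpha> d \<beta>] unfolding P_def Q_def W_def D_def by simp
    have s3: "(\<Sum>i=0..n - 1. of_int (n - 1 - 2 * i) * zcoeff \<alpha> (D - i) * zcoeff \<beta> (D - n + 1 + i)) =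
      (if n - 1 \<le> 2 * D then coeff (pCons 0 W) (nat (2 * D - (n - 1))) else 0)"
      using zcoeff_weighted_sum[of "n - 1" \<alpha> d \<beta>] unfolding P_def Q_def W_def D_def by (simp add: algebra_simps)
    show "- (\<Sum>i=0..n. zcoeff \<alpha> (int d - i) * zcoeff \<alpha> (int d - n + i)) * a
       - (\<Sum>i=0..n. zcoeff \<alpha> (int d - i) * zcoeff \<beta> (int d - n + i)) * b
       - (\<Sum>i=0..n. zcoeff \<beta> (int d - i) * zcoeff \<beta> (int d - n + i)) * c
       + (\<Sum>i=0..n+1. of_int (n + 1 - 2 * i) * zcoeff \<alpha> (int d - i) * zcoeff \<beta> (int d - n - 1 + i)) * e
       + (\<Sum>i=0..n. of_int (n - 2 * i) * zcoeff \<alpha> (int d - i) * zcoeff \<beta> (int d - n + i)) * f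
       + (\<Sum>i=0..n-1. of_int (n - 1 - 2 * i) * zcoeff \<alpha> (int d - i) * zcoeff \<beta> (int d - n + 1 + i)) * g
       = (\<Sum>i=0..n. zcoeff \<alpha> (int d - i) * ddt (zcoeff \<beta> (int d - n + i)))
         - (\<Sum>i=0..n. zcoeff \<beta> (int d - i) * ddt (zcoeff \<alpha> (int d - n + i)))"
      unfolding dd zcoeff_sum form_ddt unfolding D_def[symmetric] s1 s2 s3 P_def[symmetric] Q_def[symmetric]
    proof (cases "n \<le> 2 * D")
      case True
      define N where "N = nat (2 * D - n)"
      \<comment> \<open>For n = 2 d the guard yields 0, as does the constant coefficient of x^2
        W.\<close>
      have 1: "(if n + 1 \<le> 2 * D then coeff (pCons 0 W) (nat (2 * D - (n + 1))) else 0) = coeff (pCons 0 (pCons 0 W)) N"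
      proof (cases "n + 1 \<le> 2 * D")
        case True
        then have "N = Suc (nat (2 * D - (n + 1)))"
          unfolding N_def by simp
        then show ?thesis
          using True by simp
      next
        case False
        then show ?thesis
          using \<open>n \<le> 2 * D\<close> by (simp add: N_def)
      qed
      have 3: "nat (2 * D - (n - 1)) = Suc N"
        using True by (simp add: N_def)
      show "- (if n \<le> 2 * D then coeff (P * P) (nat (2 * D - n)) else 0) * a
        - (if n \<le> 2 * D then coeff (P * Q) (nat (2 * D - n)) else 0) * b
        - (if n \<le> 2 * D then coeff (Q * Q) (nat (2 * D - n)) else 0) * c
        + (if n + 1 \<le> 2 * D then coeff (pCons 0 W) (nat (2 * D - (n + 1))) else 0) * e
        + (if n \<le> 2 * D then coeff (pCons 0 W) (nat (2 * D - n)) else 0) * f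
        + (if n - 1 \<le> 2 * D then coeff (pCons 0 W) (nat (2 * D - (n - 1))) else 0) * g
        = (if n \<le> 2 * D then coeff (P * coeff_ddt Q) (nat (2 * D - n)) else 0)
          - (if n \<le> 2 * D then coeff (Q * coeff_ddt P) (nat (2 * D - n)) else 0)"
        using zero[of N] True unfolding 1 3 N_def[symmetric] by (simp add: algebra_simps)
    next
      case False
      \<comment> \<open>Beyond 2 d only the last sum may pass its guard, for n = 2 d + 1, and it
        then reads the constant coefficient of x W, which is 0.\<close>
      then have "nat (2 * D - (n - 1)) = 0"
        by simp
      with False show "- (if n \<le> 2 * D then coeff (P * P) (nat (2 * D - n)) else 0) * a
        - (if n \<le> 2 * D then coeff (P * Q) (nat (2 * D - n)) else 0) * b
        - (if n \<le> 2 * D then coeff (Q * Q) (nat (2 * D - n)) else 0) * c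
        + (if n + 1 \<le> 2 * D then coeff (pCons 0 W) (nat (2 * D - (n + 1))) else 0) * e
        + (if n \<le> 2 * D then coeff (pCons 0 W) (nat (2 * D - n)) else 0) * f
        + (if n - 1 \<le> 2 * D then coeff (pCons 0 W) (nat (2 * D - (n - 1))) else 0) * g
        = (if n \<le> 2 * D then coeff (P * coeff_ddt Q) (nat (2 * D - n)) else 0)
          - (if n \<le> 2 * D then coeff (Q * coeff_ddt P) (nat (2 * D - n)) else 0)"
        by simp
    qed
  qed
  then show False
    using c1 unfolding condition1_def by blast
qed


section \<open>Simplicity of the preimages of infinity\<close>

text \<open>The dehomogenized denominator of $\phi^m$ for $\phi = P / Q$, of degree \<open>d ^ m\<close> as a form.\<close>

primrec iterate_denominator :: "nat \<Rightarrow> 'k::comm_ring_1 poly \<Rightarrow> 'k poly \<Rightarrow> nat \<Rightarrow> 'k poly"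
  where
    "iterate_denominator d P Q 0 = 1"
  | "iterate_denominator d P Q (Suc m) = form_comp (d ^ m) (iterate_denominator d P Q m) P Q"

lemma degree_iterate_denominator:
  assumes "degree P \<le> d" "degree Q \<le> d"
  shows "degree (iterate_denominator d P Q m) \<le> d ^ m"
proof (cases m)
  case (Suc n)
  then show ?thesis
    using degree_form_comp[OF assms, of "d ^ n" "iterate_denominator d P Q n"] by (simp add: mult.commute)
qed simp

definition form_zero :: "nat \<Rightarrow> 'k::field poly \<Rightarrow> 'k P1 \<Rightarrow> bool"
  where "form_zero n f w = (case w of Fin y \<Rightarrow> poly f y = 0 | Infty \<Rightarrow> coeff f n = 0)"

lemma binform_dehomogenize:
  fixes f :: "'k::field poly"
  assumes "degree f \<le> n" "q \<noteq> 0"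
  shows "binform (\<lambda>c. c) n f p q = q ^ n * poly f (p / q)"
proof -
  have eq: "poly f (p / q) = (\<Sum>i\<le>n. coeff f i * (p / q) ^ i)"
    unfolding poly_altdef using assms(1) by (intro sum.mono_neutral_left) (auto simp: coeff_eq_0)
  have summand: "q ^ n * (coeff f i * (p / q) ^ i) = coeff f i * p ^ i * q ^ (n - i)" if "i \<le> n" for i
    using that assms(2) by (simp add: power_divide power_diff field_simps)
  show ?thesis
    unfolding binform_def eq sum_distrib_left by (intro sum.cong refl) (simp only: summand atMost_iff)
qed

lemma binform_infinity: "binform (\<lambda>c. c) n f p 0 = coeff f n * p ^ n"
proof -
  have "binform (\<lambda>c. c) n f p 0 = (\<Sum>i\<in>{n}. coeff f i * p ^ i * 0 ^ (n - i))"
    unfolding binform_def by (rule sum.mono_neutral_right) (auto simp: power_0_left split: if_splits)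
  then show ?thesis
    by simp
qed

lemma binform_zero_iff:
  fixes f :: "'k::field poly"
  assumes "degree f \<le> n" "p \<noteq> 0 \<or> q \<noteq> 0"
  shows "binform (\<lambda>c. c) n f p q = 0 \<longleftrightarrow> form_zero n f (ratio p q)"
  using assms by (cases "q = 0") (auto simp: binform_dehomogenize binform_infinity form_zero_def ratio_def)

lemma poly_form_comp: "poly (form_comp n f P Q) x = binform (\<lambda>c. c) n f (poly P x) (poly Q x)"
  by (simp add: binform_def poly_sum mult.assoc)

lemma order_mult_nonroot: "p * q \<noteq> 0 \<Longrightarrow> poly q x \<noteq> 0 \<Longrightarrow> Polynomial.order x (p * q) = Polynomial.order x p"
  by (simp add: order_mult order_0I)

text \<open>Split off the linear factor of the form \<open>f\<close> at the image of
  \<open>x\<close>: X - y Y if the image is finite, Y if it is infinite, in which case n = deg f +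
  1. After substitution this factor carries the ramification index at \<open>x\<close>, and by
  simplicity the cofactor does not vanish there.\<close>

lemma simple_preimage:
  fixes f P Q :: "'k::field poly"
  assumes f: "f \<noteq> 0" "degree f \<le> n" "n \<le> degree f + 1" and simple: "\<And>y. Polynomial.order y f \<le> 1"
    and PQ: "poly P x \<noteq> 0 \<or> poly Q x \<noteq> 0" and Q: "Q \<noteq> 0" and lin: "\<And>y. P - smult y Q \<noteq> 0"
    and unram: "form_zero n f (ratio (poly P x) (poly Q x)) \<Longrightarrow>
      vanishing_order P Q x (ratio (poly P x) (poly Q x)) \<le> 1"
  shows "form_comp n f P Q \<noteq> 0 \<and> Polynomial.order x (form_comp n f P Q) \<le> 1"
proof (cases "form_zero n f (ratio (poly P x) (poly Q x))")
  case False
  then have "poly (form_comp n f P Q) x \<noteq> 0"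
    using binform_zero_iff[OF f(2) PQ] by (simp add: poly_form_comp)
  then show ?thesis
    using order_0I by fastforce
next
  case zero: True
  show ?thesis
  proof (cases "poly Q x = 0")
    case False
    define y where "y = poly P x / poly Q x"
    have w: "ratio (poly P x) (poly Q x) = Fin y"
      using False by (simp add: ratio_def y_def)
    then have "poly f y = 0"
      using zero by (simp add: form_zero_def)
    then have "Polynomial.order y f = 1"
      using simple[of y] f(1) order_root[of f y] by simp
    then obtain g where g: "f = [:- y, 1:] * g" "\<not> [:- y, 1:] dvd g"
      using order_decomp[OF f(1), of y] by auto
    have gy: "poly g y \<noteq> 0"
      using g(2) by (simp add: poly_eq_0_iff_dvd)
    have g0: "g \<noteq> 0"
      using gy by auto
    have "degree f = Suc (degree g)"
      using g0 unfolding g(1) by (subst degree_mult_eq) auto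
    then obtain k where k: "n = 1 + k" "degree g \<le> k"
      using f(2) by (cases n) auto
    have "form_comp n f P Q = form_comp 1 [:- y, 1:] P Q * form_comp k g P Q"
      unfolding k(1) g(1) using k(2) by (intro const_hom.binform_mult) auto
    also have "form_comp 1 [:- y, 1:] P Q = P - smult y Q"
      using const_hom.binform_linear[of "- y" 1 P Q] by simp
    finally have split: "form_comp n f P Q = (P - smult y Q) * form_comp k g P Q" .
    have rest: "poly (form_comp k g P Q) x \<noteq> 0"
      unfolding poly_form_comp binform_dehomogenize[OF k(2) False] using gy False by (simp add: y_def)
    then have "form_comp n f P Q \<noteq> 0"
      unfolding split using lin by auto
    then show ?thesis
      using order_mult_nonroot[OF _ rest] unram[OF zero] unfolding split w vanishing_order_def by simp
  next
    case True
    have w: "ratio (poly P x) (poly Q x) = Infty"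
      using True by (simp add: ratio_def)
    then have "coeff f n = 0"
      using zero by (simp add: form_zero_def)
    then have "degree f \<noteq> n"
      using f(1) by auto
    then obtain k where k: "n = 1 + k" "degree f = k"
      using f(2,3) by (cases n) auto
    have split: "form_comp n f P Q = Q * form_comp k f P Q"
      using const_hom.binform_Suc[of f k P Q] k by simp
    have rest: "poly (form_comp k f P Q) x \<noteq> 0"
      unfolding poly_form_comp True binform_infinity using PQ True f(1) k(2) by auto
    then have "form_comp n f P Q \<noteq> 0"
      unfolding split using Q by auto
    then show ?thesis
      using order_mult_nonroot[OF _ rest] unram[OF zero] unfolding split w vanishing_order_def by simp
  qed
qed

text \<open>\<open>reversal N f\<close> is $x^N f(1/x)$.\<close>

abbreviation reversal :: "nat \<Rightarrow> 'k::comm_ring_1 poly \<Rightarrow> 'k poly"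
  where "reversal N f \<equiv> form_comp N f 1 [:0, 1:]"

lemma poly_reversal_0: "poly (reversal N f) 0 = coeff f N"
  unfolding poly_form_comp by (simp add: binform_infinity)

lemma reversal_split:
  fixes f :: "'k::field poly"
  assumes "degree f \<le> N"
  shows "reversal N f = [:0, 1:] ^ (N - degree f) * reversal (degree f) f"
  using const_hom.binform_lift[of f "degree f" "N - degree f" 1 "[:0, 1:]"] assms by simp

lemma reversal_nonzero:
  fixes f :: "'k::field poly"
  assumes "degree f \<le> N" "f \<noteq> 0"
  shows "reversal N f \<noteq> 0"
proof -
  have "poly (reversal (degree f) f) 0 \<noteq> 0"
    using assms(2) by (simp add: poly_reversal_0)
  then have "reversal (degree f) f \<noteq> 0"
    by auto
  then show ?thesis
    unfolding reversal_split[OF assms(1)] by simp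
qed

text \<open>This is the multiplicity of infinity as a zero of the form of degree \<open>N\<close>,
  so that questions at infinity can be settled at 0.\<close>

lemma order_reversal:
  fixes f :: "'k::field poly"
  assumes "degree f \<le> N" "f \<noteq> 0"
  shows "Polynomial.order 0 (reversal N f) = N - degree f"
proof -
  have "poly (reversal (degree f) f) 0 \<noteq> 0"
    using assms(2) by (simp add: poly_reversal_0)
  moreover have "reversal N f \<noteq> 0"
    using reversal_nonzero[OF assms] .
  ultimately show ?thesis
    using order_mult_nonroot[of "[:0, 1:] ^ (N - degree f)" "reversal (degree f) f" 0] order_power_n_n[of 0 "N - degree f"]
    unfolding reversal_split[OF assms(1)] by simp
qed

lemma reversal_form: "form d (rev_coeffs d a) = reversal d (form d a)"
proof (rule poly_eqI)
  fix j
  have "[:c:] * 1 ^ i * [:0, 1:] ^ k = Polynomial.monom (c::'a) k" for c i k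
    by (simp add: monom_altdef)
  then have "coeff (reversal d (form d a)) j = (\<Sum>i\<le>d. coeff (Polynomial.monom (coeff (form d a) i) (d - i)) j)"
    unfolding binform_def coeff_sum by simp
  also have "\<dots> = (\<Sum>i\<le>d. if d - i = j then a i else 0)"
    by (intro sum.cong) (auto simp: coeff_form)
  also have "\<dots> = (if j \<le> d then a (d - j) else 0)"
  proof (cases "j \<le> d")
    case True
    then have "(\<Sum>i\<le>d. if d - i = j then a i else 0) = (\<Sum>i\<in>{d - j}. if d - i = j then a i else 0)"
      by (intro sum.mono_neutral_right) auto
    then show ?thesis
      using True by simp
  qed (auto intro: sum.neutral)
  finally show "coeff (form d (rev_coeffs d a)) j = coeff (reversal d (form d a)) j"
    by (simp add: coeff_form rev_coeffs_def)
qed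

text \<open>The form at level m + 1 is the pullback under \<phi> of that at level m. A multiple zero
  of it would be a critical point of \<phi> that reaches infinity in m + 1 steps. The inequality
  between d ^ m and the degree says that infinity is at most a simple zero.\<close>

lemma simple_iterate_denominator:
  fixes a b :: "nat \<Rightarrow> 'k::field" and d :: nat
  defines "P \<equiv> form d a" and "Q \<equiv> form d b"
  assumes d: "d \<ge> 1" and PQ: "comaximal P Q" "max (degree P) (degree Q) = d" and Q: "Q \<noteq> 0"
    and crit: "\<And>\<gamma>. critical_point d a b \<gamma> \<Longrightarrow> Infty \<notin> forward_orbit (rat_map d a b) \<gamma>"
  shows "iterate_denominator d P Q m \<noteq> 0 \<and> d ^ m \<le> degree (iterate_denominator d P Q m) + 1 \<and>
    (\<forall>y. Polynomial.order y (iterate_denominator d P Q m) \<le> 1) \<and>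
    (\<forall>\<gamma>. form_zero (d ^ m) (iterate_denominator d P Q m) \<gamma> \<longleftrightarrow> (rat_map d a b ^^ m) \<gamma> = Infty)"
proof (induction m)
  case 0
  show ?case
    \<comment> \<open>At level 0 the polynomial 1 is a form of degree d ^ 0 = 1, that is Y, with
      infinity as its only zero.\<close>
    by (auto simp: form_zero_def split: P1.split)
next
  case (Suc m)
  define f where "f = iterate_denominator d P Q m"
  define n where "n = d ^ m"
  have degPQ: "degree P \<le> d" "degree Q \<le> d"
    unfolding P_def Q_def by (rule degree_form_le)+
  have f: "f \<noteq> 0" "degree f \<le> n" "n \<le> degree f + 1" "\<And>y. Polynomial.order y f \<le> 1"
    and zero: "\<And>\<gamma>. form_zero n f \<gamma> \<longleftrightarrow> (rat_map d a b ^^ m) \<gamma> = Infty"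
    using Suc.IH degree_iterate_denominator[OF degPQ] unfolding f_def n_def by auto
  have unram: "ramification_index d a b \<gamma> \<le> 1" if "form_zero n f (rat_map d a b \<gamma>)" for \<gamma>
  proof -
    have "(rat_map d a b ^^ Suc m) \<gamma> = Infty"
      using that zero by (simp add: funpow_Suc_right del: funpow.simps)
    then have "Infty \<in> forward_orbit (rat_map d a b) \<gamma>"
      unfolding forward_orbit_def by (metis (mono_tags, lifting) CollectI One_nat_def Suc_le_mono le0)
    then show ?thesis
      using crit unfolding critical_point_def by (meson not_le)
  qed
  obtain s t where st: "s * P + t * Q = 1"
    using PQ(1) unfolding comaximal_def by blast
  have nonzero: "poly P x \<noteq> 0 \<or> poly Q x \<noteq> 0" for x
    using arg_cong[OF st, of "\<lambda>p. poly p x"] by auto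
  have lin: "P - smult y Q \<noteq> 0" for y
  proof
    assume "P - smult y Q = 0"
    then have P: "P = smult y Q"
      by simp
    then have "(smult y s + t) * Q = 1"
      using st by (simp add: algebra_simps)
    then have "degree Q = 0"
      using \<open>Q \<noteq> 0\<close> by (metis degree_1 degree_mult_eq_0 mult_eq_0_iff one_neq_zero)
    then show False
      using PQ(2) d P by (simp split: if_splits)
  qed
  have coeffs: "coeff P d = a d" "coeff Q d = b d"
    by (auto simp: P_def Q_def coeff_form)
  have nonzero_inf: "a d \<noteq> 0 \<or> b d \<noteq> 0"
    using PQ(2) d unfolding coeffs[symmetric] by (metis degree_0 leading_coeff_neq_0 max_def not_one_le_zero)
  define F where "F = form_comp n f P Q"
  have F: "iterate_denominator d P Q (Suc m) = F"
    unfolding F_def f_def n_def by simp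
  have degF: "degree F \<le> n * d"
    unfolding F_def by (rule degree_form_comp[OF degPQ])
  have fin: "F \<noteq> 0 \<and> Polynomial.order x F \<le> 1" for x
    unfolding F_def using unram[of "Fin x"]
    by (intro simple_preimage f nonzero Q lin) (simp add: P_def Q_def)
  \<comment> \<open>Multiplicity at infinity: the reversed form is again a pullback of f, by the
    reversals of P and Q, so \<open>simple_preimage\<close> applies at 0.\<close>
  have rev: "reversal (n * d) F = form_comp n f (reversal d P) (reversal d Q)"
    unfolding F_def using const_hom.binform_comp[OF degPQ f(2)] .
  have "Polynomial.order 0 (reversal (n * d) F) \<le> 1"
  proof -
    have "form_comp n f (reversal d P) (reversal d Q) \<noteq> 0 \<and>
      Polynomial.order 0 (form_comp n f (reversal d P) (reversal d Q)) \<le> 1"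
    proof (rule simple_preimage[OF f])
      show "poly (reversal d P) 0 \<noteq> 0 \<or> poly (reversal d Q) 0 \<noteq> 0"
        using nonzero_inf unfolding poly_reversal_0 coeffs .
      show "reversal d Q \<noteq> 0"
        using reversal_nonzero degPQ Q by blast
      fix y
      have "reversal d P - smult y (reversal d Q) = reversal d (P - smult y Q)"
        using const_hom.binform_add[of d P "smult (- y) Q"] const_hom.binform_smult[of d "- y" Q] by simp
      then show "reversal d P - smult y (reversal d Q) \<noteq> 0"
        using reversal_nonzero[of "P - smult y Q" d] lin degPQ
        by (metis degree_diff_le degree_smult_le order_trans)
    next
      assume "form_zero n f (ratio (poly (reversal d P) 0) (poly (reversal d Q) 0))"
      then show "vanishing_order (reversal d P) (reversal d Q) 0 (ratio (poly (reversal d P) 0) (poly (reversal d Q) 0)) \<le> 1"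
        using unram[of Infty] unfolding poly_reversal_0 coeffs by (simp add: reversal_form P_def Q_def)
    qed
    then show ?thesis
      unfolding rev by blast
  qed
  then have "n * d \<le> degree F + 1"
    using order_reversal[OF degF] fin by simp
  moreover have "form_zero (n * d) F \<gamma> \<longleftrightarrow> (rat_map d a b ^^ Suc m) \<gamma> = Infty" for \<gamma>
  proof -
    have "form_zero (n * d) F \<gamma> \<longleftrightarrow> form_zero n f (rat_map d a b \<gamma>)"
    proof (cases \<gamma>)
      case (Fin x)
      then show ?thesis
        using binform_zero_iff[OF f(2) nonzero[of x]]
        by (simp add: form_zero_def F_def poly_form_comp P_def Q_def)
    next
      case Infty
      have "coeff F (n * d) = poly (reversal (n * d) F) 0"
        by (rule poly_reversal_0[symmetric])
      also have "\<dots> = binform (\<lambda>c. c) n f (a d) (b d)"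
        unfolding rev poly_form_comp[of n] poly_reversal_0 coeffs ..
      finally show ?thesis
        using binform_zero_iff[OF f(2) nonzero_inf] Infty by (simp add: form_zero_def)
    qed
    then show ?thesis
      using zero by (simp add: funpow_Suc_right del: funpow.simps)
  qed
  moreover have "d ^ Suc m = n * d"
    by (simp add: n_def)
  ultimately show ?case
    using fin unfolding F by metis
qed

section \<open>Separability over the ground field from simple roots in the algebraic closure\<close>

abbreviation ac_poly :: "'k::field poly \<Rightarrow> 'k alg_closure poly"
  where "ac_poly \<equiv> map_poly to_ac"

lemma ac_poly_add: "ac_poly (p + q) = ac_poly p + ac_poly q"
  by (rule poly_eqI) (simp add: coeff_map_poly)

lemma ac_poly_smult: "ac_poly (smult c p) = smult (to_ac c) (ac_poly p)"
  by (rule poly_eqI) (simp add: coeff_map_poly)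

lemma ac_poly_mult: "ac_poly (p * q) = ac_poly p * ac_poly q"
  by (induction p) (simp_all add: ac_poly_add ac_poly_smult map_poly_pCons)

lemma ac_poly_power: "ac_poly (p ^ n) = ac_poly p ^ n"
  by (induction n) (simp_all add: ac_poly_mult)

lemma ac_poly_sum: "ac_poly (\<Sum>i\<in>S. f i) = (\<Sum>i\<in>S. ac_poly (f i))"
  by (induction S rule: infinite_finite_induct) (simp_all add: ac_poly_add)

lemma ac_poly_pderiv: "ac_poly (pderiv p) = pderiv (ac_poly p)"
  by (rule poly_eqI) (simp add: coeff_map_poly coeff_pderiv)

lemma degree_ac_poly [simp]: "degree (ac_poly p) = degree p"
  by (rule degree_map_poly) simp

lemma ac_poly_form_comp: "ac_poly (form_comp n f P Q) = form_comp n (ac_poly f) (ac_poly P) (ac_poly Q)"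
  unfolding binform_def by (simp add: ac_poly_sum ac_poly_smult ac_poly_mult ac_poly_power coeff_map_poly)

lemma ac_poly_iterate_denominator:
  "ac_poly (iterate_denominator d P Q m) = iterate_denominator d (ac_poly P) (ac_poly Q) m"
  by (induction m) (simp_all add: ac_poly_form_comp)

lemma ac_poly_form: "ac_poly (form d a) = form d (\<lambda>i. to_ac (a i))"
  by (rule poly_eqI) (simp add: coeff_map_poly coeff_form)

text \<open>A nonconstant common divisor of f and its derivative would have a root in the closure,
  but the derivative does not vanish at a root of order 1.\<close>

lemma comaximal_pderivI:
  fixes f :: "'k::field poly"
  assumes "f \<noteq> 0" "\<And>y. Polynomial.order y (ac_poly f) \<le> 1"
  shows "comaximal f (pderiv f)"
proof -
  obtain g A B where g: "g \<noteq> 0" "f = g * A" "pderiv f = g * B" "comaximal A B"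
    using field_poly_gcd[of f "pderiv f"] assms(1) by blast
  have "degree g = 0"
  proof (rule ccontr)
    assume "degree g \<noteq> 0"
    then obtain x where x: "poly (ac_poly g) x = 0"
      using alg_closed_imp_poly_has_root[of "ac_poly g"] by auto
    have f0: "ac_poly f \<noteq> 0"
      using assms(1) by (simp add: map_poly_eq_0_iff)
    have "poly (ac_poly f) x = 0"
      using x unfolding g(2) by (simp add: ac_poly_mult)
    then have "Polynomial.order x (ac_poly f) = 1"
      using assms(2)[of x] f0 order_root[of "ac_poly f" x] by simp
    then obtain h where h: "ac_poly f = [:- x, 1:] * h" "\<not> [:- x, 1:] dvd h"
      using order_decomp[OF f0, of x] by auto
    have "poly (pderiv (ac_poly f)) x = poly h x"
      unfolding h(1) pderiv_mult by (simp add: pderiv_pCons)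
    moreover have "poly (pderiv (ac_poly f)) x = 0"
      using x unfolding ac_poly_pderiv[symmetric] g(3) by (simp add: ac_poly_mult)
    ultimately show False
      using h(2) by (simp add: poly_eq_0_iff_dvd)
  qed
  then obtain c where c: "g = [:c:]"
    by (rule degree_eq_zeroE)
  obtain s t where st: "s * A + t * B = 1"
    using g(4) unfolding comaximal_def by blast
  have "smult (inverse c) s * f + smult (inverse c) t * pderiv f = s * A + t * B"
    unfolding g(3) unfolding g(2) using g(1) by (simp add: c algebra_simps)
  then show ?thesis
    using st comaximalI by metis
qed

lemma iterate_denominator_separable:
  fixes a b :: "nat \<Rightarrow> 'k::field"
  assumes d: "d \<ge> 1" and ab: "is_ratfun d a b" and crit: "condition2 d a b"
  shows "comaximal (iterate_denominator d (form d a) (form d b) m) (pderiv (iterate_denominator d (form d a) (form d b) m))"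
    and "d ^ m \<le> degree (iterate_denominator d (form d a) (form d b) m) + 1"
proof -
  define a' where "a' = (\<lambda>i. to_ac (a i))"
  define b' where "b' = (\<lambda>i. to_ac (b i))"
  have forms: "ac_poly (form d a) = form d a'" "ac_poly (form d b) = form d b'"
    unfolding a'_def b'_def by (rule ac_poly_form)+
  obtain s t where st: "s * form d a + t * form d b = 1"
    using ab coprime_imp_comaximal unfolding is_ratfun_def comaximal_def by blast
  have "ac_poly s * form d a' + ac_poly t * form d b' = 1"
    using arg_cong[OF st, of ac_poly] by (simp add: ac_poly_add ac_poly_mult forms)
  then have 1: "comaximal (form d a') (form d b')"
    by (rule comaximalI)
  have 2: "max (degree (form d a')) (degree (form d b')) = d" "form d b' \<noteq> 0"
    using ab unfolding is_ratfun_def forms[symmetric] by (auto simp: map_poly_eq_0_iff)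
  define f where "f = iterate_denominator d (form d a) (form d b) m"
  have f: "ac_poly f = iterate_denominator d (form d a') (form d b') m"
    unfolding f_def ac_poly_iterate_denominator forms ..
  have "critical_point d a' b' \<gamma> \<Longrightarrow> Infty \<notin> forward_orbit (rat_map d a' b') \<gamma>" for \<gamma>
    using crit unfolding condition2_def Let_def a'_def b'_def by blast
  from simple_iterate_denominator[OF d 1 2 this, of m]
  have *: "ac_poly f \<noteq> 0" "d ^ m \<le> degree f + 1" "\<And>y. Polynomial.order y (ac_poly f) \<le> 1"
    unfolding f[symmetric] by auto
  then have "f \<noteq> 0"
    by auto
  then show "comaximal (iterate_denominator d (form d a) (form d b) m) (pderiv (iterate_denominator d (form d a) (form d b) m))"
    using comaximal_pderivI *(3) unfolding f_def by blast
  show "d ^ m \<le> degree (iterate_denominator d (form d a) (form d b) m) + 1"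
    using *(2) unfolding f_def .
qed


section \<open>Exponents for the iterated denominators\<close>

lemma approx_exponent_split:
  fixes E R :: "'q::field poly fract poly"
  assumes sep: "comaximal (E * R) (pderiv (E * R))"
    and E: "approx_exponent (degree E) E \<kappa>" and R: "approx_exponent (degree R) R \<kappa>"
  shows "approx_exponent (degree (E * R)) (E * R) \<kappa>"
proof -
  have "E * R \<noteq> 0"
    using sep by (auto simp: comaximal_def)
  then have "E \<noteq> 0" "R \<noteq> 0"
    by auto
  then have "comaximal_forms (degree E) E (degree R) R"
    using separable_factors(1)[OF sep] by (simp add: comaximal_forms_def)
  then show ?thesis
    using approx_exponent_mult[OF _ E R] \<open>E \<noteq> 0\<close> \<open>R \<noteq> 0\<close> by (simp add: degree_mult_eq)
qed

text \<open>If n = deg f + 1 the form has the extra factor Y, represented by the polynomial 1 in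
  degree 1; its Liouville exponent is 1.\<close>

lemma approx_exponent_root_at_infinity:
  fixes f :: "'q::field poly fract poly"
  assumes "f \<noteq> 0" "approx_exponent (degree f) f \<kappa>" "\<kappa> \<ge> 1" "degree f \<le> n" "n \<le> degree f + 1"
  shows "approx_exponent n f \<kappa>"
proof (cases "n = degree f")
  case False
  then have n: "n = 1 + degree f"
    using assms by simp
  have "comaximal_forms 1 1 (degree f) f"
    using assms(1) comaximal_sym[OF comaximal_1[of f]] by (simp add: comaximal_forms_def)
  then have "approx_exponent (1 + degree f) (1 * f) \<kappa>"
    using approx_exponent_mono[OF approx_exponent_degree assms(3)] assms(2) by (rule approx_exponent_mult)
  then show ?thesis
    by (simp add: n)
qed (use assms in simp)

text \<open>If level m fails because of a Riccati factor E, level m + 1 works. Its own factor E' can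
  only fail by being Riccati as well, and splits into the common part G with the pullback of E, and
  the rest H. By condition (1) the defect is nonzero, so it bounds deg G by 2 d + 1; and H divides
  the pullback of R, whose degree is about d ^ Suc m / 2. For both, Liouville's exponent stays
  within the target.\<close>

lemma denominator_exponent:
  fixes a b :: "nat \<Rightarrow> 'q::field poly fract" and d :: nat
  defines "f \<equiv> iterate_denominator d (form d a) (form d b)"
  assumes d: "d \<ge> 2" and ab: "is_ratfun d a b" and c1: "condition1 d a b" and c2: "condition2 d a b"
    and m: "d ^ m \<ge> 3"
  shows "\<exists>m'. m \<le> m' \<and> approx_exponent (d ^ m') (f m') (d ^ m' div 2 + 2 * d + 1)"
proof -
  define P where "P = form d a"
  define Q where "Q = form d b"
  define D where "D = d ^ m"
  have degPQ: "degree P \<le> d" "degree Q \<le> d"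
    unfolding P_def Q_def by (rule degree_form_le)+
  have PQ: "comaximal P Q"
    using ab coprime_imp_comaximal unfolding is_ratfun_def P_def Q_def by blast
  have sep: "comaximal (f k) (pderiv (f k))" and lower: "d ^ k \<le> degree (f k) + 1"
    and upper: "degree (f k) \<le> d ^ k" for k
    using iterate_denominator_separable[OF _ ab c2] degree_iterate_denominator[OF degPQ] d
    unfolding f_def P_def Q_def by auto
  have nz: "f k \<noteq> 0" for k
    using sep[of k] by (auto simp: comaximal_def)
  have finish: ?thesis if "m \<le> k" "f k = E * R" "approx_exponent (degree E) E \<kappa>" "approx_exponent (degree R) R \<kappa>"
    "\<kappa> \<le> d ^ k div 2 + 2 * d + 1" for k E R \<kappa>
  proof -
    have "approx_exponent (degree (f k)) (f k) (d ^ k div 2 + 2 * d + 1)"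
      unfolding that(2) using approx_exponent_mono[OF approx_exponent_split that(5)] sep[of k] that by simp
    then have "approx_exponent (d ^ k) (f k) (d ^ k div 2 + 2 * d + 1)"
      using approx_exponent_root_at_infinity[OF nz _ _ upper lower] by simp
    then show ?thesis
      using that(1) by blast
  qed
  have le: "degree (f k) div 2 + 1 \<le> d ^ k div 2 + 2 * d + 1" for k
    using div_le_mono[OF upper, of k 2] by linarith
  have deg2: "degree (f k) \<ge> 2" if "d ^ k \<ge> 3" for k
    using lower[of k] that by linarith
  obtain E R where ER: "f m = E * R" "degree R \<le> degree (f m) div 2 + 1" and
    E: "approx_exponent (degree E) E (degree (f m) div 2 + 1) \<or> (\<exists>B. degree B \<le> 2 \<and> roots_satisfy E 1 B)"
    using separable_decomposition[OF sep[of m] deg2[OF m]] by blast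
  show ?thesis
  proof (cases "approx_exponent (degree E) E (degree (f m) div 2 + 1)")
    case True
    then show ?thesis
      using finish[OF order_refl ER(1) True approx_exponent_mono[OF approx_exponent_degree ER(2)] le] by blast
  next
    case False
    then obtain B where B: "degree B \<le> 2" "roots_satisfy E 1 B"
      using E by blast
    have "3 \<le> d ^ Suc m"
      using m d mult_le_mono[of 1 d 3 "d ^ m"] by simp
    then obtain E' R' where ER': "f (Suc m) = E' * R'" "degree R' \<le> degree (f (Suc m)) div 2 + 1" and
      E': "approx_exponent (degree E') E' (degree (f (Suc m)) div 2 + 1) \<or> (\<exists>B. degree B \<le> 2 \<and> roots_satisfy E' 1 B)"
      using separable_decomposition[OF sep[of "Suc m"] deg2] by blast
    have R': "approx_exponent (degree R') R' (degree (f (Suc m)) div 2 + 1)"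
      by (rule approx_exponent_mono[OF approx_exponent_degree ER'(2)])
    show ?thesis
    proof (cases "approx_exponent (degree E') E' (degree (f (Suc m)) div 2 + 1)")
      case True
      then show ?thesis
        using finish[OF _ ER'(1) True R' le] by simp
    next
      case False
      then obtain V where V: "degree V \<le> 2" "roots_satisfy E' 1 V"
        using E' by blast
      have nzER: "E \<noteq> 0" "R \<noteq> 0" "E' \<noteq> 0" "R' \<noteq> 0"
        using nz[of m] nz[of "Suc m"] ER(1) ER'(1) by auto
      have sepE: "comaximal E (pderiv E)" and sepE': "comaximal E' (pderiv E')"
        using separable_factors(2) sep ER(1) ER'(1) by metis+
      have degf: "degree (f m) = degree E + degree R"
        using nzER unfolding ER(1) by (simp add: degree_mult_eq)
      \<comment> \<open>The degree of the cofactor of E as a form, including a possible zero at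
        infinity that deg R does not see.\<close>
      define l where "l = D - degree E"
      have l: "D = degree E + l" "degree R \<le> l" "l \<le> degree R + 1"
        using upper[of m] lower[of m] degf unfolding l_def D_def by auto
      define \<Phi> where "\<Phi> = form_comp (degree E) E P Q"
      define T where "T = form_comp l R P Q"
      have "f (Suc m) = form_comp D (f m) P Q"
        unfolding f_def P_def Q_def D_def by simp
      also have "\<dots> = \<Phi> * T"
        unfolding l(1) ER(1) \<Phi>_def T_def by (rule const_hom.binform_mult) (use l in auto)
      finally have fT: "E' * R' = \<Phi> * T"
        unfolding ER'(1) .
      then have "T \<noteq> 0" "\<Phi> \<noteq> 0"
        using nzER by auto
      obtain G H \<Phi>' where G: "G \<noteq> 0" "E' = G * H" "\<Phi> = G * \<Phi>'" "comaximal H \<Phi>'"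
        using field_poly_gcd[of E' \<Phi>] nzER by blast
      have "G * (H * R') = G * (\<Phi>' * T)"
        using fT unfolding G by (simp add: mult.assoc)
      then have "H * R' = \<Phi>' * T"
        using G(1) by (metis mult_cancel_left)
      then have "H dvd \<Phi>' * T"
        by (metis dvd_triv_left)
      then have "H dvd T"
        using comaximal_dvd_mult[OF G(4)] by blast
      then have "degree H \<le> degree T"
        using \<open>T \<noteq> 0\<close> by (rule dvd_imp_degree_le)
      also have "\<dots> \<le> l * d"
        unfolding T_def by (rule degree_form_comp[OF degPQ])
      \<comment> \<open>One unit comes from the bound on deg R and one from infinity; times d they
        give the 2 d in the target exponent.\<close>
      also have "l \<le> D div 2 + 2"
        using l ER(2) div_le_mono[OF upper[of m], of 2] unfolding D_def by linarith
      then have "l * d \<le> (D div 2) * d + 2 * d"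
        by (metis add_mult_distrib mult_le_mono1)
      also have "(D div 2) * d \<le> d ^ Suc m div 2"
      proof -
        have "2 * ((D div 2) * d) \<le> D * d"
          by (simp add: mult.assoc[symmetric])
        then have "(D div 2) * d \<le> (D * d) div 2"
          by linarith
        then show ?thesis
          unfolding D_def by (simp add: mult.commute)
      qed
      finally have H: "degree H \<le> d ^ Suc m div 2 + 2 * d"
        by simp
      have "roots_satisfy G 1 V"
        using roots_satisfy_factor sepE' V(2) unfolding G(2) by blast
      moreover have "G dvd form_comp (degree E) E P Q"
        using G(3) unfolding \<Phi>_def by simp
      ultimately have "G dvd transport_defect P Q V B"
        using riccati_preimage[OF PQ sepE B(2,1)] by blast
      moreover have "transport_defect P Q V B \<noteq> 0"
        unfolding P_def Q_def by (rule transport_defect_nonzero[OF c1 V(1) B(1)])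
      ultimately have "degree G \<le> degree (transport_defect P Q V B)"
        by (rule dvd_imp_degree_le)
      also have "\<dots> \<le> 2 * d + 1"
        using degree_transport_defect_le[OF degPQ _ V(1)] d by simp
      finally have degG: "degree G \<le> 2 * d + 1" .
      define \<kappa> where "\<kappa> = d ^ Suc m div 2 + 2 * d + 1"
      have "approx_exponent (degree E') E' \<kappa>"
        unfolding G(2)
      proof (rule approx_exponent_split)
        show "comaximal (G * H) (pderiv (G * H))"
          using sepE' unfolding G(2) .
        show "approx_exponent (degree G) G \<kappa>"
          by (rule approx_exponent_mono[OF approx_exponent_degree]) (use degG in \<open>simp add: \<kappa>_def\<close>)
        show "approx_exponent (degree H) H \<kappa>"
          by (rule approx_exponent_mono[OF approx_exponent_degree]) (use H in \<open>simp add: \<kappa>_def\<close>)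
      qed
      moreover have "approx_exponent (degree R') R' \<kappa>"
        using approx_exponent_mono[OF R' le] unfolding \<kappa>_def .
      ultimately show ?thesis
        using finish[OF _ ER'(1), of \<kappa>] unfolding \<kappa>_def by simp
    qed
  qed
qed


section \<open>Orbits\<close>

lemma ratio_scale: "w \<noteq> 0 \<Longrightarrow> ratio (w * x) (w * y) = ratio x y"
  by (simp add: ratio_def)

lemma quot_point_to_fract: "quot_point u v = ratio (to_fract u) (to_fract v)"
  by (simp add: quot_point_def to_fract_def)

lemma comaximal_nonzero: "comaximal u v \<Longrightarrow> u \<noteq> 0 \<or> v \<noteq> 0"
  for u v :: "'a::comm_ring_1"
  by (auto simp: comaximal_def)

lemma ratio_eq_imp_scale:
  fixes x y x' y' :: "'k::field"
  assumes "x \<noteq> 0 \<or> y \<noteq> 0" "x' \<noteq> 0 \<or> y' \<noteq> 0" "ratio x y = ratio x' y'"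
  obtains w where "w \<noteq> 0" "x = w * x'" "y = w * y'"
proof (cases "y = 0")
  case True
  then have "y' = 0" "x \<noteq> 0" "x' \<noteq> 0"
    using assms by (auto simp: ratio_def split: if_splits)
  then show ?thesis
    using that[of "x / x'"] True by simp
next
  case False
  then have "y' \<noteq> 0" "x / y = x' / y'"
    using assms by (auto simp: ratio_def split: if_splits)
  then show ?thesis
    using that[of "y / y'"] False by (simp add: field_simps)
qed

lemma binform_homogeneous: "binform (\<lambda>c. c) n f (w * u) (w * v) = w ^ n * binform (\<lambda>c. c) n f u v"
  unfolding binform_def sum_distrib_left
proof (intro sum.cong refl)
  fix i assume "i \<in> {..n}"
  then have "w ^ n = w ^ i * w ^ (n - i)"
    by (simp flip: power_add)
  then show "coeff f i * (w * u) ^ i * (w * v) ^ (n - i) = w ^ n * (coeff f i * u ^ i * v ^ (n - i))"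
    by (simp add: power_mult_distrib algebra_simps)
qed

lemma rat_map_ratio:
  fixes u v :: "'k::field"
  assumes "u \<noteq> 0 \<or> v \<noteq> 0"
  shows "rat_map d a b (ratio u v) =
    ratio (binform (\<lambda>c. c) d (form d a) u v) (binform (\<lambda>c. c) d (form d b) u v)"
proof (cases "v = 0")
  case True
  then have "ratio (u ^ d * a d) (u ^ d * b d) = ratio (a d) (b d)"
    using assms by (intro ratio_scale) simp
  then show ?thesis
    using True by (simp add: binform_infinity coeff_form mult.commute) (simp add: ratio_def)
next
  case False
  then show ?thesis
    using ratio_scale[of "v ^ d" "poly (form d a) (u / v)" "poly (form d b) (u / v)"]
    by (simp add: binform_dehomogenize degree_form_le ratio_def[of u v])
qed

lemma is_ratfun_comaximal_forms:
  assumes "is_ratfun d a b" "d \<ge> 1"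
  shows "comaximal_forms d (form d a) d (form d b)"
proof -
  have "degree (form d a) = d \<or> degree (form d b) = d"
    using assms unfolding is_ratfun_def by (metis max_def)
  then have "coeff (form d a) d \<noteq> 0 \<or> coeff (form d b) d \<noteq> 0"
    using assms(2) by (metis degree_0 leading_coeff_neq_0 not_one_le_zero)
  then show ?thesis
    using assms coprime_imp_comaximal unfolding is_ratfun_def comaximal_forms_def by (metis degree_form_le)
qed

lemma comaximal_forms_no_common_zero:
  fixes F G :: "'k::field poly"
  assumes "comaximal_forms m F n G" "u \<noteq> 0 \<or> v \<noteq> 0"
  shows "binform (\<lambda>c. c) m F u v \<noteq> 0 \<or> binform (\<lambda>c. c) n G u v \<noteq> 0"
proof (rule ccontr)
  assume *: "\<not> ?thesis"
  obtain s t s' t' where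
    1: "\<And>u v. binform (\<lambda>c. c) n s u v * binform (\<lambda>c. c) m F u v + binform (\<lambda>c. c) m t u v * binform (\<lambda>c. c) n G u v = u ^ (n + m)" and
    2: "\<And>u v. binform (\<lambda>c. c) n s' u v * binform (\<lambda>c. c) m F u v + binform (\<lambda>c. c) m t' u v * binform (\<lambda>c. c) n G u v = v ^ (n + m)"
    using comaximal_forms_powers[OF id_hom.coeff_hom_axioms assms(1)] by metis
  have "u ^ (n + m) = 0" "v ^ (n + m) = 0"
    using 1[of u v] 2[of u v] * by auto
  then show False
    using assms(2) by auto
qed

text \<open>The factor \<open>w\<close> is the cancellation between numerator and denominator.\<close>

lemma rat_map_quot_point_iff:
  fixes u v u' v' :: "'q::field poly"
  assumes "is_ratfun d a b" "d \<ge> 1" "comaximal u v" "comaximal u' v'"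
  shows "rat_map d a b (quot_point u v) = quot_point u' v' \<longleftrightarrow>
    (\<exists>w. w \<noteq> 0 \<and> fract_form d (form d a) (to_fract u) (to_fract v) = w * to_fract u' \<and>
      fract_form d (form d b) (to_fract u) (to_fract v) = w * to_fract v')"
proof -
  have uv: "to_fract u \<noteq> 0 \<or> to_fract v \<noteq> 0" "to_fract u' \<noteq> 0 \<or> to_fract v' \<noteq> 0"
    using assms comaximal_nonzero by auto
  note nz = comaximal_forms_no_common_zero[OF is_ratfun_comaximal_forms[OF assms(1,2)] uv(1)]
  show ?thesis
    unfolding quot_point_to_fract rat_map_ratio[OF uv(1)]
    using ratio_eq_imp_scale[OF nz uv(2)] ratio_scale by metis
qed

text \<open>Since u' and v' are comaximal, \<open>w\<close> is a polynomial combination of the two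
  values and thus integral up to a fixed denominator. Dividing by it therefore raises the height of
  the image by a bounded factor at most.\<close>

lemma scale_factor_lower:
  fixes a b :: "nat \<Rightarrow> 'q::field poly fract"
  obtains c where "c > 0" "\<And>u v u' v' w. comaximal u' v' \<Longrightarrow> w \<noteq> 0 \<Longrightarrow>
    fract_form d (form d a) (to_fract u) (to_fract v) = w * to_fract u' \<Longrightarrow>
    fract_form d (form d b) (to_fract u) (to_fract v) = w * to_fract v' \<Longrightarrow> c \<le> fract_norm w"
proof -
  obtain r1 where r1: "r1 \<noteq> 0" "\<And>u v. to_fract r1 * fract_form d (form d a) (to_fract u) (to_fract v) \<in> range to_fract"
    using fract_form_integral by blast
  obtain r2 where r2: "r2 \<noteq> 0" "\<And>u v. to_fract r2 * fract_form d (form d b) (to_fract u) (to_fract v) \<in> range to_fract"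
    using fract_form_integral by blast
  have r: "poly_norm (r1 * r2) > 0"
    using poly_norm_ge_1[of "r1 * r2"] r1 r2 by simp
  have "inverse (poly_norm (r1 * r2)) \<le> fract_norm w"
    if cop: "comaximal u' v'" and w: "w \<noteq> 0" and
      eq: "fract_form d (form d a) (to_fract u) (to_fract v) = w * to_fract u'"
      "fract_form d (form d b) (to_fract u) (to_fract v) = w * to_fract v'" for u v u' v' w
  proof -
    obtain s t where st: "s * u' + t * v' = 1"
      using cop unfolding comaximal_def by blast
    have "to_fract (r1 * r2) * w = to_fract (r1 * r2) * w * to_fract (s * u' + t * v')"
      unfolding st by simp
    also have "\<dots> = to_fract (s * r2) * (to_fract r1 * (w * to_fract u')) + to_fract (t * r1) * (to_fract r2 * (w * to_fract v'))"
      by (simp add: algebra_simps)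
    also have "\<dots> \<in> range to_fract"
      unfolding eq[symmetric] by (intro to_fract_range_add to_fract_range_mult[OF _ r1(2)] to_fract_range_mult[OF _ r2(2)] rangeI)
    finally have "to_fract (r1 * r2) * w \<in> range to_fract" .
    then have "fract_norm (to_fract (r1 * r2) * w) \<ge> 1"
      using w r1(1) r2(1) by (intro to_fract_range_norm) auto
    then have "1 \<le> poly_norm (r1 * r2) * fract_norm w"
      by (simp only: fract_norm_mult fract_norm_to_fract)
    then show ?thesis
      using r by (simp add: field_simps)
  qed
  then show ?thesis
    using that[of "inverse (poly_norm (r1 * r2))"] r by simp
qed

text \<open>Stated for the sequences \<open>A\<close> and \<open>B\<close> instead of the starting
  point, so that exchanging them gives the orbit of the reversed map. That orbit may start at
  infinity, which no \<alpha> in the field could represent.\<close>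

locale polynomial_orbit =
  fixes d :: nat and a b :: "nat \<Rightarrow> 'q::{field,finite} poly fract" and A B :: "nat \<Rightarrow> 'q poly"
  assumes d: "d \<ge> 2" and ratfun: "is_ratfun d a b"
    and coprime: "\<And>n. n \<ge> 1 \<Longrightarrow> comaximal (A n) (B n)"
    and step: "\<And>n. n \<ge> 1 \<Longrightarrow> rat_map d a b (quot_point (A n) (B n)) = quot_point (A (Suc n)) (B (Suc n))"
    and infinite_orbit: "infinite ((\<lambda>n. quot_point (A n) (B n)) ` {1..})"
begin

definition height :: "nat \<Rightarrow> real"
  where "height n = pair_norm (to_fract (A n)) (to_fract (B n))"

lemma orbit_funpow:
  assumes "n \<ge> 1"
  shows "(rat_map d a b ^^ k) (quot_point (A n) (B n)) = quot_point (A (n + k)) (B (n + k))"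
  using assms by (induction k) (simp_all add: step)

text \<open>One repetition would make the orbit eventually periodic, hence finite.\<close>

lemma orbit_inj: "inj_on (\<lambda>n. quot_point (A n) (B n)) {1..}"
proof (rule ccontr)
  let ?x = "\<lambda>n. quot_point (A n) (B n)"
  assume "\<not> ?thesis"
  then obtain i j where ij: "i \<ge> 1" "i < j" "?x i = ?x j"
    unfolding inj_on_def by (metis atLeast_iff linorder_neqE_nat)
  have "?x n \<in> ?x ` {1..j}" if "n \<ge> 1" for n
    using that
  proof (induction n rule: less_induct)
    case (less n)
    show ?case
    proof (cases "n \<le> j")
      case False
      have "?x n = (rat_map d a b ^^ (n - j)) (?x j)"
        using False ij by (simp add: orbit_funpow)
      also have "\<dots> = ?x (i + (n - j))"
        using ij by (metis orbit_funpow)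
      finally show ?thesis
        using less.IH[of "i + (n - j)"] ij False by simp
    qed (use less.prems in auto)
  qed
  then have "?x ` {1..} \<subseteq> ?x ` {1..j}"
    by auto
  then show False
    using infinite_orbit finite_subset by blast
qed

lemma finite_degree_le: "finite {p :: 'q poly. degree p \<le> k}"
proof (rule finite_subset)
  show "finite (Poly ` {xs :: 'q list. length xs \<le> Suc k})"
    using finite_lists_length_le[of "UNIV :: 'q set" "Suc k"] by simp
  show "{p :: 'q poly. degree p \<le> k} \<subseteq> Poly ` {xs. length xs \<le> Suc k}"
  proof
    fix p :: "'q poly" assume "p \<in> {p. degree p \<le> k}"
    then have "length (coeffs p) \<le> Suc k"
      by (cases "p = 0") (auto simp: length_coeffs_degree)
    then show "p \<in> Poly ` {xs. length xs \<le> Suc k}"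
      by (intro image_eqI[of _ _ "coeffs p"]) auto
  qed
qed

text \<open>Northcott's property: over a finite field only finitely many pairs have bounded degrees,
  and no pair recurs along the orbit.\<close>

lemma degree_unbounded: "eventually (\<lambda>n. degree (A n) > k \<or> degree (B n) > k) sequentially"
proof -
  define S where "S = {n. n \<ge> 1 \<and> degree (A n) \<le> k \<and> degree (B n) \<le> k}"
  have "finite S"
  proof (rule inj_on_finite)
    show "inj_on (\<lambda>n. (A n, B n)) S"
      using orbit_inj unfolding inj_on_def S_def by fastforce
    show "(\<lambda>n. (A n, B n)) ` S \<subseteq> {p. degree p \<le> k} \<times> {p. degree p \<le> k}"
      unfolding S_def by auto
  qed (use finite_degree_le in blast)
  then obtain N where "\<forall>n\<in>S. n < N"
    using finite_nat_set_iff_bounded by blast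
  then show ?thesis
    unfolding eventually_sequentially S_def
    by (intro exI[of _ "max 1 N"]) (metis (mono_tags, lifting) max.boundedE mem_Collect_eq not_le)
qed

lemma height_eq: "n \<ge> 1 \<Longrightarrow> height n = 2 ^ max (degree (A n)) (degree (B n))"
  using comaximal_nonzero[OF coprime[of n]]
  by (auto simp: height_def pair_norm_def poly_norm_def max_def power_le_zero_eq)

text \<open>The induction peels off the first application of \<phi>, as the recursion of
  \<open>iterate_denominator\<close> does; by homogeneity its cancellation factor enters with the
  power d ^ m. A lower bound for that factor controls the height, an upper bound controls the loss
  in the denominator. \<open>C\<close> depends on \<open>m\<close> but not on
  \<open>n\<close>.\<close>

lemma iterate_estimates:
  "\<exists>C. C > 0 \<and> (\<forall>n\<ge>1. height (n + m) \<le> C * height n ^ (d ^ m) \<and>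
    (\<exists>w. w \<noteq> 0 \<and> fract_norm w \<le> C \<and> fract_form (d ^ m) (iterate_denominator d (form d a) (form d b) m) (to_fract (A n)) (to_fract (B n))
        = w * to_fract (B (n + m))))"
proof (induction m)
  case 0
  show ?case
    by (intro exI[of _ 1]) (auto simp: id_hom.binform_1 intro!: exI[of _ 1])
next
  case (Suc m)
  define P where "P = form d a"
  define Q where "Q = form d b"
  define D where "D = d ^ m"
  define f where "f = iterate_denominator d P Q m"
  have degPQ: "degree P \<le> d" "degree Q \<le> d"
    unfolding P_def Q_def by (rule degree_form_le)+
  obtain C where C: "C > 0" "\<And>n. n \<ge> 1 \<Longrightarrow> height (n + m) \<le> C * height n ^ D"
    "\<And>n. n \<ge> 1 \<Longrightarrow> \<exists>w. w \<noteq> 0 \<and> fract_norm w \<le> C \<and> fract_form D f (to_fract (A n)) (to_fract (B n)) = w * to_fract (B (n + m))"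
    using Suc.IH unfolding P_def Q_def D_def f_def by blast
  obtain c where c: "c > 0" "\<And>u v u' v' w. comaximal u' v' \<Longrightarrow> w \<noteq> 0 \<Longrightarrow>
    fract_form d P (to_fract u) (to_fract v) = w * to_fract u' \<Longrightarrow>
    fract_form d Q (to_fract u) (to_fract v) = w * to_fract v' \<Longrightarrow> c \<le> fract_norm w"
    using scale_factor_lower unfolding P_def Q_def by blast
  have forms: "comaximal_forms d P d Q"
    unfolding P_def Q_def using is_ratfun_comaximal_forms[OF ratfun] d by simp
  obtain C1 where C1: "C1 > 0"
    "\<And>u v w x y. comaximal u v \<Longrightarrow> fract_form d P (to_fract u) (to_fract v) = w * to_fract x \<Longrightarrow>
      fract_form d Q (to_fract u) (to_fract v) = w * to_fract y \<Longrightarrow> fract_norm w \<le> C1"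
    using comaximal_forms_divisor[OF forms] by blast
  obtain CP where CP: "CP > 0" "\<And>u v. fract_norm (fract_form d P u v) \<le> CP * pair_norm u v ^ d"
    using fract_form_upper by blast
  obtain CQ where CQ: "CQ > 0" "\<And>u v. fract_norm (fract_form d Q u v) \<le> CQ * pair_norm u v ^ d"
    using fract_form_upper by blast
  define C2 where "C2 = (CP + CQ) / c"
  have "C2 > 0"
    unfolding C2_def using CP CQ c by simp
  have main: "height (n + Suc m) \<le> (C * C2 ^ D) * height n ^ (d ^ Suc m) \<and>
    (\<exists>w. w \<noteq> 0 \<and> fract_norm w \<le> C1 ^ D * C \<and> fract_form (d ^ Suc m) (iterate_denominator d P Q (Suc m)) (to_fract (A n)) (to_fract (B n))
        = w * to_fract (B (n + Suc m)))" if n: "n \<ge> 1" for n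
  proof
    obtain w where w: "w \<noteq> 0" "fract_form d P (to_fract (A n)) (to_fract (B n)) = w * to_fract (A (Suc n))"
      "fract_form d Q (to_fract (A n)) (to_fract (B n)) = w * to_fract (B (Suc n))"
      using rat_map_quot_point_iff[OF ratfun _ coprime[OF n] coprime] step[OF n] d unfolding P_def Q_def by auto
    have w_lower: "c \<le> fract_norm w"
      using c(2)[OF coprime w] n by simp
    have w_upper: "fract_norm w \<le> C1"
      using C1(2)[OF coprime[OF n] w(2,3)] .
    have h0: "height k \<ge> 0" for k
      by (simp add: height_def)
    have "c * poly_norm (A (Suc n)) \<le> CP * height n ^ d"
    proof -
      have "c * poly_norm (A (Suc n)) \<le> fract_norm w * poly_norm (A (Suc n))"
        using w_lower by (intro mult_right_mono) auto
      also have "\<dots> = fract_norm (fract_form d P (to_fract (A n)) (to_fract (B n)))"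
        unfolding w by (simp add: fract_norm_mult)
      also have "\<dots> \<le> CP * height n ^ d"
        unfolding height_def by (rule CP)
      finally show ?thesis .
    qed
    moreover have "c * poly_norm (B (Suc n)) \<le> CQ * height n ^ d"
    proof -
      have "c * poly_norm (B (Suc n)) \<le> fract_norm w * poly_norm (B (Suc n))"
        using w_lower by (intro mult_right_mono) auto
      also have "\<dots> = fract_norm (fract_form d Q (to_fract (A n)) (to_fract (B n)))"
        unfolding w by (simp add: fract_norm_mult)
      also have "\<dots> \<le> CQ * height n ^ d"
        unfolding height_def by (rule CQ)
      finally show ?thesis .
    qed
    moreover have "CP * height n ^ d \<le> (CP + CQ) * height n ^ d" "CQ * height n ^ d \<le> (CP + CQ) * height n ^ d"
      using CP CQ h0 by (auto intro: mult_right_mono)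
    moreover have "height (Suc n) = poly_norm (A (Suc n)) \<or> height (Suc n) = poly_norm (B (Suc n))"
      unfolding height_def pair_norm_def by (simp add: max_def)
    ultimately have "c * height (Suc n) \<le> (CP + CQ) * height n ^ d"
      by (metis order_trans)
    then have h1: "height (Suc n) \<le> C2 * height n ^ d"
      unfolding C2_def using c(1) by (simp add: field_simps)
    have "height (n + Suc m) \<le> C * height (Suc n) ^ D"
      using C(2)[of "Suc n"] by simp
    also have "\<dots> \<le> C * (C2 * height n ^ d) ^ D"
      using h1 h0 C(1) by (intro mult_left_mono power_mono) auto
    also have "\<dots> = (C * C2 ^ D) * height n ^ (d ^ Suc m)"
      by (simp add: power_mult_distrib D_def flip: power_mult)
    finally show "height (n + Suc m) \<le> (C * C2 ^ D) * height n ^ (d ^ Suc m)" .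
    obtain w' where w': "w' \<noteq> 0" "fract_norm w' \<le> C"
      "fract_form D f (to_fract (A (Suc n))) (to_fract (B (Suc n))) = w' * to_fract (B (Suc n + m))"
      using C(3)[of "Suc n"] by auto
    have "fract_form (d ^ Suc m) (iterate_denominator d P Q (Suc m)) (to_fract (A n)) (to_fract (B n))
      = fract_form (D * d) (form_comp D f P Q) (to_fract (A n)) (to_fract (B n))"
      unfolding D_def f_def by (simp add: mult.commute)
    also have "\<dots> = fract_form D f (w * to_fract (A (Suc n))) (w * to_fract (B (Suc n)))"
      unfolding w[symmetric] by (rule id_hom.binform_comp[OF degPQ])
        (use degree_iterate_denominator[OF degPQ] in \<open>simp add: f_def D_def\<close>)
    also have "\<dots> = (w ^ D * w') * to_fract (B (n + Suc m))"
      unfolding binform_homogeneous w'(3) by (simp add: mult.assoc)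
    finally have "fract_form (d ^ Suc m) (iterate_denominator d P Q (Suc m)) (to_fract (A n)) (to_fract (B n))
      = (w ^ D * w') * to_fract (B (n + Suc m))" .
    moreover have "w ^ D * w' \<noteq> 0"
      using w(1) w'(1) by simp
    moreover have "fract_norm (w ^ D * w') \<le> C1 ^ D * C"
      unfolding fract_norm_mult fract_norm_power using w_upper w'(2) C1(1)
      by (intro mult_mono power_mono) auto
    ultimately show "\<exists>w. w \<noteq> 0 \<and> fract_norm w \<le> C1 ^ D * C \<and> fract_form (d ^ Suc m) (iterate_denominator d P Q (Suc m)) (to_fract (A n)) (to_fract (B n))
        = w * to_fract (B (n + Suc m))"
      by blast
  qed
  define C' where "C' = max (C * C2 ^ D) (C1 ^ D * C)"
  have "C' > 0"
    unfolding C'_def using C(1) \<open>C2 > 0\<close> by (simp add: less_max_iff_disj)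
  moreover have "height (n + Suc m) \<le> C' * height n ^ (d ^ Suc m) \<and>
    (\<exists>w. w \<noteq> 0 \<and> fract_norm w \<le> C' \<and> fract_form (d ^ Suc m) (iterate_denominator d P Q (Suc m)) (to_fract (A n)) (to_fract (B n))
        = w * to_fract (B (n + Suc m)))" if n: "n \<ge> 1" for n
  proof -
    have "(C * C2 ^ D) * height n ^ (d ^ Suc m) \<le> C' * height n ^ (d ^ Suc m)"
      unfolding C'_def height_def by (intro mult_right_mono) auto
    moreover have "C1 ^ D * C \<le> C'"
      unfolding C'_def by simp
    ultimately show ?thesis
      using main[OF n] by (meson order_trans)
  qed
  ultimately show ?case
    unfolding P_def Q_def by blast
qed

text \<open>Logarithms of the previous estimates. The denominator at n + m is the form value divided
  by \<open>w\<close> of norm at most \<open>C\<close>, so cancellation costs only a bounded part of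
  the degree that the exponent guarantees.\<close>

lemma degree_estimates:
  assumes exponent: "approx_exponent (d ^ m) (iterate_denominator d (form d a) (form d b) m) \<kappa>"
    and "\<kappa> \<le> d ^ m"
  obtains C where "\<And>n. n \<ge> 1 \<Longrightarrow> B (n + m) \<noteq> 0 \<Longrightarrow>
      real (degree (A (n + m))) \<le> real (d ^ m) * real (max (degree (A n)) (degree (B n))) + C
      \<and> real (d ^ m - \<kappa>) * real (max (degree (A n)) (degree (B n))) - C \<le> real (degree (B (n + m)))"
proof -
  define D where "D = d ^ m"
  define f where "f = iterate_denominator d (form d a) (form d b) m"
  define h where "h n = max (degree (A n)) (degree (B n))" for n
  obtain C where C: "C > 0" "\<And>n. n \<ge> 1 \<Longrightarrow> height (n + m) \<le> C * height n ^ D"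
    "\<And>n. n \<ge> 1 \<Longrightarrow> \<exists>w. w \<noteq> 0 \<and> fract_norm w \<le> C \<and> fract_form D f (to_fract (A n)) (to_fract (B n)) = w * to_fract (B (n + m))"
    using iterate_estimates[of m] unfolding D_def f_def by blast
  obtain c where c: "c > 0" "\<And>u v. comaximal u v \<Longrightarrow> fract_form D f (to_fract u) (to_fract v) \<noteq> 0 \<Longrightarrow>
    c * pair_norm (to_fract u) (to_fract v) ^ D \<le>
      pair_norm (to_fract u) (to_fract v) ^ \<kappa> * fract_norm (fract_form D f (to_fract u) (to_fract v))"
    using exponent unfolding approx_exponent_def D_def f_def by blast
  define K where "K = max (log 2 C) (log 2 (C / c))"
  have "real (degree (A (n + m))) \<le> real D * real (h n) + K \<and>
      real (D - \<kappa>) * real (h n) - K \<le> real (degree (B (n + m)))"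
    if n: "n \<ge> 1" and B: "B (n + m) \<noteq> 0" for n
  proof
    have hn: "height n = 2 ^ h n"
      unfolding h_def by (rule height_eq[OF n])
    have "2 ^ degree (A (n + m)) \<le> (2::real) ^ h (n + m)"
      unfolding h_def by (intro power_increasing) auto
    also have "\<dots> = height (n + m)"
      unfolding h_def using height_eq[of "n + m"] n by simp
    also have "\<dots> \<le> C * 2 ^ (h n * D)"
      using C(2)[OF n] unfolding hn by (simp add: power_mult)
    finally have "log 2 (2 ^ degree (A (n + m))) \<le> log 2 (C * 2 ^ (h n * D))"
      using C(1) by (subst log_le_cancel_iff) auto
    also have "\<dots> = log 2 C + real (h n * D)"
      using C(1) by (simp add: log_mult log_nat_power)
    also have "\<dots> \<le> real D * real (h n) + K"
      by (simp add: K_def mult.commute)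
    finally show "real (degree (A (n + m))) \<le> real D * real (h n) + K"
      by (simp add: log_nat_power)
    obtain w where w: "w \<noteq> 0" "fract_norm w \<le> C" "fract_form D f (to_fract (A n)) (to_fract (B n)) = w * to_fract (B (n + m))"
      using C(3)[OF n] by blast
    have "c * (2 ^ h n) ^ D \<le> (2 ^ h n) ^ \<kappa> * (C * 2 ^ degree (B (n + m)))"
    proof -
      have "c * height n ^ D \<le> height n ^ \<kappa> * fract_norm (w * to_fract (B (n + m)))"
        using c(2)[OF coprime[OF n]] B w(1) unfolding w(3) height_def by simp
      also have "\<dots> \<le> height n ^ \<kappa> * (C * 2 ^ degree (B (n + m)))"
        using w(2) B C(1) unfolding fract_norm_mult
        by (intro mult_left_mono mult_mono) (auto simp: poly_norm_def height_def)
      finally show ?thesis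
        unfolding hn .
    qed
    moreover have "((2::real) ^ h n) ^ D = (2 ^ h n) ^ \<kappa> * (2 ^ h n) ^ (D - \<kappa>)"
      using assms(2) by (simp add: D_def flip: power_add)
    ultimately have "(2 ^ h n) ^ \<kappa> * (c * (2 ^ h n) ^ (D - \<kappa>)) \<le> (2 ^ h n) ^ \<kappa> * (C * 2 ^ degree (B (n + m)))"
      by (simp add: algebra_simps)
    then have "c * 2 ^ (h n * (D - \<kappa>)) \<le> C * 2 ^ degree (B (n + m))"
      by (simp add: power_mult)
    then have "2 ^ (h n * (D - \<kappa>)) \<le> C / c * 2 ^ degree (B (n + m))"
      using c(1) by (simp add: field_simps)
    then have "log 2 (2 ^ (h n * (D - \<kappa>))) \<le> log 2 (C / c * 2 ^ degree (B (n + m)))"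
      using C(1) c(1) by (subst log_le_cancel_iff) auto
    also have "\<dots> = log 2 (C / c) + real (degree (B (n + m)))"
      using C(1) c(1) by (subst log_mult) (auto simp: log_nat_power)
    also have "\<dots> \<le> K + real (degree (B (n + m)))"
      by (simp add: K_def)
    finally show "real (D - \<kappa>) * real (h n) - K \<le> real (degree (B (n + m)))"
      by (simp add: log_nat_power mult.commute)
  qed
  then show ?thesis
    using that[of K] unfolding D_def h_def by blast
qed

end


section \<open>From degree estimates to the upper limit\<close>

lemma unit_poly_degree: "p dvd 1 \<Longrightarrow> degree p = 0"
  for p :: "'k::field poly"
  by (metis degree_1 dvd_imp_degree_le le_zero_eq one_neq_zero)

context polynomial_orbit
begin

lemma eventually_denominator_nonzero: "eventually (\<lambda>n. B n \<noteq> 0) sequentially"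
  using degree_unbounded[of 0] eventually_ge_at_top[of 1]
proof eventually_elim
  case (elim n)
  show ?case
  proof
    assume B: "B n = 0"
    then have "A n dvd 1"
      using coprime[OF elim(2)] comaximal_common_dvd[of "A n" "B n" "A n"] by simp
    then show False
      using elim(1) B unit_poly_degree[of "A n"] by simp
  qed
qed

text \<open>First m is fixed, with D large in terms of d and \<epsilon>; then deg A is at most D h +
  O(1) and deg B at least (D / 2 - 2 d - 1) h - O(1), where h is the larger degree m steps earlier.
  The bounded terms depend on m and are absorbed because h tends to infinity with n.\<close>

lemma eventually_degree_le:
  assumes c1: "condition1 d a b" and c2: "condition2 d a b" and \<epsilon>: "\<epsilon> > 0"
  shows "eventually (\<lambda>n. real (degree (A n)) \<le> (2 + \<epsilon>) * real (degree (B n))) sequentially"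
proof -
  \<comment> \<open>The first entry yields D + 1 \<le> (2 + \<epsilon>) (D / 2 - 2 d - 1), the
    inequality \<open>gain\<close>; the second makes the exponent \<kappa> at most D and D at least
    3.\<close>
  define K where "K = max (2 / \<epsilon> * ((2 + \<epsilon>) * (2 * real d + 1) + 1)) (4 * real d + 3)"
  obtain m0 where m0: "K < real d ^ m0"
    using real_arch_pow[of "real d" K] d by auto
  have large: "K < real (d ^ m)" if "m \<ge> m0" for m
  proof -
    have "real d ^ m0 \<le> real d ^ m"
      using that d by (intro power_increasing) auto
    then show ?thesis
      using m0 by simp
  qed
  have "3 < real (d ^ m0)"
    using large[of m0] d unfolding K_def by simp
  then have "3 \<le> d ^ m0"
    by (metis less_imp_le of_nat_less_iff of_nat_numeral)
  then obtain m where m: "m0 \<le> m"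
    "approx_exponent (d ^ m) (iterate_denominator d (form d a) (form d b) m) (d ^ m div 2 + 2 * d + 1)"
    using denominator_exponent[OF d ratfun c1 c2] by blast
  define D where "D = d ^ m"
  define \<kappa> where "\<kappa> = D div 2 + 2 * d + 1"
  have D: "2 / \<epsilon> * ((2 + \<epsilon>) * (2 * real d + 1) + 1) < real D" "4 * real d + 3 < real D"
    using large[OF m(1)] unfolding K_def D_def by auto
  have "real (2 * (D div 2)) \<le> real D"
    by (rule of_nat_mono) simp
  then have half: "real (D div 2) \<le> real D / 2"
    by simp
  then have "real \<kappa> \<le> real D"
    using D(2) unfolding \<kappa>_def by simp
  then have \<kappa>: "\<kappa> \<le> D"
    by simp
  have lower: "real (D - \<kappa>) \<ge> real D / 2 - (2 * real d + 1)"
    using half \<kappa> by (simp add: \<kappa>_def of_nat_diff)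
  have "(2 + \<epsilon>) * (2 * real d + 1) + 1 < \<epsilon> / 2 * real D"
    using D(1) \<epsilon> by (simp add: field_simps)
  then have "real D + 1 \<le> (2 + \<epsilon>) * (real D / 2 - (2 * real d + 1))"
    by (simp add: algebra_simps)
  also have "\<dots> \<le> (2 + \<epsilon>) * real (D - \<kappa>)"
    using lower \<epsilon> by (intro mult_left_mono) auto
  finally have gain: "real D + 1 \<le> (2 + \<epsilon>) * real (D - \<kappa>)" .
  define h where "h n = max (degree (A n)) (degree (B n))" for n
  obtain C where C: "\<And>n. n \<ge> 1 \<Longrightarrow> B (n + m) \<noteq> 0 \<Longrightarrow>
      real (degree (A (n + m))) \<le> real D * real (h n) + C
      \<and> real (D - \<kappa>) * real (h n) - C \<le> real (degree (B (n + m)))"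
    using degree_estimates[OF m(2)] \<kappa> unfolding D_def \<kappa>_def h_def by blast
  \<comment> \<open>The spare h n in \<open>gain\<close> has to pay for \<open>C\<close> in the
    numerator and (2 + \<epsilon>) C in the denominator.\<close>
  obtain k :: nat where k: "(3 + \<epsilon>) * C \<le> real k"
    using real_arch_simple by blast
  have "eventually (\<lambda>n. real (degree (A (n + m))) \<le> (2 + \<epsilon>) * real (degree (B (n + m)))) sequentially"
    using degree_unbounded[of k] eventually_ge_at_top[of 1]
      iffD2[OF eventually_sequentially_seg eventually_denominator_nonzero, of m]
  proof eventually_elim
    case (elim n)
    have "real k \<le> real (h n)"
      using elim(1) unfolding h_def by auto
    then have h: "(3 + \<epsilon>) * C \<le> real (h n)"
      using k by linarith
    have "real (degree (A (n + m))) \<le> real D * real (h n) + C"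
      using C elim by blast
    also have "\<dots> \<le> (real D + 1) * real (h n) - (2 + \<epsilon>) * C"
      using h by (simp add: algebra_simps)
    also have "\<dots> \<le> (2 + \<epsilon>) * real (D - \<kappa>) * real (h n) - (2 + \<epsilon>) * C"
      using gain by (intro diff_right_mono mult_right_mono) (auto simp del: of_nat_diff)
    also have "\<dots> = (2 + \<epsilon>) * (real (D - \<kappa>) * real (h n) - C)"
      by (simp add: algebra_simps)
    also have "\<dots> \<le> (2 + \<epsilon>) * real (degree (B (n + m)))"
      using C elim \<epsilon> by (intro mult_left_mono) auto
    finally show ?case .
  qed
  then show ?thesis
    by (rule iffD1[OF eventually_sequentially_seg])
qed

text \<open>A constant denominator would force a constant numerator by the degree inequality, but
  some degree is positive for large n.\<close>

lemma eventually_denominator_nonconstant: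
  assumes "condition1 d a b" "condition2 d a b"
  shows "eventually (\<lambda>n. degree (B n) > 0) sequentially"
  using eventually_degree_le[OF assms, of 1] degree_unbounded[of 0]
  by (rule eventually_elim2) auto

lemma limsup_degree_ratio_le:
  assumes "condition1 d a b" "condition2 d a b"
  shows "limsup (\<lambda>n. degree_ratio (A n) (B n)) \<le> 2"
proof (rule ereal_le_epsilon2)
  fix \<epsilon> :: real assume \<epsilon>: "\<epsilon> > 0"
  have "eventually (\<lambda>n. degree_ratio (A n) (B n) \<le> ereal (2 + \<epsilon>)) sequentially"
    using eventually_degree_le[OF assms \<epsilon>] eventually_denominator_nonconstant[OF assms]
    by (rule eventually_elim2) (simp add: degree_ratio_def field_simps)
  then have "limsup (\<lambda>n. degree_ratio (A n) (B n)) \<le> ereal (2 + \<epsilon>)"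
    by (rule Limsup_bounded)
  then show "limsup (\<lambda>n. degree_ratio (A n) (B n)) \<le> 2 + ereal \<epsilon>"
    by simp
qed

lemma eventually_not_polynomial:
  assumes "condition1 d a b" "condition2 d a b"
  shows "eventually (\<lambda>n. quot_point (A n) (B n) \<notin> polynomial_points) sequentially"
  using eventually_denominator_nonconstant[OF assms] eventually_ge_at_top[of 1]
proof eventually_elim
  case (elim n)
  show ?case
  proof
    assume "quot_point (A n) (B n) \<in> polynomial_points"
    then obtain p where "quot_point (A n) (B n) = Fin (to_fract p)"
      unfolding polynomial_points_def to_fract_def by blast
    moreover have "B n \<noteq> 0"
      using elim(1) by auto
    ultimately have "to_fract (A n) = to_fract (p * B n)"
      by (simp add: quot_point_to_fract ratio_def field_simps)
    then have "A n = p * B n"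
      by (simp only: to_fract_eq_iff)
    then have "B n dvd A n"
      by simp
    then have "B n dvd 1"
      using comaximal_common_dvd[OF coprime[OF elim(2)]] by simp
    then show False
      using elim(1) unit_poly_degree[of "B n"] by simp
  qed
qed

end

section \<open>Conjugation by x -> 1/x and the lower limit\<close>

lemma binform_reversal:
  "binform (\<lambda>c. c) d (form d (rev_coeffs d a)) v u = binform (\<lambda>c. c) d (form d a) u v"
  unfolding binform_def
  by (rule sum.reindex_bij_witness[of _ "\<lambda>i. d - i" "\<lambda>i. d - i"])
    (auto simp: coeff_form rev_coeffs_def)

lemma is_ratfun_reversal:
  assumes "is_ratfun d a b" "d \<ge> 1"
  shows "is_ratfun d (rev_coeffs d b) (rev_coeffs d a)"
proof -
  define P where "P = form d a"
  define Q where "Q = form d b"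
  have PQ: "comaximal_forms d P d Q"
    unfolding P_def Q_def by (rule is_ratfun_comaximal_forms[OF assms])
  obtain s t s' t' where
    st: "\<And>u v. form_comp d s u v * form_comp d P u v + form_comp d t u v * form_comp d Q u v = u ^ (d + d)"
    using comaximal_forms_powers[OF const_hom.coeff_hom_axioms PQ] by metis
  \<comment> \<open>At the point (1, x) the pure power in the ideal of the two forms becomes 1, and
    the identity becomes a Bezout identity for the reversals.\<close>
  have cop: "comaximal (reversal d P) (reversal d Q)"
    using st[of 1 "[:0, 1:]"] by (intro comaximalI) auto
  have copPQ: "comaximal P Q"
    using PQ unfolding comaximal_forms_def by blast
  have "P \<noteq> 0"
  proof
    assume "P = 0"
    then have "Q dvd 1"
      using comaximal_common_dvd[OF copPQ, of Q] by simp
    then have "degree Q = 0"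
      by (rule unit_poly_degree)
    then show False
      using assms \<open>P = 0\<close> unfolding is_ratfun_def P_def[symmetric] Q_def[symmetric] by simp
  qed
  then have 1: "reversal d P \<noteq> 0"
    using reversal_nonzero unfolding P_def by (metis degree_form_le)
  have 2: "coprime (reversal d Q) (reversal d P)"
    using comaximal_common_dvd[OF cop] by (intro coprimeI) auto
  have le: "degree (reversal d P) \<le> d" "degree (reversal d Q) \<le> d"
    using degree_form_le unfolding P_def Q_def reversal_form[symmetric] by auto
  \<comment> \<open>The constant coefficients become the top ones. As 0 is not a common root of P
    and Q, the reversed quotient again has degree d.\<close>
  have "coeff P 0 \<noteq> 0 \<or> coeff Q 0 \<noteq> 0"
  proof (rule ccontr)
    assume "\<not> ?thesis"
    then have "poly P 0 = 0" "poly Q 0 = 0"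
      by (auto simp: poly_0_coeff_0)
    then have "poly (s * P + t * Q) 0 = 0" for s t
      by simp
    moreover obtain s t where "s * P + t * Q = 1"
      using copPQ unfolding comaximal_def by blast
    ultimately show False
      by (metis poly_1 one_neq_zero)
  qed
  then have "coeff (reversal d P) d \<noteq> 0 \<or> coeff (reversal d Q) d \<noteq> 0"
    unfolding P_def Q_def reversal_form[symmetric] by (auto simp: coeff_form rev_coeffs_def)
  then have "max (degree (reversal d Q)) (degree (reversal d P)) = d"
    using le le_degree[of "reversal d P" d] le_degree[of "reversal d Q" d] by linarith
  then show ?thesis
    using 1 2 unfolding is_ratfun_def reversal_form P_def Q_def by blast
qed

lemma (in polynomial_orbit) reversed_orbit: "polynomial_orbit d (rev_coeffs d b) (rev_coeffs d a) B A"
proof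
  show "d \<ge> 2"
    by (rule d)
  show rev: "is_ratfun d (rev_coeffs d b) (rev_coeffs d a)"
    using is_ratfun_reversal[OF ratfun] d by simp
  fix n :: nat assume n: "n \<ge> 1"
  then show cop: "comaximal (B n) (A n)"
    using coprime comaximal_sym by blast
  have cop': "comaximal (B (Suc n)) (A (Suc n))"
    using coprime[of "Suc n"] comaximal_sym by simp
  show "rat_map d (rev_coeffs d b) (rev_coeffs d a) (quot_point (B n) (A n)) = quot_point (B (Suc n)) (A (Suc n))"
    using rat_map_quot_point_iff[OF rev _ cop cop'] rat_map_quot_point_iff[OF ratfun _ coprime[OF n] coprime[of "Suc n"]]
      step[OF n] d by (auto simp: binform_reversal)
next
  define invert :: "'q poly fract P1 \<Rightarrow> 'q poly fract P1"
    where "invert w = (case w of Fin x \<Rightarrow> ratio 1 x | Infty \<Rightarrow> Fin 0)" for w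
  have "invert (quot_point (B n) (A n)) = quot_point (A n) (B n)" if "n \<ge> 1" for n
    using comaximal_nonzero[OF coprime[OF that]]
    by (auto simp: invert_def quot_point_to_fract ratio_def)
  then have "(\<lambda>n. quot_point (A n) (B n)) ` {1..} = invert ` (\<lambda>n. quot_point (B n) (A n)) ` {1..}"
    unfolding image_image by (intro image_cong) auto
  then show "infinite ((\<lambda>n. quot_point (B n) (A n)) ` {1..})"
    using infinite_orbit by (metis finite_imageI)
qed

lemma (in polynomial_orbit) liminf_degree_ratio_ge:
  assumes "condition1 d a b" "condition2 d a b"
    and rev: "condition1 d (rev_coeffs d b) (rev_coeffs d a)" "condition2 d (rev_coeffs d b) (rev_coeffs d a)"
  shows "1 / 2 \<le> liminf (\<lambda>n. degree_ratio (A n) (B n))"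
proof (rule ereal_le_epsilon2)
  interpret reversed: polynomial_orbit d "rev_coeffs d b" "rev_coeffs d a" B A
    by (rule reversed_orbit)
  fix \<delta> :: real assume \<delta>: "\<delta> > 0"
  \<comment> \<open>The choice 4 \<delta> works because (1/2 - \<delta>) (2 + 4 \<delta>) = 1 - 4
    \<delta>^2.\<close>
  have "eventually (\<lambda>n. ereal (1 / 2 - \<delta>) \<le> degree_ratio (A n) (B n)) sequentially"
    using reversed.eventually_degree_le[OF rev, of "4 * \<delta>"] eventually_denominator_nonconstant[OF assms(1,2)]
  proof (rule eventually_elim2)
    show "4 * \<delta> > 0"
      using \<delta> by simp
    fix n assume le: "real (degree (B n)) \<le> (2 + 4 * \<delta>) * real (degree (A n))" and pos: "0 < degree (B n)"
    have "(1 / 2 - \<delta>) * real (degree (B n)) \<le> real (degree (A n))"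
    proof (cases "\<delta> \<le> 1 / 2")
      case True
      then have "(1 / 2 - \<delta>) * real (degree (B n)) \<le> (1 / 2 - \<delta>) * ((2 + 4 * \<delta>) * real (degree (A n)))"
        using le by (intro mult_left_mono) auto
      also have "\<dots> = real (degree (A n)) - 4 * \<delta>\<^sup>2 * real (degree (A n))"
        by (simp add: algebra_simps power2_eq_square)
      also have "\<dots> \<le> real (degree (A n))"
        by simp
      finally show ?thesis .
    next
      case False
      then have "(1 / 2 - \<delta>) * real (degree (B n)) \<le> 0"
        by (intro mult_nonpos_nonneg) auto
      then show ?thesis
        by simp
    qed
    then show "ereal (1 / 2 - \<delta>) \<le> degree_ratio (A n) (B n)"
      using pos by (simp add: degree_ratio_def field_simps)
  qed
  then have "ereal (1 / 2 - \<delta>) \<le> liminf (\<lambda>n. degree_ratio (A n) (B n))"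
    by (rule Liminf_bounded)
  then have "ereal (1 / 2 - \<delta>) + ereal \<delta> \<le> liminf (\<lambda>n. degree_ratio (A n) (B n)) + ereal \<delta>"
    by (rule add_right_mono)
  moreover have "ereal (1 / 2 - \<delta>) + ereal \<delta> = 1 / 2"
    by (simp add: one_ereal_def numeral_eq_ereal)
  ultimately show "1 / 2 \<le> liminf (\<lambda>n. degree_ratio (A n) (B n)) + ereal \<delta>"
    by simp
qed

theorem theorem1p1:
  fixes d :: nat
    and a b :: "nat \<Rightarrow> 'q::{field,finite} poly fract"
    and \<alpha> :: "'q poly fract"
    and A B :: "nat \<Rightarrow> 'q poly"
  assumes "d \<ge> 2"
    and "is_ratfun d a b"
    and "condition1 d a b"
    and "condition2 d a b"
    and "wandering d a b \<alpha>"
    and "\<And>n. n \<ge> 1 \<Longrightarrow> coprime (A n) (B n)"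
    and "\<And>n. n \<ge> 1 \<Longrightarrow> (rat_map d a b ^^ n) (Fin \<alpha>) = quot_point (A n) (B n)"
  shows "limsup (\<lambda>n. degree_ratio (A n) (B n)) \<le> 2
    \<and> finite (forward_orbit (rat_map d a b) (Fin \<alpha>) \<inter> polynomial_points)
    \<and> (condition1 d (rev_coeffs d b) (rev_coeffs d a) \<and>
       condition2 d (rev_coeffs d b) (rev_coeffs d a) \<longrightarrow>
         1 / 2 \<le> liminf (\<lambda>n. degree_ratio (A n) (B n))
         \<and> liminf (\<lambda>n. degree_ratio (A n) (B n)) \<le> limsup (\<lambda>n. degree_ratio (A n) (B n))
         \<and> limsup (\<lambda>n. degree_ratio (A n) (B n)) \<le> 2)"
proof -
  note orbit = assms(7)
  have orbit_eq: "forward_orbit (rat_map d a b) (Fin \<alpha>) = (\<lambda>n. quot_point (A n) (B n)) ` {1..}"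
    unfolding forward_orbit_def using orbit by auto (metis One_nat_def Suc_le_eq)
  interpret polynomial_orbit d a b A B
  proof
    fix n :: nat assume n: "n \<ge> 1"
    show "comaximal (A n) (B n)"
      using assms(6)[OF n] by (rule coprime_imp_comaximal)
    show "rat_map d a b (quot_point (A n) (B n)) = quot_point (A (Suc n)) (B (Suc n))"
      using orbit[of "Suc n"] orbit[OF n] by simp
  next
    show "infinite ((\<lambda>n. quot_point (A n) (B n)) ` {1..})"
      using assms(5) unfolding wandering_def orbit_eq .
  qed fact+
  obtain N where N: "\<And>n. n \<ge> N \<Longrightarrow> quot_point (A n) (B n) \<notin> polynomial_points"
    using eventually_not_polynomial[OF assms(3,4)] unfolding eventually_sequentially by blast
  then have "forward_orbit (rat_map d a b) (Fin \<alpha>) \<inter> polynomial_points \<subseteq> (\<lambda>n. quot_point (A n) (B n)) ` {..<N}"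
    unfolding orbit_eq by (auto intro!: imageI) (meson not_le)
  then have "finite (forward_orbit (rat_map d a b) (Fin \<alpha>) \<inter> polynomial_points)"
    by (rule finite_subset) simp
  then show ?thesis
    using limsup_degree_ratio_le[OF assms(3,4)] liminf_degree_ratio_ge[OF assms(3,4)]
      Liminf_le_Limsup[of sequentially "\<lambda>n. degree_ratio (A n) (B n)"] by simp
qed

end
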